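(* Let $G(x_1,x_2,x_3,x_4)$ be a form of degree $2d\geq 4$ of the shape described in the context (with $p=0$), such that the equation $G(x_1,x_2,x_3,x_4)=0$ satisfies the properties $D_1$, $D_2$, $D_3$ described in the context. If, for some rational point $P$ on the surface $G=0$, the repeated application of the $RC$ operation yields an infinite sequence of distinct rational points $P,\ RC(P),\ (RC)^2(P),\ \ldots$ on the surface, then there is a curve of genus 0 or 1 on the surface $G(x_1,x_2,x_3,x_4)=0$.
   Context: The form $G$. Let $q$ be a parameter (a rational number), and put $$Q(x_1,x_2)=x_1^2+qx_2^2,\quad Q_1(x_1,x_2,x_3,x_4)=x_1x_3-qx_2x_4,\quad Q_2(x_1,x_2,x_3,x_4)=x_1x_4+x_2x_3$$ (the case $p=0$ of $Q=x_1^2+px_1x_2+qx_2^2$, $Q_1=x_1x_3-qx_2x_4$, $Q_2=x_1x_4+x_2x_3+px_2x_4$). Let $a_1,\dots,a_{12}$ be integers and let $$\begin{aligned} F(x_1,\dots,x_4)={}&a_1Q(x_1,x_2)Q(-x_1,x_2)+a_2Q_1(x_1,x_2,x_3,x_4)Q_1(-x_1,x_2,x_3,x_4)\\ &+a_3Q_2(x_1,x_2,x_3,x_4)Q_2(-x_1,x_2,x_3,x_4)\\ &+a_4\{Q(x_1,x_2)Q_1(-x_1,x_2,x_3,x_4)+Q(-x_1,x_2)Q_1(x_1,x_2,x_3,x_4)\}\\ &+a_5\{Q(x_1,x_2)Q_2(-x_1,x_2,x_3,x_4)+Q(-x_1,x_2)Q_2(x_1,x_2,x_3,x_4)\}\\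 &+(a_6x_1^2+a_7x_2^2+a_8x_2x_3+a_9x_2x_4+a_{10}x_3^2+a_{11}x_3x_4+a_{12}x_4^2)Q(x_3,x_4). \end{aligned}$$ Let $Q_{j+3}(x_1,x_2,x_3,x_4)$, $j=0,\dots,d-1$, be quadratic forms with rational coefficients in which $x_1$ occurs only in degree 2 (i.e. every monomial involving $x_1$ is a multiple of $x_1^2$), and let $b_0,\dots,b_{d-2}$ be integers. Then $$G(x_1,\dots,x_4)=\sum_{j=0}^{d-1}Q^{d-1-j}(x_1,x_2)Q^j(x_3,x_4)Q_{j+3}(x_1,\dots,x_4)+\Big\{\sum_{j=0}^{d-2}b_jQ^{d-2-j}(x_1,x_2)Q^j(x_3,x_4)\Big\}F(x_1,\dots,x_4).$$ One has $G(x_1,x_2,x_3,x_4)=G(-x_1,x_2,x_3,x_4)$ (property $D_2$). On substituting $$x_3=B_1:=m_1x_1+qm_2x_2,\qquad x_4=B_2:=m_2x_1-m_1x_2,$$ the equation $G=0$ takes the form $$Q^{d-1}(x_1,x_2)\{\phi_0(m_1,m_2)x_1^2+\phi_1(m_1,m_2)x_1x_2+\phi_2(m_1,m_2)x_2^2\}=0$$ with polynomials $\phi_0,\phi_1,\phi_2$. Points. Rational solutions of $G=0$ differing by a nonzero rational factor represent the same point; points considered satisfy $(x_1,x_2)\neq(0,0)$ and $(x_3,x_4)\neq(0,0)$. Property $D_1$: there is at least one integer solution of $G=0$ with $(x_1,x_2)\neq(0,0)$ and $(x_3,x_4)\neq(0,0)$. Property $D_2$: $G(x_1,x_2,x_3,x_4)=G(-x_1,x_2,x_3,x_4)$.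 Property $D_3$: (i) for all rational $(x_1,x_2)\neq(0,0)$ the forms $B_1,B_2$ are linearly independent linear forms in $m_1,m_2$, and for all rational $(m_1,m_2)\neq(0,0)$ they are linearly independent linear forms in $x_1,x_2$; (ii) $Q^{d-1}(x_1,x_2)=0$ has no rational solution other than $(0,0)$, and $\phi_0,\phi_1,\phi_2$ do not vanish simultaneously for any rational $(m_1,m_2)\neq(0,0)$. Operations. For a point $P=(\alpha_1,\alpha_2,\alpha_3,\alpha_4)$: the reflection is $R(P)=(-\alpha_1,\alpha_2,\alpha_3,\alpha_4)$. For the conjugate, let $(m_1,m_2)$ be the rational solution of $\alpha_3=m_1\alpha_1+qm_2\alpha_2$, $\alpha_4=m_2\alpha_1-m_1\alpha_2$; the quadratic $\phi_0(m_1,m_2)x_1^2+\phi_1(m_1,m_2)x_1x_2+\phi_2(m_1,m_2)x_2^2=0$ has the root $(\alpha_1:\alpha_2)$; let $(\beta_1:\beta_2)$ be the second root (with multiplicity). Then $C(P)=(\beta_1,\beta_2,m_1\beta_1+qm_2\beta_2,m_2\beta_1-m_1\beta_2)$. The $RC$ operation sends $P$ to $RC(P)=R(C(P))$. *)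

theory Defs
  imports Complex_Main "HOL-Computational_Algebra.Polynomial" "HOL-Algebra.Generated_Fields"
    "HOL-Algebra.Algebraic_Closure_Type"
begin

section \<open>The form \<open>G\<close>\<close>

text \<open>All forms are polymorphic polynomial functions with rational coefficients, so that they can
  be evaluated at rational and at complex points.\<close>

definition formQ :: "rat \<Rightarrow> 'a::field_char_0 \<Rightarrow> 'a \<Rightarrow> 'a" where
  "formQ q x1 x2 = x1^2 + of_rat q * x2^2"

definition formQ1 :: "rat \<Rightarrow> 'a::field_char_0 \<Rightarrow> 'a \<Rightarrow> 'a \<Rightarrow> 'a \<Rightarrow> 'a" where
  "formQ1 q x1 x2 x3 x4 = x1 * x3 - of_rat q * x2 * x4"

definition formQ2 :: "'a::field_char_0 \<Rightarrow> 'a \<Rightarrow> 'a \<Rightarrow> 'a \<Rightarrow> 'a" where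
  "formQ2 x1 x2 x3 x4 = x1 * x4 + x2 * x3"

definition formF :: "rat \<Rightarrow> (nat \<Rightarrow> int) \<Rightarrow> 'a::field_char_0 \<Rightarrow> 'a \<Rightarrow> 'a \<Rightarrow> 'a \<Rightarrow> 'a" where
  "formF q a x1 x2 x3 x4 =
     of_int (a 1) * formQ q x1 x2 * formQ q (- x1) x2
   + of_int (a 2) * formQ1 q x1 x2 x3 x4 * formQ1 q (- x1) x2 x3 x4
   + of_int (a 3) * formQ2 x1 x2 x3 x4 * formQ2 (- x1) x2 x3 x4
   + of_int (a 4) * (formQ q x1 x2 * formQ1 q (- x1) x2 x3 x4 + formQ q (- x1) x2 * formQ1 q x1 x2 x3 x4)
   + of_int (a 5) * (formQ q x1 x2 * formQ2 (- x1) x2 x3 x4 + formQ q (- x1) x2 * formQ2 x1 x2 x3 x4)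
   + (of_int (a 6) * x1^2 + of_int (a 7) * x2^2 + of_int (a 8) * x2 * x3 + of_int (a 9) * x2 * x4
      + of_int (a 10) * x3^2 + of_int (a 11) * x3 * x4 + of_int (a 12) * x4^2) * formQ q x3 x4"

text \<open>The general quadratic form with rational coefficients in which \<open>x1\<close> occurs only in the
  monomial \<open>x1\<^sup>2\<close>.\<close>

definition formEven :: "(nat \<Rightarrow> rat) \<Rightarrow> 'a::field_char_0 \<Rightarrow> 'a \<Rightarrow> 'a \<Rightarrow> 'a \<Rightarrow> 'a" where
  "formEven c x1 x2 x3 x4 =
     of_rat (c 1) * x1^2 + of_rat (c 2) * x2^2 + of_rat (c 3) * x3^2 + of_rat (c 4) * x4^2
   + of_rat (c 5) * x2 * x3 + of_rat (c 6) * x2 * x4 + of_rat (c 7) * x3 * x4"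

text \<open>\<open>c j\<close> is the coefficient vector of \<open>Q\<^bsub>j+3\<^esub>\<close>.\<close>

definition formG :: "rat \<Rightarrow> nat \<Rightarrow> (nat \<Rightarrow> nat \<Rightarrow> rat) \<Rightarrow> (nat \<Rightarrow> int) \<Rightarrow> (nat \<Rightarrow> int) \<Rightarrow>
    'a::field_char_0 \<Rightarrow> 'a \<Rightarrow> 'a \<Rightarrow> 'a \<Rightarrow> 'a" where
  "formG q d c b a x1 x2 x3 x4 =
     (\<Sum>j=0..d-1. formQ q x1 x2 ^ (d - 1 - j) * formQ q x3 x4 ^ j * formEven (c j) x1 x2 x3 x4)
   + (\<Sum>j=0..d-2. of_int (b j) * formQ q x1 x2 ^ (d - 2 - j) * formQ q x3 x4 ^ j)
       * formF q a x1 x2 x3 x4"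

definition formB1 :: "rat \<Rightarrow> rat \<Rightarrow> rat \<Rightarrow> rat \<Rightarrow> rat \<Rightarrow> rat" where
  "formB1 q m1 m2 x1 x2 = m1 * x1 + q * m2 * x2"

definition formB2 :: "rat \<Rightarrow> rat \<Rightarrow> rat \<Rightarrow> rat \<Rightarrow> rat" where
  "formB2 m1 m2 x1 x2 = m2 * x1 - m1 * x2"

text \<open>The defining identity of \<open>\<phi>\<^sub>0, \<phi>\<^sub>1, \<phi>\<^sub>2\<close>.  Lemmas \<open>residual_exists\<close> and \<open>residual_unique\<close> below
  show that it has exactly one solution.\<close>

definition residual_coeffs :: "rat \<Rightarrow> nat \<Rightarrow> (nat \<Rightarrow> nat \<Rightarrow> rat) \<Rightarrow> (nat \<Rightarrow> int) \<Rightarrow> (nat \<Rightarrow> int) \<Rightarrow>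
    (rat \<Rightarrow> rat \<Rightarrow> rat) \<Rightarrow> (rat \<Rightarrow> rat \<Rightarrow> rat) \<Rightarrow> (rat \<Rightarrow> rat \<Rightarrow> rat) \<Rightarrow> bool" where
  "residual_coeffs q d c b a \<phi>0 \<phi>1 \<phi>2 \<longleftrightarrow>
     (\<forall>m1 m2 x1 x2. formG q d c b a x1 x2 (formB1 q m1 m2 x1 x2) (formB2 m1 m2 x1 x2) =
        formQ q x1 x2 ^ (d - 1) * (\<phi>0 m1 m2 * x1^2 + \<phi>1 m1 m2 * x1 * x2 + \<phi>2 m1 m2 * x2^2))"

definition binary_quadratic :: "(rat \<Rightarrow> rat \<Rightarrow> rat) \<Rightarrow> bool" where
  "binary_quadratic h \<longleftrightarrow> (\<exists>f0 f1 f2. \<forall>x1 x2. h x1 x2 = f0 * x1^2 + f1 * x1 * x2 + f2 * x2^2)"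

lemma binary_quadratic_add:
  assumes "binary_quadratic g" "binary_quadratic h"
  shows "binary_quadratic (\<lambda>x1 x2. g x1 x2 + h x1 x2)"
proof -
  obtain g0 g1 g2 h0 h1 h2
    where "\<forall>x1 x2. g x1 x2 = g0 * x1^2 + g1 * x1 * x2 + g2 * x2^2"
      and "\<forall>x1 x2. h x1 x2 = h0 * x1^2 + h1 * x1 * x2 + h2 * x2^2"
    using assms unfolding binary_quadratic_def by blast
  then show ?thesis
    unfolding binary_quadratic_def
    by (intro exI[of _ "g0 + h0"] exI[of _ "g1 + h1"] exI[of _ "g2 + h2"])
      (simp add: algebra_simps)
qed

lemma binary_quadratic_scale:
  assumes "binary_quadratic h"
  shows "binary_quadratic (\<lambda>x1 x2. r * h x1 x2)"
proof -
  obtain h0 h1 h2 where "\<forall>x1 x2. h x1 x2 = h0 * x1^2 + h1 * x1 * x2 + h2 * x2^2"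
    using assms unfolding binary_quadratic_def by blast
  then show ?thesis
    unfolding binary_quadratic_def
    by (intro exI[of _ "r * h0"] exI[of _ "r * h1"] exI[of _ "r * h2"])
      (simp add: algebra_simps)
qed

lemma binary_quadratic_prod:
  "binary_quadratic (\<lambda>x1 x2. (r * x1 + s * x2) * (t * x1 + u * x2))"
  unfolding binary_quadratic_def
  by (intro exI[of _ "r * t"] exI[of _ "r * u + s * t"] exI[of _ "s * u"])
    (simp add: algebra_simps power2_eq_square)

lemma binary_quadratic_sum:
  assumes "finite A" "\<And>j. j \<in> A \<Longrightarrow> binary_quadratic (h j)"
  shows "binary_quadratic (\<lambda>x1 x2. \<Sum>j\<in>A. h j x1 x2)"
  using assms
proof (induction A rule: finite_induct)
  case empty
  then show ?case
    unfolding binary_quadratic_def by (intro exI[of _ 0]) simp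
next
  case (insert j A)
  then show ?case by (simp add: binary_quadratic_add)
qed

lemma formQ_B: "formQ q (formB1 q m1 m2 x1 x2) (formB2 m1 m2 x1 x2) = formQ q x1 x2 * formQ q m1 m2"
  by (simp add: formQ_def formB1_def formB2_def power2_eq_square algebra_simps)

lemma formF_B:
  "\<exists>e. binary_quadratic e \<and>
     (\<forall>x1 x2. formF q a x1 x2 (formB1 q m1 m2 x1 x2) (formB2 m1 m2 x1 x2) = formQ q x1 x2 * e x1 x2)"
proof -
  let ?l1 = "\<lambda>x1 x2. (- 1 * x1 + 0 * x2) * (m1 * x1 + q * m2 * x2)"
  let ?l2 = "\<lambda>x1 x2. (0 * x1 + - q * x2) * (m2 * x1 + - m1 * x2)"
  let ?l3 = "\<lambda>x1 x2. (- 1 * x1 + 0 * x2) * (m2 * x1 + - m1 * x2)"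
  let ?l4 = "\<lambda>x1 x2. (0 * x1 + 1 * x2) * (m1 * x1 + q * m2 * x2)"
  let ?l5 = "\<lambda>x1 x2. (1 * x1 + 0 * x2) * (1 * x1 + 0 * x2)"
  let ?l6 = "\<lambda>x1 x2. (0 * x1 + 1 * x2) * (0 * x1 + 1 * x2)"
  let ?l7 = "\<lambda>x1 x2. (0 * x1 + 1 * x2) * (m2 * x1 + - m1 * x2)"
  let ?l8 = "\<lambda>x1 x2. (m1 * x1 + q * m2 * x2) * (m1 * x1 + q * m2 * x2)"
  let ?l9 = "\<lambda>x1 x2. (m1 * x1 + q * m2 * x2) * (m2 * x1 + - m1 * x2)"
  let ?l10 = "\<lambda>x1 x2. (m2 * x1 + - m1 * x2) * (m2 * x1 + - m1 * x2)"
  let ?A = "\<lambda>i. rat_of_int (a i)"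
  let ?N = "formQ q m1 m2"
  define e where "e = (\<lambda>x1 x2.
      (?A 1 + ?A 4 * m1 + ?A 5 * m2 + ?A 6 * ?N) * ?l5 x1 x2
    + ((?A 1 + ?A 4 * m1 + ?A 5 * m2) * q + ?A 7 * ?N) * ?l6 x1 x2
    + (?A 2 * m1 + ?A 4) * (?l1 x1 x2 + ?l2 x1 x2)
    + (?A 3 * m2 + ?A 5) * (?l3 x1 x2 + ?l4 x1 x2)
    + ?A 8 * ?N * ?l4 x1 x2 + ?A 9 * ?N * ?l7 x1 x2
    + ?A 10 * ?N * ?l8 x1 x2 + ?A 11 * ?N * ?l9 x1 x2 + ?A 12 * ?N * ?l10 x1 x2)"
  have "binary_quadratic e"
    unfolding e_def
    by (intro binary_quadratic_add binary_quadratic_scale binary_quadratic_prod)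
  moreover have "formF q a x1 x2 (formB1 q m1 m2 x1 x2) (formB2 m1 m2 x1 x2)
      = formQ q x1 x2 * e x1 x2" for x1 x2
  proof -
    have 1: "formQ1 q x1 x2 (formB1 q m1 m2 x1 x2) (formB2 m1 m2 x1 x2) = m1 * formQ q x1 x2"
      by (simp add: formQ_def formQ1_def formB1_def formB2_def power2_eq_square algebra_simps)
    have 2: "formQ2 x1 x2 (formB1 q m1 m2 x1 x2) (formB2 m1 m2 x1 x2) = m2 * formQ q x1 x2"
      by (simp add: formQ_def formQ2_def formB1_def formB2_def power2_eq_square algebra_simps)
    have 3: "formQ1 q (- x1) x2 (formB1 q m1 m2 x1 x2) (formB2 m1 m2 x1 x2) = ?l1 x1 x2 + ?l2 x1 x2"
      by (simp add: formQ1_def formB1_def formB2_def algebra_simps)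
    have 4: "formQ2 (- x1) x2 (formB1 q m1 m2 x1 x2) (formB2 m1 m2 x1 x2) = ?l3 x1 x2 + ?l4 x1 x2"
      by (simp add: formQ2_def formB1_def formB2_def algebra_simps)
    have 5: "formQ q (- x1) x2 = formQ q x1 x2" by (simp add: formQ_def)
    have 6: "formQ q x1 x2 = ?l5 x1 x2 + q * ?l6 x1 x2"
      by (simp add: formQ_def power2_eq_square)
    define y where "y = formQ q x1 x2"
    have 7: "e x1 x2 = ?A 1 * y + (?A 2 * m1 + ?A 4) * (?l1 x1 x2 + ?l2 x1 x2)
      + (?A 3 * m2 + ?A 5) * (?l3 x1 x2 + ?l4 x1 x2) + (?A 4 * m1 + ?A 5 * m2) * y
      + (?A 6 * x1^2 + ?A 7 * x2^2 + ?A 8 * x2 * formB1 q m1 m2 x1 x2 + ?A 9 * x2 * formB2 m1 m2 x1 x2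
      + ?A 10 * formB1 q m1 m2 x1 x2^2 + ?A 11 * formB1 q m1 m2 x1 x2 * formB2 m1 m2 x1 x2
      + ?A 12 * formB2 m1 m2 x1 x2^2) * ?N"
      unfolding e_def y_def 6 formB1_def formB2_def
      by (simp add: power2_eq_square algebra_simps)
    show ?thesis
      unfolding formF_def formQ_B 1 2 3 4 5 7 unfolding y_def
      by (simp add: algebra_simps)
  qed
  ultimately show ?thesis by blast
qed

lemma formEven_B: "binary_quadratic (\<lambda>x1 x2. formEven c x1 x2 (formB1 q m1 m2 x1 x2) (formB2 m1 m2 x1 x2))"
proof -
  have "(\<lambda>x1 x2. formEven c x1 x2 (formB1 q m1 m2 x1 x2) (formB2 m1 m2 x1 x2)) =
    (\<lambda>x1 x2. c 1 * ((1 * x1 + 0 * x2) * (1 * x1 + 0 * x2))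
      + c 2 * ((0 * x1 + 1 * x2) * (0 * x1 + 1 * x2))
      + c 3 * ((m1 * x1 + q * m2 * x2) * (m1 * x1 + q * m2 * x2))
      + c 4 * ((m2 * x1 + - m1 * x2) * (m2 * x1 + - m1 * x2))
      + c 5 * ((0 * x1 + 1 * x2) * (m1 * x1 + q * m2 * x2))
      + c 6 * ((0 * x1 + 1 * x2) * (m2 * x1 + - m1 * x2))
      + c 7 * ((m1 * x1 + q * m2 * x2) * (m2 * x1 + - m1 * x2)))"
    by (simp add: formEven_def formB1_def formB2_def power2_eq_square mult.assoc)
  moreover have "binary_quadratic \<dots>"
    by (intro binary_quadratic_add binary_quadratic_scale binary_quadratic_prod)
  ultimately show ?thesis by simp
qed

lemma residual_exists:
  assumes "d \<ge> 2"
  shows "\<exists>\<phi>0 \<phi>1 \<phi>2. residual_coeffs q d c b a \<phi>0 \<phi>1 \<phi>2"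
proof -
  have "\<exists>f. \<forall>x1 x2. formG q d c b a x1 x2 (formB1 q m1 m2 x1 x2) (formB2 m1 m2 x1 x2) =
      formQ q x1 x2 ^ (d - 1) * (fst f * x1^2 + fst (snd f) * x1 * x2 + snd (snd f) * x2^2)" for m1 m2
  proof -
    let ?N = "formQ q m1 m2"
    obtain e where e: "binary_quadratic e"
      "\<And>x1 x2. formF q a x1 x2 (formB1 q m1 m2 x1 x2) (formB2 m1 m2 x1 x2) = formQ q x1 x2 * e x1 x2"
      using formF_B by metis
    define h where "h = (\<lambda>x1 x2.
      (\<Sum>j=0..d-1. ?N ^ j * formEven (c j) x1 x2 (formB1 q m1 m2 x1 x2) (formB2 m1 m2 x1 x2))
      + (\<Sum>j=0..d-2. of_int (b j) * ?N ^ j) * e x1 x2)"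
    have "binary_quadratic h"
      unfolding h_def
      by (intro binary_quadratic_add binary_quadratic_scale binary_quadratic_sum formEven_B e) simp
    then obtain f0 f1 f2 where f: "\<And>x1 x2. h x1 x2 = f0 * x1^2 + f1 * x1 * x2 + f2 * x2^2"
      unfolding binary_quadratic_def by blast
    have "formG q d c b a x1 x2 (formB1 q m1 m2 x1 x2) (formB2 m1 m2 x1 x2)
        = formQ q x1 x2 ^ (d - 1) * h x1 x2" for x1 x2
    proof -
      let ?y = "formQ q x1 x2" and ?x3 = "formB1 q m1 m2 x1 x2" and ?x4 = "formB2 m1 m2 x1 x2"
      have "(\<Sum>j=0..d-1. ?y ^ (d - 1 - j) * (?y * ?N) ^ j * formEven (c j) x1 x2 ?x3 ?x4) =
        (\<Sum>j=0..d-1. ?y ^ (d - 1) * (?N ^ j * formEven (c j) x1 x2 ?x3 ?x4))"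
      proof (rule sum.cong)
        fix j assume "j \<in> {0..d-1}"
        then have "d - 1 = (d - 1 - j) + j" by simp
        then have "?y ^ (d - 1) = ?y ^ (d - 1 - j) * ?y ^ j"
          by (metis power_add)
        then show "?y ^ (d - 1 - j) * (?y * ?N) ^ j * formEven (c j) x1 x2 ?x3 ?x4 =
          ?y ^ (d - 1) * (?N ^ j * formEven (c j) x1 x2 ?x3 ?x4)"
          by (simp add: power_mult_distrib)
      qed simp
      moreover have "(\<Sum>j=0..d-2. of_int (b j) * ?y ^ (d - 2 - j) * (?y * ?N) ^ j) =
        (\<Sum>j=0..d-2. ?y ^ (d - 2) * (of_int (b j) * ?N ^ j))"
      proof (rule sum.cong)
        fix j assume "j \<in> {0..d-2}"
        then have "d - 2 = (d - 2 - j) + j" by simp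
        then have "?y ^ (d - 2) = ?y ^ (d - 2 - j) * ?y ^ j"
          by (metis power_add)
        then show "of_int (b j) * ?y ^ (d - 2 - j) * (?y * ?N) ^ j =
          ?y ^ (d - 2) * (of_int (b j) * ?N ^ j)"
          by (simp add: power_mult_distrib)
      qed simp
      moreover have "?y ^ (d - 1) = ?y ^ (d - 2) * ?y"
      proof -
        have "d - 1 = Suc (d - 2)" using assms by simp
        then show ?thesis by simp
      qed
      ultimately show ?thesis
        unfolding formG_def h_def formQ_B e(2)
        by (simp add: distrib_left sum_distrib_left[symmetric])
    qed
    then show ?thesis by (intro exI[of _ "(f0, f1, f2)"]) (simp add: f)
  qed
  then obtain f where "\<And>m1 m2 x1 x2.
      formG q d c b a x1 x2 (formB1 q m1 m2 x1 x2) (formB2 m1 m2 x1 x2) =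
      formQ q x1 x2 ^ (d - 1) *
        (fst (f m1 m2) * x1^2 + fst (snd (f m1 m2)) * x1 * x2 + snd (snd (f m1 m2)) * x2^2)"
    by metis
  then have "residual_coeffs q d c b a (\<lambda>m1 m2. fst (f m1 m2)) (\<lambda>m1 m2. fst (snd (f m1 m2)))
      (\<lambda>m1 m2. snd (snd (f m1 m2)))"
    unfolding residual_coeffs_def by blast
  then show ?thesis by blast
qed

lemma residual_unique:
  assumes "residual_coeffs q d c b a \<phi>0 \<phi>1 \<phi>2" and "residual_coeffs q d c b a \<psi>0 \<psi>1 \<psi>2"
  shows "\<phi>0 = \<psi>0 \<and> \<phi>1 = \<psi>1 \<and> \<phi>2 = \<psi>2"
proof -
  have "\<phi>0 m1 m2 = \<psi>0 m1 m2 \<and> \<phi>1 m1 m2 = \<psi>1 m1 m2 \<and> \<phi>2 m1 m2 = \<psi>2 m1 m2" for m1 m2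
  proof -
    define u v w where "u = \<phi>0 m1 m2 - \<psi>0 m1 m2" and "v = \<phi>1 m1 m2 - \<psi>1 m1 m2"
      and "w = \<phi>2 m1 m2 - \<psi>2 m1 m2"
    have z: "u * x1^2 + v * x1 * x2 + w * x2^2 = 0" if "formQ q x1 x2 \<noteq> 0" for x1 x2
    proof -
      have "formQ q x1 x2 ^ (d - 1) * (\<phi>0 m1 m2 * x1^2 + \<phi>1 m1 m2 * x1 * x2 + \<phi>2 m1 m2 * x2^2)
        = formQ q x1 x2 ^ (d - 1) * (\<psi>0 m1 m2 * x1^2 + \<psi>1 m1 m2 * x1 * x2 + \<psi>2 m1 m2 * x2^2)"
        using assms unfolding residual_coeffs_def by metis
      then have "\<phi>0 m1 m2 * x1^2 + \<phi>1 m1 m2 * x1 * x2 + \<phi>2 m1 m2 * x2^2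
        = \<psi>0 m1 m2 * x1^2 + \<psi>1 m1 m2 * x1 * x2 + \<psi>2 m1 m2 * x2^2"
        using that by simp
      then show ?thesis unfolding u_def v_def w_def by (simp add: algebra_simps)
    qed
    have u: "u = 0" using z[of 1 0] by (simp add: formQ_def)
    have n: "v * n + w = 0" if "n^2 + q \<noteq> 0" for n
      using z[of n 1] that u by (simp add: formQ_def)
    have "v = 0 \<and> w = 0"
      using n[of 1] n[of 2] n[of 3] by (cases "q = -1"; cases "q = -4"; simp)
    then show ?thesis using u unfolding u_def v_def w_def by simp
  qed
  then show ?thesis by blast
qed

section \<open>Points and the properties \<open>D\<^sub>1\<close>, \<open>D\<^sub>2\<close>, \<open>D\<^sub>3\<close>\<close>

type_synonym 'a quad = "'a \<times> 'a \<times> 'a \<times> 'a"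

definition surface :: "rat \<Rightarrow> nat \<Rightarrow> (nat \<Rightarrow> nat \<Rightarrow> rat) \<Rightarrow> (nat \<Rightarrow> int) \<Rightarrow> (nat \<Rightarrow> int) \<Rightarrow>
    'a::field_char_0 quad set" where
  "surface q d c b a = {(x1, x2, x3, x4). formG q d c b a x1 x2 x3 x4 = 0}"

definition admissible :: "'a::zero quad set" where
  "admissible = {(x1, x2, x3, x4). (x1, x2) \<noteq> (0, 0) \<and> (x3, x4) \<noteq> (0, 0)}"

definition same_point :: "'a::field quad \<Rightarrow> 'a quad \<Rightarrow> bool" where
  "same_point = (\<lambda>(x1, x2, x3, x4) y. \<exists>l. l \<noteq> 0 \<and> y = (l * x1, l * x2, l * x3, l * x4))"

definition D1 :: "rat \<Rightarrow> nat \<Rightarrow> (nat \<Rightarrow> nat \<Rightarrow> rat) \<Rightarrow> (nat \<Rightarrow> int) \<Rightarrow> (nat \<Rightarrow> int) \<Rightarrow> bool" where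
  "D1 q d c b a \<longleftrightarrow>
     (\<exists>x1 x2 x3 x4 :: int. (x1, x2) \<noteq> (0, 0) \<and> (x3, x4) \<noteq> (0, 0) \<and>
        formG q d c b a (rat_of_int x1) (of_int x2) (of_int x3) (of_int x4) = 0)"

definition D2 :: "rat \<Rightarrow> nat \<Rightarrow> (nat \<Rightarrow> nat \<Rightarrow> rat) \<Rightarrow> (nat \<Rightarrow> int) \<Rightarrow> (nat \<Rightarrow> int) \<Rightarrow> bool" where
  "D2 q d c b a \<longleftrightarrow>
     (\<forall>x1 x2 x3 x4 :: rat. formG q d c b a x1 x2 x3 x4 = formG q d c b a (- x1) x2 x3 x4)"

definition independent_linear_forms :: "(rat \<Rightarrow> rat \<Rightarrow> rat) \<Rightarrow> (rat \<Rightarrow> rat \<Rightarrow> rat) \<Rightarrow> bool" where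
  "independent_linear_forms L L' \<longleftrightarrow>
     (\<forall>r s. (\<forall>u v. r * L u v + s * L' u v = 0) \<longrightarrow> r = 0 \<and> s = 0)"

definition D3 :: "rat \<Rightarrow> nat \<Rightarrow>
    (rat \<Rightarrow> rat \<Rightarrow> rat) \<Rightarrow> (rat \<Rightarrow> rat \<Rightarrow> rat) \<Rightarrow> (rat \<Rightarrow> rat \<Rightarrow> rat) \<Rightarrow> bool" where
  "D3 q d \<phi>0 \<phi>1 \<phi>2 \<longleftrightarrow>
     (\<forall>x1 x2. (x1, x2) \<noteq> (0, 0) \<longrightarrow>
        independent_linear_forms (\<lambda>m1 m2. formB1 q m1 m2 x1 x2) (\<lambda>m1 m2. formB2 m1 m2 x1 x2)) \<and>
     (\<forall>m1 m2. (m1, m2) \<noteq> (0, 0) \<longrightarrow>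
        independent_linear_forms (formB1 q m1 m2) (formB2 m1 m2)) \<and>
     (\<forall>x1 x2 :: rat. formQ q x1 x2 ^ (d - 1) = 0 \<longrightarrow> (x1, x2) = (0, 0)) \<and>
     (\<forall>m1 m2. (m1, m2) \<noteq> (0, 0) \<longrightarrow> \<not> (\<phi>0 m1 m2 = 0 \<and> \<phi>1 m1 m2 = 0 \<and> \<phi>2 m1 m2 = 0))"

section \<open>The \<open>RC\<close> operation\<close>

definition reflection :: "rat quad \<Rightarrow> rat quad" where
  "reflection = (\<lambda>(x1, x2, x3, x4). (- x1, x2, x3, x4))"

text \<open>That \<open>(\<beta>1 : \<beta>2)\<close> is the second root, counted with multiplicity, is expressed by the
  factorization of the binary quadratic form.\<close>

definition is_conjugate :: "rat \<Rightarrow>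
    (rat \<Rightarrow> rat \<Rightarrow> rat) \<Rightarrow> (rat \<Rightarrow> rat \<Rightarrow> rat) \<Rightarrow> (rat \<Rightarrow> rat \<Rightarrow> rat) \<Rightarrow> rat quad \<Rightarrow> rat quad \<Rightarrow> bool" where
  "is_conjugate q \<phi>0 \<phi>1 \<phi>2 = (\<lambda>(\<alpha>1, \<alpha>2, \<alpha>3, \<alpha>4) (\<beta>1, \<beta>2, \<beta>3, \<beta>4).
     \<exists>m1 m2 l. \<alpha>3 = formB1 q m1 m2 \<alpha>1 \<alpha>2 \<and> \<alpha>4 = formB2 m1 m2 \<alpha>1 \<alpha>2 \<and>
       l \<noteq> 0 \<and> (\<beta>1, \<beta>2) \<noteq> (0, 0) \<and>
       (\<forall>x1 x2. \<phi>0 m1 m2 * x1^2 + \<phi>1 m1 m2 * x1 * x2 + \<phi>2 m1 m2 * x2^2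
          = l * (\<alpha>2 * x1 - \<alpha>1 * x2) * (\<beta>2 * x1 - \<beta>1 * x2)) \<and>
       \<beta>3 = formB1 q m1 m2 \<beta>1 \<beta>2 \<and> \<beta>4 = formB2 m1 m2 \<beta>1 \<beta>2)"

text \<open>The conjugate is determined only as a point, so an arbitrary coordinate vector is chosen.\<close>

definition conjugate :: "rat \<Rightarrow>
    (rat \<Rightarrow> rat \<Rightarrow> rat) \<Rightarrow> (rat \<Rightarrow> rat \<Rightarrow> rat) \<Rightarrow> (rat \<Rightarrow> rat \<Rightarrow> rat) \<Rightarrow> rat quad \<Rightarrow> rat quad" where
  "conjugate q \<phi>0 \<phi>1 \<phi>2 P = (SOME P'. is_conjugate q \<phi>0 \<phi>1 \<phi>2 P P')"

definition RC :: "rat \<Rightarrow>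
    (rat \<Rightarrow> rat \<Rightarrow> rat) \<Rightarrow> (rat \<Rightarrow> rat \<Rightarrow> rat) \<Rightarrow> (rat \<Rightarrow> rat \<Rightarrow> rat) \<Rightarrow> rat quad \<Rightarrow> rat quad" where
  "RC q \<phi>0 \<phi>1 \<phi>2 P = reflection (conjugate q \<phi>0 \<phi>1 \<phi>2 P)"

section \<open>Genus of an algebraic function field of one variable\<close>

text \<open>Here \<open>k\<close> is an algebraically closed field of constants and \<open>K\<close> is a function field over \<open>k\<close>,
  both subfields of an ambient field.  Places are normalized discrete valuations of \<open>K\<close> that are
  trivial on \<open>k\<close>; they are given the value \<open>0\<close> outside \<open>K - {0}\<close> so that distinct functions are
  distinct places.\<close>

definition is_place :: "'a::field set \<Rightarrow> 'a set \<Rightarrow> ('a \<Rightarrow> int) \<Rightarrow> bool" where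
  "is_place k K v \<longleftrightarrow>
     (\<forall>x. x \<notin> K - {0} \<longrightarrow> v x = 0) \<and>
     v ` (K - {0}) = UNIV \<and>
     (\<forall>x\<in>K - {0}. \<forall>y\<in>K - {0}. v (x * y) = v x + v y) \<and>
     (\<forall>x\<in>K - {0}. \<forall>y\<in>K - {0}. x + y \<noteq> 0 \<longrightarrow> min (v x) (v y) \<le> v (x + y)) \<and>
     (\<forall>x\<in>k - {0}. v x = 0)"

definition is_divisor :: "'a::field set \<Rightarrow> 'a set \<Rightarrow> (('a \<Rightarrow> int) \<Rightarrow> int) \<Rightarrow> bool" where
  "is_divisor k K D \<longleftrightarrow> finite {v. D v \<noteq> 0} \<and> (\<forall>v. D v \<noteq> 0 \<longrightarrow> is_place k K v)"

text \<open>Every place has degree 1, because \<open>k\<close> is algebraically closed.\<close>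

definition divisor_degree :: "(('a \<Rightarrow> int) \<Rightarrow> int) \<Rightarrow> int" where
  "divisor_degree D = (\<Sum>v | D v \<noteq> 0. D v)"

definition riemann_roch_space :: "'a::field set \<Rightarrow> 'a set \<Rightarrow> (('a \<Rightarrow> int) \<Rightarrow> int) \<Rightarrow> 'a set" where
  "riemann_roch_space k K D =
     {f \<in> K. f = 0 \<or> (\<forall>v. is_place k K v \<longrightarrow> - D v \<le> v f)}"

definition riemann_roch_dim :: "'a::field set \<Rightarrow> 'a set \<Rightarrow> (('a \<Rightarrow> int) \<Rightarrow> int) \<Rightarrow> nat" where
  "riemann_roch_dim k K D = ring.dim ring_of_type_algebra k (riemann_roch_space k K D)"

text \<open>The genus is the maximum of \<open>deg D - l(D) + 1\<close> over all divisors \<open>D\<close>.\<close>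

definition function_field_genus :: "'a::field set \<Rightarrow> 'a set \<Rightarrow> int \<Rightarrow> bool" where
  "function_field_genus k K g \<longleftrightarrow>
     (\<exists>D. is_divisor k K D \<and> g = divisor_degree D - int (riemann_roch_dim k K D) + 1) \<and>
     (\<forall>D. is_divisor k K D \<longrightarrow> divisor_degree D - int (riemann_roch_dim k K D) + 1 \<le> g)"

definition transcendence_degree_one :: "'a::field set \<Rightarrow> 'a set \<Rightarrow> bool" where
  "transcendence_degree_one k K \<longleftrightarrow>
     (\<exists>t\<in>K. ring.transcendental ring_of_type_algebra k t \<and>
        (\<forall>x\<in>K. \<not> ring.transcendental ring_of_type_algebra
                  (generate_field ring_of_type_algebra (insert t k)) x))"

section \<open>Curves in projective 3-space\<close>

text \<open>Subsets of projective space are represented by their affine cones with the origin removed.\<close>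

definition is_form :: "'a::field set \<Rightarrow> nat \<Rightarrow> ('a quad \<Rightarrow> 'a) \<Rightarrow> bool" where
  "is_form k n f \<longleftrightarrow>
     (\<exists>c. (\<forall>e. c e \<in> k) \<and>
        f = (\<lambda>(x1, x2, x3, x4). \<Sum>(i1, i2, i3, i4) | i1 + i2 + i3 + i4 = n.
               c (i1, i2, i3, i4) * x1 ^ i1 * x2 ^ i2 * x3 ^ i3 * x4 ^ i4))"

definition zariski_closed :: "'a::field set \<Rightarrow> 'a quad set \<Rightarrow> bool" where
  "zariski_closed k V \<longleftrightarrow>
     (\<exists>S. (\<forall>f\<in>S. \<exists>n. is_form k n f) \<and> V = {x. x \<noteq> (0, 0, 0, 0) \<and> (\<forall>f\<in>S. f x = 0)})"

definition irreducible_over :: "'a::field set \<Rightarrow> 'a quad set \<Rightarrow> bool" where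
  "irreducible_over k V \<longleftrightarrow> V \<noteq> {} \<and>
     (\<forall>A B. zariski_closed k A \<and> zariski_closed k B \<and> V \<subseteq> A \<union> B \<longrightarrow> V \<subseteq> A \<or> V \<subseteq> B)"

definition generic_point :: "'a::field set \<Rightarrow> 'a quad set \<Rightarrow> 'a quad \<Rightarrow> bool" where
  "generic_point k V \<xi> \<longleftrightarrow> \<xi> \<in> V \<and> (\<forall>n f. is_form k n f \<and> f \<xi> = 0 \<longrightarrow> (\<forall>x\<in>V. f x = 0))"

text \<open>The field of rational functions (quotients of forms of equal degree) on an irreducible \<open>V\<close>,
  realized by evaluation at a generic point.  A different generic point of \<open>V\<close> gives a
  \<open>k\<close>-isomorphic field.\<close>

definition function_field_at :: "'a::field set \<Rightarrow> 'a quad \<Rightarrow> 'a set" where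
  "function_field_at k \<xi> = {f \<xi> / h \<xi> | f h n. is_form k n f \<and> is_form k n h \<and> h \<xi> \<noteq> 0}"

text \<open>The complex numbers serve as universal domain: they have infinite transcendence degree over
  the field of algebraic numbers, so every projective variety over that field has a complex generic
  point.\<close>

definition alg_numbers :: "complex set" where
  "alg_numbers = {x. algebraic x}"

definition geom_irreducible_curve_over_Q :: "complex quad set \<Rightarrow> bool" where
  "geom_irreducible_curve_over_Q V \<longleftrightarrow>
     zariski_closed \<rat> V \<and> irreducible_over alg_numbers V \<and>
     (\<exists>\<xi>. generic_point alg_numbers V \<xi> \<and>
          transcendence_degree_one alg_numbers (function_field_at alg_numbers \<xi>))"

definition has_geometric_genus :: "complex quad set \<Rightarrow> int \<Rightarrow> bool" where
  "has_geometric_genus V g \<longleftrightarrow>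
     (\<exists>\<xi>. generic_point alg_numbers V \<xi> \<and>
          function_field_genus alg_numbers (function_field_at alg_numbers \<xi>) g)"

end

theory Submission
  imports Defs "HOL-Analysis.Continuum_Not_Denumerable"
begin

text \<open>The RC operation has an invariant.  The conjugation keeps \<open>(m1, m2)\<close> and \<open>Q(B1, B2) = Q(m1, m2) Q(x1, x2)\<close>,
  while the reflection keeps \<open>Q(x1, x2)\<close> and \<open>Q(x3, x4)\<close>; so \<open>N = Q(x3, x4) / Q(x1, x2)\<close> is the same
  rational number at all points of the sequence (\<open>norm_ratio_RC\<close>).  On the quadric
  \<open>Q(x3, x4) = N Q(x1, x2)\<close> the form \<open>F\<close> is divisible by \<open>Q(x1, x2)\<close>, hence \<open>G\<close> is
  \<open>Q(x1, x2)\<^sup>d\<^sup>-\<^sup>1\<close> times a quadratic form (\<open>formG_on_quadric\<close>).  The infinitely many points therefore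
  lie on an intersection of two quadrics that is contained in the surface.  In both quadrics
  \<open>x1\<close> occurs only as \<open>x1\<^sup>2\<close>; solving one of them for \<open>x1\<^sup>2\<close> gives the equations
  \<open>x1\<^sup>2 = S(x2, x3, x4)\<close>, \<open>C(x2, x3, x4) = 0\<close> with ternary quadratic forms \<open>S\<close> and \<open>C\<close>, a double cover
  of a plane conic.

  The rational points provide either a line contained in \<open>C = 0\<close>, through two of the points
  \<open>(x2, x3, x4)\<close>, or three points in general position on \<open>C = 0\<close>.  In both cases a component of \<open>C = 0\<close> has
  a rational parametrization \<open>p(t)\<close> (\<open>curve_over_line\<close>, \<open>curve_over_conic\<close>), and \<open>f(t) = S(p(t))\<close> has degree
  at most 4.  The curve is the set of zeros of the rational forms that vanish at
  \<open>\<xi> = (s, p(t))\<close>, where \<open>t\<close> is a transcendental number and \<open>s\<^sup>2 = f(t)\<close>.  Its points are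
  specializations of \<open>\<xi>\<close> also over the field \<open>k\<close> of algebraic numbers, that is, the curve is geometrically
  irreducible, provided that \<open>f\<close> is not a square over \<open>k\<close> without being one over the rationals
  (\<open>linearly_disjoint\<close>).  This exception does not occur, because \<open>f\<close> takes a nonzero square value at some rational
  point unless \<open>f = 0\<close> (\<open>rational_sqrt\<close>).

  The function field is \<open>K = k(t, s)\<close>, and its genus is at most 1 by an estimate in the style of Riemann
  (\<open>genus_le_1\<close>).  A divisor \<open>D\<close> is bounded by a divisor \<open>D'\<close> of degree at most \<open>2 n\<close>, supported at
  infinity and at the zeros of a polynomial \<open>z(t)\<close>, for which \<open>L(D')\<close> contains the
  \<open>2 n\<close> independent functions \<open>t\<^sup>i / z\<close> with \<open>i \<le> n\<close> and \<open>t\<^sup>i s / z\<close> with \<open>i \<le> n - 2\<close>; since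
  \<open>deg D - dim L(D)\<close> grows with \<open>D\<close>, it is never positive.  So the genus, a maximum over all
  divisors that is at least the value 0 at \<open>D = 0\<close>, is 0 or 1.  If \<open>K = k(t)\<close> the same applies to the
  double cover \<open>k(t)\<close> of \<open>k(t\<^sup>2)\<close>.\<close>

section \<open>Subfields of the complex numbers\<close>

hide_const (open) Polynomials.degree

abbreviation complex_ring :: "complex ring" where
  "complex_ring \<equiv> ring_of_type_algebra"

lemma complex_ring_simps [simp]:
  "carrier complex_ring = UNIV" "\<one>\<^bsub>complex_ring\<^esub> = 1" "\<zero>\<^bsub>complex_ring\<^esub> = 0"
  "x \<otimes>\<^bsub>complex_ring\<^esub> y = x * y" "x \<oplus>\<^bsub>complex_ring\<^esub> y = x + y"
  by (simp_all add: ring_of_type_algebra_def)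

lemma field_complex_ring: "field complex_ring"
  by (rule field_from_type_algebra)

interpretation cring: domain complex_ring
  by (rule field.axioms(1)[OF field_complex_ring])

lemma complex_ring_uminus [simp]: "\<ominus>\<^bsub>complex_ring\<^esub> x = - x"
proof -
  have "x \<oplus>\<^bsub>complex_ring\<^esub> (\<ominus>\<^bsub>complex_ring\<^esub> x) = \<zero>\<^bsub>complex_ring\<^esub>"
    by (rule cring.r_neg) simp
  then show ?thesis by (simp add: eq_neg_iff_add_eq_0 add.commute)
qed

lemma complex_ring_inv [simp]:
  assumes "x \<noteq> 0" shows "inv\<^bsub>complex_ring\<^esub> x = inverse x"
proof -
  have "x \<in> Units complex_ring" using assms field.field_Units[OF field_complex_ring] by auto
  then have "x \<otimes>\<^bsub>complex_ring\<^esub> (inv\<^bsub>complex_ring\<^esub> x) = \<one>\<^bsub>complex_ring\<^esub>"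
    by (rule cring.Units_r_inv)
  then show ?thesis using assms by (simp add: field_simps)
qed

lemma complex_ring_pow [simp]: "x [^]\<^bsub>complex_ring\<^esub> (n::nat) = x ^ n"
  by (induction n) (simp_all add: mult.commute)

locale complex_subfield =
  fixes F :: "complex set"
  assumes one: "1 \<in> F"
    and add: "x \<in> F \<Longrightarrow> y \<in> F \<Longrightarrow> x + y \<in> F"
    and mult: "x \<in> F \<Longrightarrow> y \<in> F \<Longrightarrow> x * y \<in> F"
    and uminus: "x \<in> F \<Longrightarrow> - x \<in> F"
    and inverse: "x \<in> F \<Longrightarrow> inverse x \<in> F"
begin

lemma zero: "0 \<in> F" using add[OF one uminus[OF one]] by simp

lemma diff: "x \<in> F \<Longrightarrow> y \<in> F \<Longrightarrow> x - y \<in> F"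
  using add[of x "- y"] uminus by simp

lemma divide: "x \<in> F \<Longrightarrow> y \<in> F \<Longrightarrow> x / y \<in> F"
  by (simp add: divide_inverse inverse mult)

lemma power: "x \<in> F \<Longrightarrow> x ^ n \<in> F"
  by (induction n) (auto intro: one mult)

lemma sum: "(\<And>i. i \<in> I \<Longrightarrow> g i \<in> F) \<Longrightarrow> (\<Sum>i\<in>I. g i) \<in> F"
  by (induction I rule: infinite_finite_induct) (auto intro: zero add)

lemma of_nat: "of_nat n \<in> F"
  by (induction n) (auto intro: zero one add)

lemma numeral: "numeral n \<in> F"
  using of_nat[of "numeral n"] by simp

lemma of_int: "of_int n \<in> F"
  by (cases n rule: int_cases2) (auto intro: of_nat uminus)

lemma Rats: "x \<in> \<rat> \<Longrightarrow> x \<in> F"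
  by (erule Rats_cases') (auto intro: divide of_int)

lemma subfield: "subfield F complex_ring"
  by (rule field.subfieldI'[OF field_complex_ring], rule cring.subringI)
    (auto intro: one add mult uminus inverse)

end

lemma subfield_imp_complex_subfield:
  assumes "subfield F complex_ring"
  shows "complex_subfield F"
proof -
  have sr: "subring F complex_ring" using assms by (rule subfieldE(1))
  have "inverse x \<in> F" if "x \<in> F" for x
  proof (cases "x = 0")
    case True
    then show ?thesis using that by simp
  next
    case False
    then have "inv\<^bsub>complex_ring\<^esub> x \<in> F" using cring.subfield_m_inv(1)[OF assms, of x] that by simp
    then show ?thesis using False by simp
  qed
  then show ?thesis
    using subringE(3,5,6,7)[OF sr] by unfold_locales auto
qed

lemma complex_subfield_Rats: "complex_subfield \<rat>"
  by unfold_locales auto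

definition polys :: "'a::zero set \<Rightarrow> 'a poly set" where
  "polys F = {p. \<forall>i. coeff p i \<in> F}"

lemma polysI: "(\<And>i. coeff p i \<in> F) \<Longrightarrow> p \<in> polys F"
  by (simp add: polys_def)

lemma polysD: "p \<in> polys F \<Longrightarrow> coeff p i \<in> F"
  by (simp add: polys_def)

lemma polys_mono: "F \<subseteq> E \<Longrightarrow> p \<in> polys F \<Longrightarrow> p \<in> polys E"
  by (auto simp: polys_def)

context complex_subfield
begin

lemma polys_0: "0 \<in> polys F" by (simp add: polys_def zero)
lemma polys_1: "1 \<in> polys F" by (simp add: polys_def zero one coeff_1)

lemma polys_pCons: "a \<in> F \<Longrightarrow> p \<in> polys F \<Longrightarrow> pCons a p \<in> polys F"
  by (auto simp: polys_def coeff_pCons split: nat.split)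

lemma polys_const: "a \<in> F \<Longrightarrow> [:a:] \<in> polys F"
  by (intro polys_pCons polys_0)

lemma polys_monom: "a \<in> F \<Longrightarrow> monom a n \<in> polys F"
  by (simp add: polys_def zero)

lemma polys_add: "p \<in> polys F \<Longrightarrow> r \<in> polys F \<Longrightarrow> p + r \<in> polys F"
  by (simp add: polys_def add)

lemma polys_uminus: "p \<in> polys F \<Longrightarrow> - p \<in> polys F"
  by (simp add: polys_def uminus)

lemma polys_diff: "p \<in> polys F \<Longrightarrow> r \<in> polys F \<Longrightarrow> p - r \<in> polys F"
  by (simp add: polys_def diff)

lemma polys_mult: "p \<in> polys F \<Longrightarrow> r \<in> polys F \<Longrightarrow> p * r \<in> polys F"
  by (auto simp: polys_def coeff_mult intro!: sum mult)

lemma polys_smult: "a \<in> F \<Longrightarrow> p \<in> polys F \<Longrightarrow> smult a p \<in> polys F"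
  by (simp add: polys_def mult)

lemma polys_power: "p \<in> polys F \<Longrightarrow> p ^ n \<in> polys F"
  by (induction n) (auto intro: polys_1 polys_mult)

lemma polys_sum: "(\<And>i. i \<in> I \<Longrightarrow> g i \<in> polys F) \<Longrightarrow> (\<Sum>i\<in>I. g i) \<in> polys F"
  by (induction I rule: infinite_finite_induct) (auto intro: polys_0 polys_add)

lemma polys_numeral: "numeral n \<in> polys F"
  using polys_const[OF numeral[of n]] by (simp add: numeral_poly)

lemma polys_pcompose: "p \<in> polys F \<Longrightarrow> r \<in> polys F \<Longrightarrow> pcompose p r \<in> polys F"
proof (induction p)
  case (pCons a p)
  have "a \<in> F" using polysD[OF pCons.prems(1), of 0] by simp
  moreover have "p \<in> polys F"
    using polysD[OF pCons.prems(1), of "Suc _"] by (intro polysI) simp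
  ultimately show ?case
    using pCons by (auto simp: pcompose_pCons intro!: polys_add polys_const polys_mult)
qed (auto intro: polys_0)

lemma poly_in: "p \<in> polys F \<Longrightarrow> x \<in> F \<Longrightarrow> poly p x \<in> F"
  by (auto simp: poly_altdef polys_def intro!: sum mult power)

lemma polys_synthetic_div: "p \<in> polys F \<Longrightarrow> a \<in> F \<Longrightarrow> synthetic_div p a \<in> polys F"
proof (induction p)
  case (pCons c p)
  have "p \<in> polys F"
    using polysD[OF pCons.prems(1), of "Suc _"] by (intro polysI) simp
  then show ?case
    using pCons by (auto simp: synthetic_div_pCons intro!: polys_pCons poly_in)
qed (auto intro: polys_0)

lemma polys_poly_shift: "p \<in> polys F \<Longrightarrow> poly_shift n p \<in> polys F"
  by (simp add: polys_def coeff_poly_shift)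

lemma polys_reflect: "p \<in> polys F \<Longrightarrow> reflect_poly p \<in> polys F"
  by (simp add: polys_def coeff_reflect_poly zero)

lemmas polys_intros = polys_0 polys_1 polys_pCons polys_monom polys_add polys_uminus polys_diff
  polys_mult polys_smult polys_power polys_sum polys_numeral polys_pcompose

end

section \<open>The field of algebraic numbers\<close>

text \<open>A polynomial over a ring with explicit carrier is the list of its coefficients, the leading
  coefficient first.\<close>

lemma eval_eq_poly: "cring.eval p x = poly (Poly (rev p)) x"
proof (induction p)
  case Nil
  then show ?case by simp
next
  case (Cons a p)
  have "Poly (rev p @ [a]) = Poly (rev p) + monom 1 (length p) * [:a:]"
    by (simp add: Poly_append)
  then show ?case using Cons by (simp add: poly_monom mult.commute)
qed

lemma algebraic_over_iff:
  assumes "complex_subfield F"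
  shows "\<not> cring.transcendental F x \<longleftrightarrow> (\<exists>p\<in>polys F. p \<noteq> 0 \<and> poly p x = 0)"
proof
  interpret complex_subfield F by fact
  have sr: "subring F complex_ring" using subfield by (rule subfieldE(1))
  assume "\<not> cring.transcendental F x"
  then obtain p where p: "p \<in> carrier (F[X]\<^bsub>complex_ring\<^esub>)" "p \<noteq> []" "cring.eval p x = 0"
    using cring.algebraicE[OF sr, of x] unfolding over_def by auto
  then have set: "set p \<subseteq> F" and lead: "hd p \<noteq> 0"
    unfolding univ_poly_def polynomial_def by auto
  define P where "P = Poly (rev p)"
  have c: "coeff P i = nth_default 0 (rev p) i" for i unfolding P_def by simp
  have "P \<in> polys F"
    using set zero by (intro polysI) (auto simp: c nth_default_def rev_nth)
  moreover have "P \<noteq> 0"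
  proof -
    have "coeff P (length p - 1) = hd p"
      using p(2) by (simp add: c nth_default_def rev_nth hd_conv_nth)
    then show ?thesis using lead by auto
  qed
  moreover have "poly P x = 0" using p(3) by (simp add: eval_eq_poly P_def)
  ultimately show "\<exists>p\<in>polys F. p \<noteq> 0 \<and> poly p x = 0" by blast
next
  interpret complex_subfield F by fact
  assume "\<exists>p\<in>polys F. p \<noteq> 0 \<and> poly p x = 0"
  then obtain P where P: "P \<in> polys F" "P \<noteq> 0" "poly P x = 0" by blast
  define p where "p = rev (coeffs P)"
  have "set p \<subseteq> F" using P(1) by (auto simp: p_def coeffs_def polys_def)
  moreover have "p \<noteq> []" using P(2) by (simp add: p_def)
  moreover have "hd p \<noteq> 0" using P(2) by (simp add: p_def hd_rev last_coeffs_eq_coeff_degree)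
  ultimately have "p \<in> carrier (F[X]\<^bsub>complex_ring\<^esub>)"
    unfolding univ_poly_def polynomial_def by auto
  moreover have "cring.eval p x = \<zero>\<^bsub>complex_ring\<^esub>" using P(3) by (simp add: eval_eq_poly p_def)
  ultimately show "\<not> cring.transcendental F x"
    using cring.algebraicI[of p F x] \<open>p \<noteq> []\<close> unfolding over_def by simp
qed

lemma algebraic_iff: "algebraic x \<longleftrightarrow> \<not> cring.transcendental \<rat> (x::complex)"
  unfolding algebraic_over_iff[OF complex_subfield_Rats] algebraic_altdef polys_def by auto

interpretation alg_numbers: complex_subfield alg_numbers
proof -
  have "subfield {x \<in> carrier complex_ring. (cring.algebraic over \<rat>) x} complex_ring"
    by (rule field.subfield_of_algebraics[OF field_complex_ring]) (rule complex_subfield.subfield[OF complex_subfield_Rats])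
  then show "complex_subfield alg_numbers"
    by (intro subfield_imp_complex_subfield) (simp add: alg_numbers_def algebraic_iff over_def)
qed

text \<open>The coefficients generate a finite extension of the rationals and \<open>x\<close> is algebraic over it, so \<open>x\<close> lies in a
  finite extension of the rationals.\<close>

lemma alg_numbers_closed:
  assumes "p \<in> polys alg_numbers" "p \<noteq> 0" "poly p x = 0"
  shows "x \<in> alg_numbers"
proof -
  have Q: "subfield \<rat> complex_ring" by (rule complex_subfield.subfield[OF complex_subfield_Rats])
  define F where "F = cring.finite_extension \<rat> (coeffs p)"
  have alg: "(cring.algebraic over \<rat>) c" if "c \<in> set (coeffs p)" for c
    using that assms(1)
    by (auto simp: coeffs_def polys_def alg_numbers_def algebraic_iff over_def split: if_splits)
  have F: "subfield F complex_ring"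
    unfolding F_def using cring.finite_extension_is_subfield[OF Q _ alg] by simp
  interpret F: complex_subfield F using F by (rule subfield_imp_complex_subfield)
  have Ffin: "cring.finite_dimension \<rat> F"
    unfolding F_def by (rule cring.finite_extension_finite_dimension(1)[OF Q _ alg]) simp_all
  have inF: "set (coeffs p) \<subseteq> F"
    unfolding F_def by (rule cring.finite_extension_mem[OF subfieldE(1)[OF Q]]) simp
  have "coeff p i \<in> F" for i
    using inF F.zero coeff_in_coeffs[OF assms(2) le_degree, of i] by (cases "coeff p i = 0") auto
  then have "\<not> cring.transcendental F x"
    using algebraic_over_iff[OF F.complex_subfield_axioms] assms(2,3) by (auto simp: polys_def)
  then have "cring.finite_dimension F (cring.simple_extension F x)"
    using cring.finite_dimension_simple_extension[OF F, of x] by (simp add: over_def)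
  then have "cring.finite_dimension \<rat> (cring.simple_extension F x)"
    using cring.telescopic_base_dim(1)[OF Q F Ffin] by blast
  moreover have "x \<in> cring.simple_extension F x"
    using cring.simple_extension_mem[OF subfieldE(1)[OF F]] by simp
  moreover have "subring (cring.simple_extension F x) complex_ring"
    using cring.simple_extension_is_subring[OF subfieldE(1)[OF F]] by simp
  ultimately have "(cring.algebraic over \<rat>) x"
    using cring.finite_dimension_imp_algebraic[OF Q] by blast
  then show ?thesis by (simp add: alg_numbers_def algebraic_iff over_def)
qed

lemma ex_not_algebraic: "\<exists>t. t \<notin> alg_numbers"
proof -
  have "countable alg_numbers"
  proof -
    have "alg_numbers \<subseteq> (\<Union>l\<in>(UNIV :: int list set) - {l. Poly (map complex_of_int l) = 0}.
        {x. poly (Poly (map complex_of_int l)) x = 0})"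
    proof
      fix x assume "x \<in> alg_numbers"
      then obtain p where p: "\<And>i. coeff p i \<in> \<int>" "p \<noteq> 0" "poly p x = 0"
        unfolding alg_numbers_def algebraic_def by auto
      have "\<exists>l. coeffs p = map of_int l"
      proof -
        have "set (coeffs p) \<subseteq> range of_int"
          using p(1) by (auto simp: coeffs_def Ints_def split: if_splits)
        then show ?thesis by (metis ex_map_conv subset_iff rangeE)
      qed
      then obtain l where "coeffs p = map of_int l" by blast
      then have "p = Poly (map of_int l)" by (metis Poly_coeffs)
      then show "x \<in> (\<Union>l\<in>(UNIV :: int list set) - {l. Poly (map complex_of_int l) = 0}.
        {x. poly (Poly (map complex_of_int l)) x = 0})" using p by blast
    qed
    moreover have "countable \<dots>"
      by (intro countable_UN) (auto intro!: uncountable_infinite poly_roots_finite countable_finite)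
    ultimately show ?thesis by (rule countable_subset)
  qed
  then show ?thesis
    using uncountable_UNIV_complex by (metis UNIV_eq_I)
qed

section \<open>Places of a function field\<close>

text \<open>A place has the value 0 at the function 0, where a valuation would be infinite; this predicate
  restores the convention under which valuations are compatible with sums.\<close>

definition val_ge :: "(complex \<Rightarrow> int) \<Rightarrow> int \<Rightarrow> complex \<Rightarrow> bool" where
  "val_ge v n x \<longleftrightarrow> x = 0 \<or> n \<le> v x"

locale place =
  k: complex_subfield k + K: complex_subfield K for k K :: "complex set" +
  fixes v :: "complex \<Rightarrow> int"
  assumes is_place: "is_place k K v" and k_subset: "k \<subseteq> K"
begin

lemma v_mult: "x \<in> K \<Longrightarrow> y \<in> K \<Longrightarrow> x \<noteq> 0 \<Longrightarrow> y \<noteq> 0 \<Longrightarrow> v (x * y) = v x + v y"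
  using is_place unfolding is_place_def by auto

lemma v_add: "x \<in> K \<Longrightarrow> y \<in> K \<Longrightarrow> x \<noteq> 0 \<Longrightarrow> y \<noteq> 0 \<Longrightarrow> x + y \<noteq> 0 \<Longrightarrow> min (v x) (v y) \<le> v (x + y)"
  using is_place unfolding is_place_def by auto

lemma v_0: "v 0 = 0"
  using is_place unfolding is_place_def by auto

lemma v_const: "c \<in> k \<Longrightarrow> v c = 0"
  using is_place v_0 unfolding is_place_def by (cases "c = 0") auto

lemma v_surj: "\<exists>x\<in>K - {0}. v x = n"
proof -
  have "v ` (K - {0}) = UNIV" using is_place unfolding is_place_def by blast
  then show ?thesis by (metis UNIV_I imageE)
qed

lemma v_uminus: "x \<in> K \<Longrightarrow> v (- x) = v x"
  using v_mult[of "- 1" x] v_const[of "- 1"] k.uminus[OF k.one] k_subset by (cases "x = 0") auto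

lemma v_inverse: "x \<in> K \<Longrightarrow> v (inverse x) = - v x"
  using v_mult[of x "inverse x"] v_const[OF k.one] K.inverse v_0 by (cases "x = 0") auto

lemma v_divide: "x \<in> K \<Longrightarrow> y \<in> K \<Longrightarrow> x \<noteq> 0 \<Longrightarrow> y \<noteq> 0 \<Longrightarrow> v (x / y) = v x - v y"
  using v_mult[of x "inverse y"] v_inverse[of y] K.inverse[of y] by (simp add: divide_inverse)

lemma v_power: "x \<in> K \<Longrightarrow> x \<noteq> 0 \<Longrightarrow> v (x ^ n) = int n * v x"
  by (induction n) (auto simp: v_const[OF k.one] v_mult K.power algebra_simps)

lemma ge_0: "val_ge v n 0" by (simp add: val_ge_def)

lemma ge_add: "x \<in> K \<Longrightarrow> y \<in> K \<Longrightarrow> val_ge v n x \<Longrightarrow> val_ge v n y \<Longrightarrow> val_ge v n (x + y)"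
  using v_add[of x y] by (fastforce simp: val_ge_def)

lemma ge_mult: "x \<in> K \<Longrightarrow> y \<in> K \<Longrightarrow> val_ge v m x \<Longrightarrow> val_ge v n y \<Longrightarrow> val_ge v (m + n) (x * y)"
  using v_mult[of x y] by (cases "x = 0"; cases "y = 0") (auto simp: val_ge_def)

lemma ge_uminus: "x \<in> K \<Longrightarrow> val_ge v n x \<Longrightarrow> val_ge v n (- x)"
  by (auto simp: val_ge_def v_uminus)

lemma ge_diff: "x \<in> K \<Longrightarrow> y \<in> K \<Longrightarrow> val_ge v n x \<Longrightarrow> val_ge v n y \<Longrightarrow> val_ge v n (x - y)"
  using ge_add[of x "- y" n] ge_uminus[of y n] K.uminus[of y] by simp

lemma ge_const: "c \<in> k \<Longrightarrow> val_ge v 0 c"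
  by (auto simp: val_ge_def v_const)

lemma ge_mono: "val_ge v n x \<Longrightarrow> m \<le> n \<Longrightarrow> val_ge v m x"
  by (auto simp: val_ge_def)

lemma v_add_eq:
  assumes "x \<in> K" "y \<in> K" "x \<noteq> 0" "val_ge v (v x + 1) y"
  shows "x + y \<noteq> 0" "v (x + y) = v x"
proof -
  have ne: "x + y \<noteq> 0"
  proof
    assume "x + y = 0"
    then have "y = - x" by (simp add: eq_neg_iff_add_eq_0 add.commute)
    then show False using assms by (auto simp: val_ge_def v_uminus)
  qed
  have "val_ge v (v x) (x + y)"
    using assms by (intro ge_add) (auto simp: val_ge_def)
  then have 1: "v x \<le> v (x + y)" using ne by (simp add: val_ge_def)
  have "\<not> v x < v (x + y)"
  proof
    assume "v x < v (x + y)"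
    then have "val_ge v (v x + 1) (x + y)" by (simp add: val_ge_def)
    then have "val_ge v (v x + 1) (x + y - y)"
      using assms K.add by (intro ge_diff) auto
    then show False using assms(3) by (simp add: val_ge_def)
  qed
  then show "x + y \<noteq> 0" "v (x + y) = v x" using ne 1 by auto
qed

lemma v_of_square: "x \<in> K \<Longrightarrow> v (x\<^sup>2) = 2 * v x"
  using v_power[of x 2] v_0 by (cases "x = 0") auto

lemma polys_in_K: "P \<in> polys k \<Longrightarrow> t \<in> K \<Longrightarrow> poly P t \<in> K"
  by (rule K.poly_in[OF polys_mono[OF k_subset]])

lemma poly_ge:
  assumes "P \<in> polys k" "t \<in> K" "val_ge v 0 t"
  shows "val_ge v 0 (poly P t)"
  using assms(1)
proof (induction P)
  case (pCons a P)
  have a: "a \<in> k" using polysD[OF pCons.prems, of 0] by simp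
  have P: "P \<in> polys k" using polysD[OF pCons.prems, of "Suc _"] by (intro polysI) simp
  have "val_ge v (0 + 0) (t * poly P t)"
    using assms P polys_in_K pCons.IH by (intro ge_mult) auto
  then have "val_ge v 0 (a + t * poly P t)"
    using a k_subset ge_const assms P polys_in_K K.mult by (intro ge_add) auto
  then show ?case by simp
qed (simp add: ge_0)

lemma poly_unit:
  assumes P: "P \<in> polys k" and t: "t \<in> K" "val_ge v 1 t" and "coeff P 0 \<noteq> 0"
  shows "poly P t \<noteq> 0" "v (poly P t) = 0"
proof -
  obtain a R where PR: "P = pCons a R" by (cases P) auto
  have a: "a \<in> k" "a \<noteq> 0" using polysD[OF P, of 0] assms(4) by (simp_all add: PR)
  have R: "R \<in> polys k" using polysD[OF P, of "Suc _"] by (intro polysI) (simp add: PR)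
  have "val_ge v (1 + 0) (t * poly R t)"
    using t R polys_in_K poly_ge ge_mono[of 1 t 0] by (intro ge_mult) auto
  then have "a + t * poly R t \<noteq> 0 \<and> v (a + t * poly R t) = v a"
    using v_add_eq[of a "t * poly R t"] a k_subset v_const[OF a(1)] polys_in_K[OF R t(1)] K.mult[OF t(1)]
    by auto
  then show "poly P t \<noteq> 0" "v (poly P t) = 0" using v_const[OF a(1)] by (simp_all add: PR)
qed

lemma poly_pole:
  assumes P: "P \<in> polys k" and t: "t \<in> K" "v t < 0" and "P \<noteq> 0"
  shows "poly P t \<noteq> 0" "v (poly P t) = int (degree P) * v t"
proof -
  have t0: "t \<noteq> 0" using t v_0 by auto
  have u: "val_ge v 1 (inverse t)" using t v_inverse by (simp add: val_ge_def)
  have R: "reflect_poly P \<in> polys k" by (rule k.polys_reflect[OF P])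
  have "coeff (reflect_poly P) 0 \<noteq> 0" using \<open>P \<noteq> 0\<close> by simp
  note U = poly_unit[OF R K.inverse[OF t(1)] u this]
  have "poly P t = t ^ degree P * poly (reflect_poly P) (inverse t)"
    using t0 by (simp add: poly_reflect_poly_nz field_simps)
  then show "poly P t \<noteq> 0" "v (poly P t) = int (degree P) * v t"
    using U t0 t v_mult[of "t ^ degree P" "poly (reflect_poly P) (inverse t)"]
      v_power[OF t(1)] K.power polys_in_K[OF R K.inverse[OF t(1)]] by auto
qed

end

section \<open>Double covers of the projective line\<close>

locale alg_closed_subfield = complex_subfield k for k +
  assumes closed: "P \<in> polys k \<Longrightarrow> P \<noteq> 0 \<Longrightarrow> poly P x = 0 \<Longrightarrow> x \<in> k"
begin

lemma ex_sqrt: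
  assumes "a \<in> k" shows "\<exists>r\<in>k. r\<^sup>2 = a"
proof -
  have "[:- a, 0, 1:] \<in> polys k" using assms by (intro polys_intros uminus one zero)
  moreover have "poly [:- a, 0, 1:] (csqrt a) = 0"
    by (simp add: power2_eq_square[symmetric])
  ultimately have "csqrt a \<in> k" using closed by fastforce
  then show ?thesis by (intro bexI[of _ "csqrt a"]) auto
qed

lemma ex_root:
  assumes "P \<in> polys k" "degree P > 0"
  shows "\<exists>a\<in>k. poly P a = 0"
proof -
  have "\<exists>x. poly P x = 0"
    using fundamental_theorem_of_algebra[of P] assms(2) constant_degree[of P] by auto
  then show ?thesis using closed[OF assms(1)] assms(2) by fastforce
qed

lemma polys_factor_induct [consumes 2, case_names const factor]:
  assumes "P \<in> polys k" "P \<noteq> 0"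
    and const: "\<And>c. c \<in> k \<Longrightarrow> c \<noteq> 0 \<Longrightarrow> \<Phi> [:c:]"
    and factor: "\<And>a Q. a \<in> k \<Longrightarrow> Q \<in> polys k \<Longrightarrow> Q \<noteq> 0 \<Longrightarrow> \<Phi> Q \<Longrightarrow> \<Phi> ([:- a, 1:] * Q)"
  shows "\<Phi> P"
  using assms(1,2)
proof (induction "degree P" arbitrary: P rule: less_induct)
  case less
  show ?case
  proof (cases "degree P = 0")
    case True
    then obtain c where "P = [:c:]" by (metis degree_eq_zeroE)
    then show ?thesis using const[of c] polysD[OF less.prems(1), of 0] less.prems(2) by simp
  next
    case False
    then obtain a where a: "a \<in> k" "poly P a = 0" using ex_root[OF less.prems(1)] by auto
    define Q where "Q = synthetic_div P a"
    have P: "P = [:- a, 1:] * Q" using synthetic_div_correct'[of a P] a by (simp add: Q_def)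
    have Q: "Q \<in> polys k" unfolding Q_def by (rule polys_synthetic_div[OF less.prems(1) a(1)])
    have "Q \<noteq> 0" using P less.prems(2) by (metis mult_zero_right)
    moreover have "degree Q < degree P"
      using False by (simp add: Q_def degree_synthetic_div)
    ultimately show ?thesis unfolding P using factor[OF a(1) Q] less.hyps[OF _ Q] P by metis
  qed
qed

end

lemma polys_lowest:
  fixes P R :: "complex poly"
  assumes "P \<noteq> 0 \<or> R \<noteq> 0" and PF: "P \<in> polys F" and RF: "R \<in> polys F"
  obtains j P' R' where "P = monom 1 j * P'" "R = monom 1 j * R'" "P' \<in> polys F" "R' \<in> polys F"
    "coeff P' 0 \<noteq> 0 \<or> coeff R' 0 \<noteq> 0"
proof -
  define j where "j = (LEAST j. coeff P j \<noteq> 0 \<or> coeff R j \<noteq> 0)"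
  have "\<exists>j. coeff P j \<noteq> 0 \<or> coeff R j \<noteq> 0" using assms(1) by (metis leading_coeff_neq_0)
  then have j: "coeff P j \<noteq> 0 \<or> coeff R j \<noteq> 0" unfolding j_def by (rule LeastI_ex)
  have less: "coeff P i = 0 \<and> coeff R i = 0" if "i < j" for i
    using not_less_Least[OF that[unfolded j_def]] by blast
  have "P = monom 1 j * poly_shift j P" "R = monom 1 j * poly_shift j R"
    using less by (auto simp: poly_eq_iff coeff_monom_mult coeff_poly_shift not_le)
  moreover have "poly_shift j P \<in> polys F" "poly_shift j R \<in> polys F"
    using PF RF by (simp_all add: polys_def coeff_poly_shift)
  moreover have "coeff (poly_shift j P) 0 \<noteq> 0 \<or> coeff (poly_shift j R) 0 \<noteq> 0"
    using j by (simp add: coeff_poly_shift)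
  ultimately show ?thesis using that by blast
qed

text \<open>The function field \<open>k(t, s)\<close> with \<open>s\<^sup>2 = f(t)\<close>, a quadratic extension of the rational function field,
  as a field of complex numbers.  The last assumption says both that \<open>t\<close> is transcendental over \<open>k\<close> and
  that \<open>s\<close> does not lie in \<open>k(t)\<close>.  The bound 4 on the degree makes the genus at most 1.\<close>

locale double_cover = alg_closed_subfield k for k +
  fixes t s :: complex and f :: "complex poly"
  assumes f: "f \<in> polys k" and deg_f: "degree f \<le> 4" and s2: "s\<^sup>2 = poly f t"
    and indep: "P \<in> polys k \<Longrightarrow> R \<in> polys k \<Longrightarrow> poly P t + poly R t * s = 0 \<Longrightarrow> P = 0 \<and> R = 0"
begin

lemma poly_t_eq_0: "P \<in> polys k \<Longrightarrow> poly P t = 0 \<longleftrightarrow> P = 0"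
  using indep[of P 0] polys_0 by auto

lemma s_nz: "s \<noteq> 0"
  using indep[of 0 1] polys_0 polys_1 by auto

lemma t_notin: "t \<notin> k"
proof
  assume "t \<in> k"
  then have "[:- t, 1:] \<in> polys k" by (intro polys_intros uminus one)
  then show False using poly_t_eq_0[of "[:- t, 1:]"] by simp
qed

lemma t_nz: "t \<noteq> 0" using t_notin zero by auto

definition rat_funs :: "complex set" where
  "rat_funs = {poly P t / poly W t | P W. P \<in> polys k \<and> W \<in> polys k \<and> W \<noteq> 0}"

lemma rat_funsE:
  assumes "x \<in> rat_funs"
  obtains P W where "P \<in> polys k" "W \<in> polys k" "W \<noteq> 0" "poly W t \<noteq> 0" "x = poly P t / poly W t"
  using assms poly_t_eq_0 unfolding rat_funs_def by auto

lemma rat_funsI: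
  "P \<in> polys k \<Longrightarrow> W \<in> polys k \<Longrightarrow> W \<noteq> 0 \<Longrightarrow> x = poly P t / poly W t \<Longrightarrow> x \<in> rat_funs"
  unfolding rat_funs_def by blast

lemma polys_rat_funs: "P \<in> polys k \<Longrightarrow> poly P t \<in> rat_funs"
  by (rule rat_funsI[of P 1]) (auto intro: polys_1)

lemma k_rat_funs: "a \<in> k \<Longrightarrow> a \<in> rat_funs"
  using polys_rat_funs[OF polys_const] by simp

lemma t_rat_funs: "t \<in> rat_funs"
  using polys_rat_funs[of "[:0, 1:]"] by (auto intro: polys_intros zero one)

sublocale rf: complex_subfield rat_funs
proof
  show "1 \<in> rat_funs" using k_rat_funs one by auto
next
  fix x y assume "x \<in> rat_funs" "y \<in> rat_funs"
  then obtain P W P' W' where *: "P \<in> polys k" "W \<in> polys k" "W \<noteq> 0" "poly W t \<noteq> 0" "x = poly P t / poly W t"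
    "P' \<in> polys k" "W' \<in> polys k" "W' \<noteq> 0" "poly W' t \<noteq> 0" "y = poly P' t / poly W' t"
    by (auto elim!: rat_funsE)
  show "x + y \<in> rat_funs"
    by (rule rat_funsI[of "P * W' + P' * W" "W * W'"]) (use * in \<open>simp_all add: polys_intros add_frac_eq\<close>)
  show "x * y \<in> rat_funs"
    by (rule rat_funsI[of "P * P'" "W * W'"]) (use * in \<open>simp_all add: polys_intros\<close>)
next
  fix x assume "x \<in> rat_funs"
  then obtain P W where *: "P \<in> polys k" "W \<in> polys k" "W \<noteq> 0" "poly W t \<noteq> 0" "x = poly P t / poly W t"
    by (auto elim!: rat_funsE)
  show "- x \<in> rat_funs"
    by (rule rat_funsI[of "- P" W]) (use * in \<open>auto intro: polys_intros\<close>)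
  show "inverse x \<in> rat_funs"
  proof (cases "P = 0")
    case True
    then show ?thesis using * k_rat_funs[OF zero] by simp
  next
    case False
    then show ?thesis by (intro rat_funsI[of W P]) (use * in auto)
  qed
qed

lemma rat_funs_minimal:
  assumes "complex_subfield E" "k \<subseteq> E" "t \<in> E"
  shows "rat_funs \<subseteq> E"
proof
  interpret E: complex_subfield E by fact
  fix x assume "x \<in> rat_funs"
  then show "x \<in> E"
    by (elim rat_funsE) (auto intro!: E.divide E.poly_in polys_mono[OF assms(2)] assms(3))
qed

lemma rat_indep:
  assumes "A \<in> rat_funs" "B \<in> rat_funs" "A + B * s = 0"
  shows "A = 0 \<and> B = 0"
proof -
  obtain P W P' W' where *: "P \<in> polys k" "W \<in> polys k" "W \<noteq> 0" "poly W t \<noteq> 0" "A = poly P t / poly W t"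
    "P' \<in> polys k" "W' \<in> polys k" "W' \<noteq> 0" "poly W' t \<noteq> 0" "B = poly P' t / poly W' t"
    using assms by (auto elim!: rat_funsE)
  have "poly (P * W') t + poly (P' * W) t * s = (A + B * s) * (poly W t * poly W' t)"
    using * by (simp add: field_simps)
  then have "P * W' = 0 \<and> P' * W = 0"
    using * assms(3) by (intro indep) (auto intro: polys_intros)
  then show ?thesis using * by auto
qed

definition fun_field :: "complex set" where
  "fun_field = {A + B * s | A B. A \<in> rat_funs \<and> B \<in> rat_funs}"

lemma fun_fieldI: "A \<in> rat_funs \<Longrightarrow> B \<in> rat_funs \<Longrightarrow> x = A + B * s \<Longrightarrow> x \<in> fun_field"
  unfolding fun_field_def by blast

lemma rat_funs_fun_field: "x \<in> rat_funs \<Longrightarrow> x \<in> fun_field"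
  by (rule fun_fieldI[of x 0]) (auto intro: rf.zero)

lemma k_fun_field: "k \<subseteq> fun_field"
  using k_rat_funs rat_funs_fun_field by blast

lemma t_fun_field: "t \<in> fun_field"
  using t_rat_funs rat_funs_fun_field by blast

lemma s_fun_field: "s \<in> fun_field"
  by (rule fun_fieldI[of 0 1]) (auto intro: rf.zero rf.one)

lemma f_rat: "poly f t \<in> rat_funs" by (rule polys_rat_funs[OF f])

sublocale KK: complex_subfield fun_field
proof
  show "1 \<in> fun_field" using rat_funs_fun_field rf.one by auto
next
  fix x y assume "x \<in> fun_field" "y \<in> fun_field"
  then obtain A B A' B' where *: "A \<in> rat_funs" "B \<in> rat_funs" "x = A + B * s"
     "A' \<in> rat_funs" "B' \<in> rat_funs" "y = A' + B' * s"
    by (auto simp: fun_field_def)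
  show "x + y \<in> fun_field"
    by (rule fun_fieldI[of "A + A'" "B + B'"]) (use * in \<open>auto intro: rf.add simp: field_simps\<close>)
  show "x * y \<in> fun_field"
  proof (rule fun_fieldI[of "A * A' + B * B' * poly f t" "A * B' + B * A'"])
    show "x * y = A * A' + B * B' * poly f t + (A * B' + B * A') * s"
      using * by (simp add: field_simps s2[symmetric] power2_eq_square)
  qed (use * f_rat in \<open>auto intro!: rf.add rf.mult\<close>)
next
  fix x assume "x \<in> fun_field"
  then obtain A B where *: "A \<in> rat_funs" "B \<in> rat_funs" "x = A + B * s"
    by (auto simp: fun_field_def)
  show "- x \<in> fun_field"
    by (rule fun_fieldI[of "- A" "- B"]) (use * in \<open>auto intro: rf.uminus\<close>)
  show "inverse x \<in> fun_field"
  proof (cases "x = 0")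
    case True
    then show ?thesis using rat_funs_fun_field rf.zero by auto
  next
    case False
    have "A - B * s \<noteq> 0"
      using rat_indep[OF *(1) rf.uminus[OF *(2)]] * False by auto
    define N where "N = A\<^sup>2 - B\<^sup>2 * poly f t"
    have N: "N \<in> rat_funs" unfolding N_def using * f_rat by (auto intro!: rf.diff rf.mult rf.power)
    have N': "N = x * (A - B * s)"
      using * by (simp add: N_def s2[symmetric] power2_eq_square algebra_simps)
    then have "inverse x = (A - B * s) / N"
      using False \<open>A - B * s \<noteq> 0\<close> by (simp add: divide_inverse)
    then have "inverse x = A / N + (- B / N) * s"
      by (simp add: diff_divide_distrib)
    then show ?thesis
      using * N by (intro fun_fieldI[of "A / N" "- B / N"]) (auto intro!: rf.divide rf.uminus)
  qed
qed

lemma fun_field_minimal: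
  assumes "complex_subfield E" "k \<subseteq> E" "t \<in> E" "s \<in> E"
  shows "fun_field \<subseteq> E"
proof
  interpret E: complex_subfield E by fact
  fix x assume "x \<in> fun_field"
  then obtain A B where *: "A \<in> rat_funs" "B \<in> rat_funs" "x = A + B * s"
    by (auto simp: fun_field_def)
  then show "x \<in> E"
    using rat_funs_minimal[OF assms(1-3)] assms(4) by (auto intro: E.add E.mult)
qed

lemma fun_field_poly:
  assumes "x \<in> fun_field"
  obtains P R W where "P \<in> polys k" "R \<in> polys k" "W \<in> polys k" "W \<noteq> 0" "poly W t \<noteq> 0"
    "x * poly W t = poly P t + poly R t * s"
proof -
  obtain A B where x: "A \<in> rat_funs" "B \<in> rat_funs" "x = A + B * s"
    using assms by (auto simp: fun_field_def)
  obtain P W P' W' where *: "P \<in> polys k" "W \<in> polys k" "W \<noteq> 0" "poly W t \<noteq> 0" "A = poly P t / poly W t"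
    "P' \<in> polys k" "W' \<in> polys k" "W' \<noteq> 0" "poly W' t \<noteq> 0" "B = poly P' t / poly W' t"
    using x by (auto elim!: rat_funsE)
  show ?thesis
    by (rule that[of "P * W'" "P' * W" "W * W'"])
      (use * x in \<open>auto intro: polys_intros simp: field_simps\<close>)
qed

lemma norm_nz:
  assumes "P \<in> polys k" "R \<in> polys k" "P \<noteq> 0 \<or> R \<noteq> 0"
  shows "P\<^sup>2 - R\<^sup>2 * f \<noteq> 0"
proof
  assume "P\<^sup>2 - R\<^sup>2 * f = 0"
  then have "poly (P\<^sup>2 - R\<^sup>2 * f) t = 0" by simp
  then have "(poly P t + poly R t * s) * (poly P t + poly (- R) t * s) = 0"
    by (simp add: s2[symmetric] power2_eq_square algebra_simps)
  then show False
    using indep[of P R] indep[of P "- R"] assms polys_uminus[of R] by auto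
qed

end

lemma double_cover_eqI:
  assumes "double_cover k t s f" "double_cover k t' s' f'"
    and "t' \<in> double_cover.rat_funs k t" "t \<in> double_cover.rat_funs k t'"
    and "r \<in> double_cover.rat_funs k t" "r \<noteq> 0" "s' = r * s"
  shows "double_cover.rat_funs k t' = double_cover.rat_funs k t"
    and "double_cover.fun_field k t' s' = double_cover.fun_field k t s"
proof -
  interpret X: double_cover k t s f by fact
  interpret Y: double_cover k t' s' f' by fact
  show 1: "Y.rat_funs = X.rat_funs"
    using X.rat_funs_minimal[OF Y.rf.complex_subfield_axioms] Y.rat_funs_minimal[OF X.rf.complex_subfield_axioms]
      X.k_rat_funs Y.k_rat_funs assms by blast
  have "s' \<in> X.fun_field"
    using assms X.KK.mult X.rat_funs_fun_field X.s_fun_field by simp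
  moreover have "s = inverse r * s'" using assms by simp
  then have "s \<in> Y.fun_field"
    using assms Y.KK.mult[of "inverse r" s'] Y.rat_funs_fun_field Y.s_fun_field Y.rf.inverse[of r]
    by (simp add: 1 mult.assoc[symmetric])
  ultimately show "Y.fun_field = X.fun_field"
    using X.fun_field_minimal[OF Y.KK.complex_subfield_axioms] Y.fun_field_minimal[OF X.KK.complex_subfield_axioms]
      X.k_fun_field Y.k_fun_field X.rat_funs_fun_field Y.rat_funs_fun_field assms(3,4) by blast
qed

context double_cover
begin

text \<open>Moving a point \<open>t = a\<close> or \<open>t = \<infinity>\<close> to \<open>t = 0\<close> is a change of the coordinates \<open>t\<close> and \<open>s\<close> of the
  same field, so that places have to be studied above \<open>t = 0\<close> only.\<close>

lemma translate:
  assumes "a \<in> k"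
  shows "double_cover k (t - a) s (pcompose f [:a, 1:])"
    and "double_cover.rat_funs k (t - a) = rat_funs"
    and "double_cover.fun_field k (t - a) s = fun_field"
proof -
  have p: "poly (pcompose P [:- a, 1:]) t = poly P (t - a)" for P
    by (simp add: poly_pcompose)
  have pk: "pcompose P [:- a, 1:] \<in> polys k" if "P \<in> polys k" for P
    using that assms by (intro polys_intros uminus one)
  show D: "double_cover k (t - a) s (pcompose f [:a, 1:])"
  proof unfold_locales
    show "pcompose f [:a, 1:] \<in> polys k" using f assms by (intro polys_intros one)
    show "degree (pcompose f [:a, 1:]) \<le> 4" using deg_f by (simp add: degree_pcompose)
    show "s\<^sup>2 = poly (pcompose f [:a, 1:]) (t - a)" by (simp add: poly_pcompose s2)
    fix P R assume "P \<in> polys k" "R \<in> polys k" "poly P (t - a) + poly R (t - a) * s = 0"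
    then show "P = 0 \<and> R = 0"
      using indep[of "pcompose P [:- a, 1:]" "pcompose R [:- a, 1:]"] pk p
      by (simp add: pcompose_eq_0_iff)
  qed
  interpret D: double_cover k "t - a" s "pcompose f [:a, 1:]" by (rule D)
  have "t - a \<in> rat_funs" using t_rat_funs k_rat_funs assms by (intro rf.diff)
  moreover have "t \<in> D.rat_funs"
    using D.rf.add[OF D.t_rat_funs D.k_rat_funs[OF assms]] by simp
  ultimately show "D.rat_funs = rat_funs" "D.fun_field = fun_field"
    using double_cover_eqI[OF double_cover_axioms D, of 1] rf.one by auto
qed

text \<open>The polynomial \<open>x\<^sup>4 f(1/x)\<close>.\<close>

definition f_inv :: "complex poly" where
  "f_inv = reflect_poly f * monom 1 (4 - degree f)"

lemma invert:
  shows "double_cover k (inverse t) (s / t\<^sup>2) f_inv"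
    and "double_cover.rat_funs k (inverse t) = rat_funs"
    and "double_cover.fun_field k (inverse t) (s / t\<^sup>2) = fun_field"
proof -
  define rev where "rev P n = reflect_poly P * monom 1 (n - degree P)" for P :: "complex poly" and n
  have rev: "poly (rev P n) t = t ^ n * poly P (inverse t)" if "degree P \<le> n" for P n
  proof -
    have "t ^ n = t ^ degree P * t ^ (n - degree P)"
      using that by (simp flip: power_add)
    then show ?thesis
      using t_nz by (simp add: rev_def poly_reflect_poly_nz poly_monom)
  qed
  have revk: "rev P n \<in> polys k" if "P \<in> polys k" for P n
    using that by (auto simp: rev_def intro!: polys_intros polys_reflect one)
  have rev0: "rev P n = 0 \<longleftrightarrow> P = 0" for P n by (simp add: rev_def)
  show D: "double_cover k (inverse t) (s / t\<^sup>2) f_inv"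
  proof unfold_locales
    show "f_inv \<in> polys k" using f unfolding f_inv_def by (intro polys_intros polys_reflect one)
    have "degree f_inv \<le> degree f + (4 - degree f)"
      unfolding f_inv_def
      by (rule order.trans[OF degree_mult_le]) (intro add_mono degree_reflect_poly_le degree_monom_le)
    then show "degree f_inv \<le> 4" using deg_f by simp
    have "f_inv = rev f 4" by (simp add: f_inv_def rev_def)
    have "poly f_inv (inverse t) = poly f t / t ^ 4"
    proof -
      have "poly (reflect_poly f) (inverse t) = inverse t ^ degree f * poly f t"
        using t_nz by (simp add: poly_reflect_poly_nz)
      moreover have "(4::nat) = degree f + (4 - degree f)" using deg_f by simp
      then have "inverse t ^ 4 = inverse t ^ degree f * inverse t ^ (4 - degree f)"
        by (metis power_add)
      ultimately show ?thesis by (simp add: f_inv_def poly_monom field_simps)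
    qed
    then show "(s / t\<^sup>2)\<^sup>2 = poly f_inv (inverse t)"
      unfolding power_divide s2 by simp
    fix P R assume P: "P \<in> polys k" "R \<in> polys k"
      and eq: "poly P (inverse t) + poly R (inverse t) * (s / t\<^sup>2) = 0"
    define n where "n = degree P + degree R"
    have "poly (rev P (n + 2)) t + poly (rev R n) t * s = t ^ (n + 2) * (poly P (inverse t) + poly R (inverse t) * (s / t\<^sup>2))"
    proof -
      have P: "poly (rev P (n + 2)) t = t ^ (n + 2) * poly P (inverse t)"
        and R: "poly (rev R n) t = t ^ n * poly R (inverse t)"
        by (intro rev; simp add: n_def)+
      have "t ^ n * s = t ^ (n + 2) * (s / t\<^sup>2)"
        using t_nz by (simp add: power2_eq_square)
      then have "poly (rev R n) t * s = t ^ (n + 2) * (s / t\<^sup>2) * poly R (inverse t)"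
        unfolding R by (metis mult.assoc mult.commute)
      then show ?thesis unfolding P distrib_left by (metis mult.assoc mult.commute)
    qed
    then have "poly (rev P (n + 2)) t + poly (rev R n) t * s = 0" using eq by simp
    then show "P = 0 \<and> R = 0"
      using indep[OF revk revk] P rev0 by blast
  qed
  interpret D: double_cover k "inverse t" "s / t\<^sup>2" f_inv by (rule D)
  have "t \<in> D.rat_funs" using D.rf.inverse[OF D.t_rat_funs] by simp
  moreover have "s / t\<^sup>2 = inverse (t\<^sup>2) * s" by (simp add: field_simps)
  ultimately show "D.rat_funs = rat_funs" "D.fun_field = fun_field"
    using double_cover_eqI[OF double_cover_axioms D, of "inverse (t\<^sup>2)"] t_rat_funs t_nz
    by (auto intro!: rf.inverse rf.power)
qed

text \<open>Even powers of \<open>t\<close> in \<open>f\<close> can be moved into \<open>s\<close>.\<close>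

lemma reduce_at_0:
  obtains m h where "double_cover k t (s / t ^ m) h" "coeff h 0 \<noteq> 0 \<or> coeff h 1 \<noteq> 0"
    "double_cover.fun_field k t (s / t ^ m) = fun_field"
proof -
  have "f \<noteq> 0" using s2 s_nz by auto
  then obtain j g where g: "f = monom 1 j * g" "g \<in> polys k" "coeff g 0 \<noteq> 0"
    using polys_lowest[of f f k] f by auto
  define m where "m = j div 2"
  define h where "h = monom 1 (j mod 2) * g"
  have fh: "f = monom 1 (2 * m) * h"
    unfolding h_def m_def mult.assoc[symmetric] g(1) by (simp add: mult_monom)
  have hk: "h \<in> polys k" unfolding h_def using g by (intro polys_intros one)
  have h01: "coeff h 0 \<noteq> 0 \<or> coeff h 1 \<noteq> 0"
    using g(3) by (cases "even j") (auto simp: h_def coeff_monom_mult odd_iff_mod_2_eq_one)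
  have D: "double_cover k t (s / t ^ m) h"
  proof unfold_locales
    have "degree f = 2 * m + degree h"
    proof -
      have "h \<noteq> 0" using \<open>f \<noteq> 0\<close> fh by auto
      then show ?thesis unfolding fh by (subst degree_mult_eq) (simp_all add: degree_monom_eq)
    qed
    then show "degree h \<le> 4" using deg_f by simp
    show "(s / t ^ m)\<^sup>2 = poly h t"
    proof -
      have "poly f t = (t ^ m)\<^sup>2 * poly h t"
        by (subst fh) (simp add: poly_monom power_even_eq)
      moreover have "(t ^ m)\<^sup>2 \<noteq> 0" using t_nz by simp
      ultimately show ?thesis unfolding power_divide s2 by (metis nonzero_mult_div_cancel_left)
    qed
    fix P R assume P: "P \<in> polys k" "R \<in> polys k" "poly P t + poly R t * (s / t ^ m) = 0"
    have "poly (monom 1 m * P) t + poly R t * s = t ^ m * (poly P t + poly R t * (s / t ^ m))"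
      using t_nz by (simp add: poly_monom distrib_left)
    then have "poly (monom 1 m * P) t + poly R t * s = 0"
      using P(3) by simp
    then have "monom 1 m * P = 0 \<and> R = 0"
      using P by (intro indep polys_intros one)
    then show "P = 0 \<and> R = 0" by auto
  qed (rule hk)
  have "s / t ^ m = inverse (t ^ m) * s" by (simp add: field_simps)
  then have "double_cover.fun_field k t (s / t ^ m) = fun_field"
    using double_cover_eqI(2)[OF double_cover_axioms D, of "inverse (t ^ m)"] t_rat_funs t_nz
    by (auto intro!: rf.inverse rf.power)
  then show ?thesis using that D h01 by blast
qed

end

section \<open>The places above a point of the projective line\<close>

context place
begin

lemma poly_residue:
  assumes P: "P \<in> polys k" and t: "t \<in> K" "val_ge v 1 t"
  shows "val_ge v 1 (poly P t - coeff P 0)"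
proof -
  obtain a R where PR: "P = pCons a R" by (cases P) auto
  have R: "R \<in> polys k" using polysD[OF P, of "Suc _"] by (intro polysI) (simp add: PR)
  have "val_ge v (1 + 0) (t * poly R t)"
    using t R polys_in_K poly_ge ge_mono[of 1 t 0] by (intro ge_mult) auto
  then show ?thesis by (simp add: PR)
qed

lemma poly_order:
  assumes N: "N = monom 1 j * N'" "N' \<in> polys k" "coeff N' 0 \<noteq> 0" and t: "t \<in> K" "v t > 0"
  shows "v (poly N t) = int j * v t"
proof -
  have "t \<noteq> 0" using t v_0 by auto
  have g: "val_ge v 1 t" using t by (simp add: val_ge_def)
  show ?thesis
    unfolding N poly_mult poly_monom
    using poly_unit[OF N(2) t(1) g N(3)] v_mult[of "t ^ j" "poly N' t"] v_power[OF t(1), of j]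
      \<open>t \<noteq> 0\<close> K.power[OF t(1)] polys_in_K[OF N(2) t(1)] by simp
qed

end

text \<open>If each value on \<open>S\<close> is a multiple of the value of \<open>u\<close>, with a factor that does not depend on
  the place, then the value of \<open>u\<close> generates the value group, which leaves room for one place.\<close>

lemma place_unique:
  assumes S: "\<And>v. v \<in> S \<Longrightarrow> is_place k K v \<and> v u > 0"
    and val: "\<And>x. x \<in> K \<Longrightarrow> x \<noteq> 0 \<Longrightarrow> \<exists>n. \<forall>v\<in>S. v x = n * v u"
  shows "finite S" "card S \<le> 1" "\<And>v. v \<in> S \<Longrightarrow> v u = 1"
proof -
  show 1: "v u = 1" if "v \<in> S" for v
  proof -
    have "1 \<in> v ` (K - {0})" using S[OF that] unfolding is_place_def by blast
    then obtain x where "x \<in> K - {0}" "v x = 1" by (metis imageE)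
    then have "x \<in> K" "x \<noteq> 0" "v x = 1" by auto
    then obtain n where "1 = n * v u" using val[of x] \<open>v \<in> S\<close> by metis
    then show ?thesis using S[OF that] by (metis dvd_triv_right abs_of_pos zdvd1_eq)
  qed
  have eq: "v = v'" if "v \<in> S" "v' \<in> S" for v v'
  proof
    fix x
    show "v x = v' x"
    proof (cases "x \<in> K - {0}")
      case True
      then obtain n where "\<forall>v\<in>S. v x = n * v u" using val by auto
      then show ?thesis using that 1[OF that(1)] 1[OF that(2)] by metis
    next
      case False
      then show ?thesis using S that unfolding is_place_def by metis
    qed
  qed
  then have "S = {} \<or> (\<exists>v. S = {v})" by blast
  then show "finite S" "card S \<le> 1" by auto
qed

context double_cover
begin

lemma placeI: "is_place k fun_field v \<Longrightarrow> place k fun_field v"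
  by unfold_locales (auto simp: k_fun_field[THEN subsetD])

definition places_over_0 :: "(complex \<Rightarrow> int) set" where
  "places_over_0 = {v. is_place k fun_field v \<and> 0 < v t}"

lemma normal_form:
  assumes "x \<in> fun_field" "x \<noteq> 0"
  obtains i j P R W where "P \<in> polys k" "R \<in> polys k" "W \<in> polys k" "coeff W 0 \<noteq> 0"
    "coeff P 0 \<noteq> 0 \<or> coeff R 0 \<noteq> 0" "x * (t ^ i * poly W t) = t ^ j * (poly P t + poly R t * s)"
proof -
  obtain P R W where *: "P \<in> polys k" "R \<in> polys k" "W \<in> polys k" "W \<noteq> 0" "poly W t \<noteq> 0"
    "x * poly W t = poly P t + poly R t * s"
    using fun_field_poly[OF assms(1)] by blast
  then have "P \<noteq> 0 \<or> R \<noteq> 0" using assms(2) by auto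
  then obtain j P' R' where 1: "P = monom 1 j * P'" "R = monom 1 j * R'" "P' \<in> polys k" "R' \<in> polys k"
    "coeff P' 0 \<noteq> 0 \<or> coeff R' 0 \<noteq> 0"
    using polys_lowest[of P R k] * by auto
  obtain i W' where 2: "W = monom 1 i * W'" "W' \<in> polys k" "coeff W' 0 \<noteq> 0"
    using polys_lowest[of W W k] * by auto
  show ?thesis
    by (rule that[OF 1(3,4) 2(2,3) 1(5), of i j])
      (use *(6) in \<open>simp add: 1(1,2) 2(1) poly_monom distrib_left mult.assoc\<close>)
qed

lemma normal_form_nz:
  assumes "P \<in> polys k" "R \<in> polys k" "coeff P 0 \<noteq> 0 \<or> coeff R 0 \<noteq> 0"
  shows "poly P t + poly R t * s \<noteq> 0"
  using indep[OF assms(1,2)] assms(3) by auto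

lemma poly_fun_field: "P \<in> polys k \<Longrightarrow> poly P t \<in> fun_field"
  using polys_rat_funs rat_funs_fun_field by blast

lemma v_normal_form:
  assumes v: "v \<in> places_over_0" and x: "x \<in> fun_field" "x \<noteq> 0"
    and nf: "P \<in> polys k" "R \<in> polys k" "W \<in> polys k" "coeff W 0 \<noteq> 0"
    "coeff P 0 \<noteq> 0 \<or> coeff R 0 \<noteq> 0" "x * (t ^ i * poly W t) = t ^ j * (poly P t + poly R t * s)"
  shows "v x = (int j - int i) * v t + v (poly P t + poly R t * s)"
proof -
  interpret place k fun_field v using v placeI by (simp add: places_over_0_def)
  have g: "val_ge v 1 t" using v by (simp add: val_ge_def places_over_0_def)
  note W = poly_unit[OF nf(3) t_fun_field g nf(4)]
  have p: "t ^ n \<in> fun_field" "t ^ n \<noteq> 0" "v (t ^ n) = int n * v t" for n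
    using KK.power[OF t_fun_field] t_nz v_power[OF t_fun_field t_nz] by auto
  have z: "poly P t + poly R t * s \<in> fun_field"
    using nf(1,2) s_fun_field by (intro KK.add KK.mult poly_fun_field)
  have "v x + (v (t ^ i) + v (poly W t)) = v (t ^ j) + v (poly P t + poly R t * s)"
    using arg_cong[OF nf(6), of v] v_mult[of "t ^ i" "poly W t"] v_mult[of x "t ^ i * poly W t"]
      v_mult[OF p(1)[of j] z p(2) normal_form_nz[OF nf(1,2,5)]] p W x
      poly_fun_field[OF nf(3)] KK.mult by auto
  then show ?thesis using W p by (simp add: algebra_simps)
qed

lemma v_s_ge:
  assumes "is_place k fun_field v" "v t \<ge> 0"
  shows "val_ge v 0 s"
proof -
  interpret place k fun_field v using assms placeI by simp
  have "val_ge v 0 (s\<^sup>2)"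
    unfolding s2 using poly_ge[OF f t_fun_field] assms by (simp add: val_ge_def)
  then show ?thesis using v_of_square[OF s_fun_field] by (simp add: val_ge_def)
qed

end

locale reduced_double_cover = double_cover +
  assumes reduced: "coeff f 0 \<noteq> 0 \<or> coeff f 1 \<noteq> 0"
begin

text \<open>If \<open>f\<close> has a simple zero at \<open>0\<close> then \<open>2 v(s) = v(t)\<close>.  The values of \<open>P(t)\<close> and \<open>R(t) s\<close> are an even and an
  odd multiple of \<open>v(s)\<close>, and nothing cancels in the sum.\<close>

lemma ramified_value:
  assumes "coeff f 0 = 0" and v: "v \<in> places_over_0"
    and nf: "P \<in> polys k" "R \<in> polys k" "coeff P 0 \<noteq> 0 \<or> coeff R 0 \<noteq> 0"
  shows "v t = 2 * v s" "v (poly P t + poly R t * s) = (if coeff P 0 \<noteq> 0 then 0 else v s)"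
proof -
  interpret place k fun_field v using v placeI by (simp add: places_over_0_def)
  have g: "val_ge v 1 t" using v by (simp add: val_ge_def places_over_0_def)
  obtain h where fg: "f = pCons 0 h" using assms(1) by (cases f) auto
  have h: "h \<in> polys k" "coeff h 0 \<noteq> 0"
    using polysD[OF f, of "Suc _"] reduced assms(1) by (auto intro!: polysI simp: fg)
  have "v (s\<^sup>2) = v t + v (poly h t)"
    unfolding s2 fg using v_mult[OF t_fun_field poly_fun_field[OF h(1)] t_nz] poly_unit[OF h(1) t_fun_field g h(2)]
    by simp
  then show vt: "v t = 2 * v s"
    using poly_unit[OF h(1) t_fun_field g h(2)] v_of_square[OF s_fun_field] by simp
  have vs: "v s > 0" using vt v by (simp add: places_over_0_def)
  have Rs: "val_ge v (0 + v s) (poly R t * s)"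
    using poly_ge[OF nf(2) t_fun_field] g s_fun_field poly_fun_field nf
    by (intro ge_mult) (auto simp: val_ge_def)
  have inK: "poly P t \<in> fun_field" "poly R t * s \<in> fun_field"
    using nf by (auto intro: poly_fun_field KK.mult s_fun_field)
  show "v (poly P t + poly R t * s) = (if coeff P 0 \<noteq> 0 then 0 else v s)"
  proof (cases "coeff P 0 = 0")
    case False
    note U = poly_unit[OF nf(1) t_fun_field g False]
    have "val_ge v (v (poly P t) + 1) (poly R t * s)"
      using ge_mono[OF Rs] vs U by simp
    then show ?thesis using v_add_eq[OF inK U(1)] U(2) False by simp
  next
    case True
    then obtain P' where P': "P = pCons 0 P'" by (cases P) auto
    have P'k: "P' \<in> polys k" using polysD[OF nf(1), of "Suc _"] by (intro polysI) (simp add: P')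
    have "coeff R 0 \<noteq> 0" using nf True by simp
    note U = poly_unit[OF nf(2) t_fun_field g this]
    have vRs: "v (poly R t * s) = v s" "poly R t * s \<noteq> 0"
      using v_mult[OF poly_fun_field[OF nf(2)] s_fun_field] U s_nz by auto
    have "val_ge v (v t + 0) (t * poly P' t)"
      using poly_ge[OF P'k t_fun_field] g t_fun_field poly_fun_field P'k
      by (intro ge_mult) (auto simp: val_ge_def)
    then have "val_ge v (v (poly R t * s) + 1) (poly P t)"
      using vt vs vRs by (simp add: P' ge_mono)
    then show ?thesis using v_add_eq[OF inK(2,1) vRs(2)] vRs True by (simp add: add.commute)
  qed
qed

text \<open>At a place where \<open>s\<close> takes the value \<open>r\<close>, the function \<open>P(t) + R(t) s\<close> takes the value
  \<open>P(0) + R(0) r\<close>.\<close>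

lemma unramified_unit:
  assumes v: "v \<in> places_over_0" and r: "r \<in> k" "val_ge v 1 (s - r)"
    and nf: "P \<in> polys k" "R \<in> polys k" "coeff P 0 + coeff R 0 * r \<noteq> 0"
  shows "v (poly P t + poly R t * s) = 0"
proof -
  interpret place k fun_field v using v placeI by (simp add: places_over_0_def)
  have g: "val_ge v 1 t" using v by (simp add: val_ge_def places_over_0_def)
  have c: "c \<in> k \<Longrightarrow> c \<in> fun_field" for c using k_fun_field by blast
  define a where "a = coeff P 0 + coeff R 0 * r"
  have a: "a \<in> k" unfolding a_def using nf r polysD by (intro add mult) auto
  define e where "e = (poly P t - coeff P 0) + ((poly R t - coeff R 0) * s + coeff R 0 * (s - r))"
  have "val_ge v (1 + 0) ((poly R t - coeff R 0) * s)"
    using poly_residue[OF nf(2) t_fun_field g] v_s_ge[of v] v nf(2) c polysD[OF nf(2)]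
    by (intro ge_mult) (auto intro: KK.diff poly_fun_field s_fun_field simp: places_over_0_def)
  moreover have "val_ge v (0 + 1) (coeff R 0 * (s - r))"
    using r c polysD[OF nf(2)] ge_const by (intro ge_mult) (auto intro: KK.diff s_fun_field)
  ultimately have "val_ge v 1 e"
    unfolding e_def using poly_residue[OF nf(1) t_fun_field g] c polysD[OF nf(2)] polysD[OF nf(1)] r nf
    by (intro ge_add) (auto intro!: KK.diff KK.add KK.mult poly_fun_field s_fun_field)
  moreover have "e \<in> fun_field"
    unfolding e_def using c polysD[OF nf(2)] polysD[OF nf(1)] r nf
    by (auto intro!: KK.diff KK.add KK.mult poly_fun_field s_fun_field)
  moreover have "poly P t + poly R t * s = a + e" unfolding a_def e_def by (simp add: algebra_simps)
  ultimately show ?thesis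
    using v_add_eq[of a e] a c v_const[OF a] nf(3) by (simp add: a_def)
qed

text \<open>If \<open>P(t) + R(t) s\<close> vanishes at the place, then its conjugate \<open>P(t) - R(t) s\<close> does not, and the value is that
  of the norm \<open>P\<^sup>2 - R\<^sup>2 f\<close>, a polynomial in \<open>t\<close>.\<close>

lemma unramified_value:
  assumes r: "r \<in> k" "r\<^sup>2 = coeff f 0" "coeff f 0 \<noteq> 0"
    and nf: "P \<in> polys k" "R \<in> polys k" "coeff P 0 \<noteq> 0 \<or> coeff R 0 \<noteq> 0"
  shows "\<exists>n. \<forall>v\<in>places_over_0. val_ge v 1 (s - r) \<longrightarrow> v (poly P t + poly R t * s) = int n * v t"
proof (cases "coeff P 0 + coeff R 0 * r = 0")
  case False
  then show ?thesis using unramified_unit[OF _ r(1) _ nf(1,2)] by (intro exI[of _ 0]) auto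
next
  case True
  have "r \<noteq> 0" using r by auto
  have P0: "coeff P 0 \<noteq> 0" using True nf(3) \<open>r \<noteq> 0\<close> by auto
  have "coeff P 0 - coeff R 0 * r = 2 * coeff P 0" using True by (simp add: algebra_simps eq_neg_iff_add_eq_0)
  then have conj: "coeff P 0 + coeff (- R) 0 * r \<noteq> 0" using P0 by simp
  define N where "N = P\<^sup>2 - R\<^sup>2 * f"
  have Nk: "N \<in> polys k" unfolding N_def using nf f by (intro polys_intros)
  have "P \<noteq> 0" using P0 by auto
  then have "N \<noteq> 0" unfolding N_def using norm_nz[OF nf(1,2)] by simp
  then obtain j N' where N': "N = monom 1 j * N'" "N' \<in> polys k" "coeff N' 0 \<noteq> 0"
    using polys_lowest[of N N k] Nk by auto
  have eq: "poly N t = (poly P t + poly R t * s) * (poly P t + poly (- R) t * s)"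
    unfolding N_def by (simp add: s2[symmetric] power2_eq_square algebra_simps)
  show ?thesis
  proof (intro exI ballI impI)
    fix v assume v: "v \<in> places_over_0" "val_ge v 1 (s - r)"
    interpret place k fun_field v using v placeI by (simp add: places_over_0_def)
    have nz: "poly P t + poly R t * s \<noteq> 0" "poly P t + poly (- R) t * s \<noteq> 0"
      using normal_form_nz[OF nf] normal_form_nz[OF nf(1) polys_uminus[OF nf(2)]] nf(3) by auto
    have "v (poly N t) = v (poly P t + poly R t * s) + v (poly P t + poly (- R) t * s)"
      unfolding eq by (rule v_mult[OF _ _ nz])
       (use nf polys_uminus[OF nf(2)] in \<open>auto intro!: KK.add KK.mult KK.diff s_fun_field poly_fun_field simp del: poly_minus\<close>)
    then show "v (poly P t + poly R t * s) = int j * v t"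
      using poly_order[OF N' t_fun_field] v unramified_unit[OF v(1) r(1) v(2) nf(1) polys_uminus[OF nf(2)] conj]
      by (simp add: places_over_0_def)
  qed
qed

text \<open>The fundamental inequality for the extension of degree 2: there is at most one place above \<open>t = 0\<close>, with
  \<open>v(t) = 2\<close>, if \<open>f(0) = 0\<close>, and otherwise there is at most one with \<open>v(t) = 1\<close> for each of the two square roots
  of \<open>f(0)\<close>.\<close>

lemma sum_places_over_0_reduced: "finite places_over_0 \<and> (\<Sum>v\<in>places_over_0. v t) \<le> 2"
proof (cases "coeff f 0 = 0")
  case True
  have vt: "v t = 2 * v s" if "v \<in> places_over_0" for v
    using ramified_value(1)[OF True that polys_1 polys_1] by simp
  have val: "\<exists>n. \<forall>v\<in>places_over_0. v x = n * v s" if "x \<in> fun_field" "x \<noteq> 0" for x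
  proof -
    obtain i j P R W where nf: "P \<in> polys k" "R \<in> polys k" "W \<in> polys k" "coeff W 0 \<noteq> 0"
      "coeff P 0 \<noteq> 0 \<or> coeff R 0 \<noteq> 0" "x * (t ^ i * poly W t) = t ^ j * (poly P t + poly R t * s)"
      by (rule normal_form[OF \<open>x \<in> fun_field\<close> \<open>x \<noteq> 0\<close>])
    have "v x = (2 * (int j - int i) + (if coeff P 0 \<noteq> 0 then 0 else 1)) * v s"
      if v: "v \<in> places_over_0" for v
      using v_normal_form[OF v \<open>x \<in> fun_field\<close> \<open>x \<noteq> 0\<close> nf] ramified_value(2)[OF True v nf(1,2,5)] vt[OF v]
      by (simp add: algebra_simps)
    then show ?thesis by blast
  qed
  have pos: "is_place k fun_field v \<and> v s > 0" if "v \<in> places_over_0" for v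
    using vt[OF that] that by (simp add: places_over_0_def)
  note U = place_unique[of places_over_0 k fun_field s, OF pos val]
  have "(\<Sum>v\<in>places_over_0. v t) = (\<Sum>v\<in>places_over_0. 2)"
  proof (rule sum.cong)
    fix v assume "v \<in> places_over_0"
    then show "v t = 2" using U(3)[of v] vt[of v] by simp
  qed simp
  then show ?thesis using U by simp
next
  case False
  obtain r where r: "r \<in> k" "r\<^sup>2 = coeff f 0" using ex_sqrt polysD[OF f] by blast
  define S where "S r = {v \<in> places_over_0. val_ge v 1 (s - r)}" for r
  have S: "finite (S r) \<and> (\<Sum>v\<in>S r. v t) \<le> 1" if r: "r \<in> k" "r\<^sup>2 = coeff f 0" for r
  proof -
    have val: "\<exists>n. \<forall>v\<in>S r. v x = n * v t" if "x \<in> fun_field" "x \<noteq> 0" for x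
    proof -
      obtain i j P R W where nf: "P \<in> polys k" "R \<in> polys k" "W \<in> polys k" "coeff W 0 \<noteq> 0"
        "coeff P 0 \<noteq> 0 \<or> coeff R 0 \<noteq> 0" "x * (t ^ i * poly W t) = t ^ j * (poly P t + poly R t * s)"
        by (rule normal_form[OF \<open>x \<in> fun_field\<close> \<open>x \<noteq> 0\<close>])
      obtain n where n: "\<forall>v\<in>places_over_0. val_ge v 1 (s - r) \<longrightarrow> v (poly P t + poly R t * s) = int n * v t"
        using unramified_value[OF r False nf(1,2,5)] by blast
      have "v x = (int j - int i + int n) * v t" if v: "v \<in> S r" for v
        using v_normal_form[OF _ \<open>x \<in> fun_field\<close> \<open>x \<noteq> 0\<close> nf, of v] n v unfolding S_def
        by (auto simp add: algebra_simps)
      then show ?thesis by blast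
    qed
    have pos: "is_place k fun_field v \<and> v t > 0" if "v \<in> S r" for v
      using that by (simp add: places_over_0_def S_def)
    note U = place_unique[of "S r" k fun_field t, OF pos val]
    have "(\<Sum>v\<in>S r. v t) = (\<Sum>v\<in>S r. 1)" by (rule sum.cong) (use U(3) in \<open>blast+\<close>)
    then show ?thesis using U by simp
  qed
  have "places_over_0 \<subseteq> S r \<union> S (- r)"
  proof
    fix v assume v: "v \<in> places_over_0"
    interpret place k fun_field v using v placeI by (simp add: places_over_0_def)
    have g: "val_ge v 1 t" using v by (simp add: val_ge_def places_over_0_def)
    have rK: "r \<in> fun_field" using r k_fun_field by blast
    have inK: "s - r \<in> fun_field" "s + r \<in> fun_field"
      using rK s_fun_field by (auto intro: KK.diff KK.add)
    have "val_ge v 0 s" using v_s_ge v by (simp add: places_over_0_def)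
    then have ge: "val_ge v 0 (s - r)" "val_ge v 0 (s + r)"
      using ge_const[OF r(1)] rK s_fun_field by (auto intro: ge_add ge_diff)
    have "(s - r) * (s + r) = poly f t - coeff f 0"
      using r s2 by (simp add: algebra_simps power2_eq_square)
    then have *: "val_ge v 1 ((s - r) * (s + r))" using poly_residue[OF f t_fun_field g] by simp
    have "val_ge v 1 (s - r) \<or> val_ge v 1 (s + r)"
      using * ge v_mult[OF inK] by (fastforce simp: val_ge_def)
    then show "v \<in> S r \<union> S (- r)" using v by (simp add: S_def)
  qed
  moreover have "S r \<union> S (- r) \<subseteq> places_over_0" by (auto simp: S_def)
  ultimately have eq: "places_over_0 = S r \<union> S (- r)" by blast
  have "(- r)\<^sup>2 = coeff f 0" "- r \<in> k" using r uminus by auto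
  note S1 = S[OF r] and S2 = S[OF this(2,1)]
  have "(\<Sum>v\<in>S r \<union> S (- r). v t) + (\<Sum>v\<in>S r \<inter> S (- r). v t) = (\<Sum>v\<in>S r. v t) + (\<Sum>v\<in>S (- r). v t)"
    using S1 S2 by (intro sum.union_inter) auto
  moreover have "(\<Sum>v\<in>S r \<inter> S (- r). v t) \<ge> 0"
    by (intro sum_nonneg) (auto simp: S_def places_over_0_def)
  ultimately show ?thesis unfolding eq using S1 S2 by auto
qed

end

context double_cover
begin

lemma sum_places_over_0: "finite places_over_0" "(\<Sum>v\<in>places_over_0. v t) \<le> 2"
proof -
  obtain m h where h: "double_cover k t (s / t ^ m) h" "coeff h 0 \<noteq> 0 \<or> coeff h 1 \<noteq> 0"
    "double_cover.fun_field k t (s / t ^ m) = fun_field"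
    by (rule reduce_at_0)
  interpret R: reduced_double_cover k t "s / t ^ m" h
    using h by (simp add: reduced_double_cover_def reduced_double_cover_axioms_def)
  have "R.places_over_0 = places_over_0"
    by (simp add: R.places_over_0_def places_over_0_def h(3))
  then show "finite places_over_0" "(\<Sum>v\<in>places_over_0. v t) \<le> 2"
    using R.sum_places_over_0_reduced by auto
qed

text \<open>The function \<open>x\<close> satisfies a quadratic equation over \<open>k[t]\<close>, which remains nontrivial at
  \<open>t = 0\<close> after division by a power of \<open>t\<close>, and its roots at \<open>t = 0\<close> lie in \<open>k\<close>.\<close>

lemma residue_over_0:
  assumes v: "v \<in> places_over_0" and x: "x \<in> fun_field" "val_ge v 0 x"
  shows "\<exists>a\<in>k. val_ge v 1 (x - a)"
proof -
  interpret place k fun_field v using v placeI by (simp add: places_over_0_def)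
  have g: "val_ge v 1 t" using v by (simp add: val_ge_def places_over_0_def)
  have c: "c \<in> k \<Longrightarrow> c \<in> fun_field" for c using k_fun_field by blast
  obtain P R W where *: "P \<in> polys k" "R \<in> polys k" "W \<in> polys k" "W \<noteq> 0" "poly W t \<noteq> 0"
    "x * poly W t = poly P t + poly R t * s"
    using fun_field_poly[OF x(1)] by blast
  define C :: "nat \<Rightarrow> complex poly" where
    "C i = (if i = 0 then P\<^sup>2 - R\<^sup>2 * f else if i = 1 then - (2 * P * W) else W\<^sup>2)" for i
  have Ck: "C i \<in> polys k" for i
    unfolding C_def using * f by (auto intro!: polys_intros)
  have "(x * poly W t - poly P t)\<^sup>2 = (poly R t)\<^sup>2 * poly f t"
    by (simp add: *(6) s2[symmetric] power_mult_distrib)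
  then have quad: "poly (C 0) t + poly (C 1) t * x + poly (C 2) t * x\<^sup>2 = 0"
    by (simp add: C_def power2_eq_square algebra_simps)
  define j where "j = (LEAST j. \<exists>i<3. coeff (C i) j \<noteq> 0)"
  have "\<exists>j. \<exists>i<3. coeff (C i) j \<noteq> 0"
  proof -
    have "C 2 \<noteq> 0" using * by (simp add: C_def)
    then have "coeff (C 2) (degree (C 2)) \<noteq> 0" by simp
    then show ?thesis by (intro exI[of _ "degree (C 2)"] exI[of _ 2]) simp
  qed
  then have j: "\<exists>i<3. coeff (C i) j \<noteq> 0" unfolding j_def by (rule LeastI_ex)
  have less: "coeff (C i) l = 0" if "i < 3" "l < j" for i l
    using not_less_Least[of l, folded j_def] that by (metis (mono_tags, lifting) j_def not_less_Least)
  define D where "D i = poly_shift j (C i)" for i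
  have Dk: "D i \<in> polys k" for i unfolding D_def by (rule polys_poly_shift[OF Ck])
  have CD: "C i = monom 1 j * D i" if "i < 3" for i
    using less[OF that] by (auto simp: D_def poly_eq_iff coeff_monom_mult coeff_poly_shift not_le)
  have "t ^ j * (poly (D 0) t + poly (D 1) t * x + poly (D 2) t * x\<^sup>2) = 0"
    using quad by (simp add: CD poly_monom algebra_simps)
  then have quadD: "poly (D 0) t + poly (D 1) t * x + poly (D 2) t * x\<^sup>2 = 0" using t_nz by simp
  define p where "p = [:coeff (D 0) 0, coeff (D 1) 0, coeff (D 2) 0:]"
  have pk: "p \<in> polys k" unfolding p_def using polysD[OF Dk] by (intro polys_intros)
  have p0: "p \<noteq> 0"
  proof -
    from j obtain i where "i < 3" "coeff (C i) j \<noteq> 0" by blast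
    then have "coeff (D i) 0 \<noteq> 0" by (simp add: D_def coeff_poly_shift)
    moreover have "i = 0 \<or> i = 1 \<or> i = 2" using \<open>i < 3\<close> by linarith
    ultimately show ?thesis by (auto simp: p_def)
  qed
  have px: "poly p x = - ((poly (D 0) t - coeff (D 0) 0) + ((poly (D 1) t - coeff (D 1) 0) * x
    + (poly (D 2) t - coeff (D 2) 0) * x\<^sup>2))"
    using quadD by (simp add: p_def power2_eq_square algebra_simps)
  have dK: "poly (D i) t - coeff (D i) 0 \<in> fun_field" for i
    using polysD[OF Dk] Dk c by (intro KK.diff poly_fun_field) auto
  have dg: "val_ge v 1 (poly (D i) t - coeff (D i) 0)" for i
    by (rule poly_residue[OF Dk t_fun_field g])
  have x2: "val_ge v 0 (x\<^sup>2)" using ge_mult[OF x(1) x(1) x(2) x(2)] by (simp add: power2_eq_square)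
  have px1: "val_ge v 1 (poly p x)"
    unfolding px
    using dg[of 0] ge_mult[OF dK[of 1] x(1) dg x(2)] ge_mult[OF dK[of 2] KK.power[OF x(1)] dg x2]
      dK x(1)
    by (intro ge_uminus ge_add) (auto intro!: KK.add KK.mult KK.power)
  have "val_ge v 1 (poly p x) \<longrightarrow> (\<exists>a\<in>k. val_ge v 1 (x - a))"
    using pk p0
  proof (induction p rule: polys_factor_induct)
    case (const b)
    then show ?case using v_const[of b] by (simp add: val_ge_def)
  next
    case (factor a Q)
    have inK: "x - a \<in> fun_field" "poly Q x \<in> fun_field"
      using x factor c polys_in_K[of Q x] by (auto intro: KK.diff)
    have "val_ge v 0 (x - a)" using x factor(1) c ge_const by (intro ge_diff) auto
    moreover have "val_ge v 0 (poly Q x)" by (rule poly_ge[OF factor(2) x])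
    moreover have "poly ([:- a, 1:] * Q) x = (x - a) * poly Q x" by (simp add: algebra_simps)
    ultimately have "val_ge v 1 (poly ([:- a, 1:] * Q) x) \<longrightarrow> val_ge v 1 (x - a) \<or> val_ge v 1 (poly Q x)"
      using v_mult[OF inK] by (fastforce simp: val_ge_def)
    then show ?case using factor by blast
  qed
  then show ?thesis using px1 by blast
qed

end

section \<open>Existence of places from power series\<close>

text \<open>Substituting a power of the series variable for \<open>t\<close>.\<close>

definition series :: "nat \<Rightarrow> complex poly \<Rightarrow> complex fps" where
  "series e P = fps_of_poly (pcompose P (monom 1 e))"

lemma series_add: "series e (P + R) = series e P + series e R"
  and series_diff: "series e (P - R) = series e P - series e R"
  and series_uminus: "series e (- P) = - series e P"
  and series_mult: "series e (P * R) = series e P * series e R"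
  by (simp_all add: series_def pcompose_add pcompose_diff pcompose_uminus pcompose_mult
    fps_of_poly_add fps_of_poly_diff fps_of_poly_uminus fps_of_poly_mult)

lemma series_const: "series e [:c:] = fps_const c"
  by (simp add: series_def fps_of_poly_const)

lemma series_0: "series e 0 = 0"
  by (simp add: series_def)

lemma series_1: "series e 1 = 1"
  by (simp add: series_def pcompose_1)

lemma series_X: "series e [:0, 1:] = fps_X ^ e"
  by (simp add: series_def pcompose_pCons fps_of_poly_monom' del: One_nat_def)

lemma series_eq_0_iff:
  assumes "e > 0" shows "series e P = 0 \<longleftrightarrow> P = 0"
proof -
  have "degree (monom (1::complex) e) = e" by (simp add: degree_monom_eq)
  then have "pcompose P (monom 1 e) = 0 \<longleftrightarrow> P = 0" using assms by (intro pcompose_eq_0_iff) simp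
  then show ?thesis by (simp add: series_def)
qed

lemma series_nth_0:
  assumes "e > 0" shows "fps_nth (series e P) 0 = coeff P 0"
proof -
  have "coeff (pcompose P (monom 1 e)) 0 = poly (pcompose P (monom 1 e)) 0"
    by (simp add: poly_0_coeff_0)
  also have "\<dots> = poly P 0" using assms by (simp add: poly_pcompose poly_monom power_0_left)
  finally show ?thesis by (simp add: series_def poly_0_coeff_0)
qed

lemma fps_sqrt_exists:
  fixes h :: "complex fps"
  assumes "fps_nth h 0 \<noteq> 0"
  obtains y where "y\<^sup>2 = h" "fps_nth y 0 \<noteq> 0"
proof -
  define r where "r = (\<lambda>(n::nat) (x::complex). csqrt (fps_nth h 0))"
  have "fps_radical r (Suc 1) h ^ Suc 1 = h"
    by (subst power_radical[symmetric]) (use assms in \<open>auto simp: r_def power2_eq_square[symmetric]\<close>)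
  moreover have "fps_nth (fps_radical r (Suc 1) h) 0 \<noteq> 0"
    using assms by (simp add: r_def)
  ultimately show ?thesis using that[of "fps_radical r (Suc 1) h"] by (simp add: power2_eq_square)
qed

context double_cover
begin

text \<open>Given a power series \<open>Y\<close> with \<open>Y\<^sup>2 = f(\<tau>\<^sup>e)\<close>, the substitution \<open>t = \<tau>\<^sup>e\<close>, \<open>s = Y\<close> embeds
  the function field into the field of Laurent series in \<open>\<tau>\<close>, and the order in \<open>\<tau>\<close> becomes a place.  Numerator
  and denominator are kept apart, so that only power series occur.\<close>

definition num :: "nat \<Rightarrow> complex fps \<Rightarrow> complex poly \<Rightarrow> complex poly \<Rightarrow> complex fps" where
  "num e Y P R = series e P + series e R * Y"

definition fraction :: "complex \<Rightarrow> complex poly \<Rightarrow> complex poly \<Rightarrow> complex poly \<Rightarrow> bool" where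
  "fraction x P R W \<longleftrightarrow> P \<in> polys k \<and> R \<in> polys k \<and> W \<in> polys k \<and> W \<noteq> 0 \<and>
     x * poly W t = poly P t + poly R t * s"

definition series_val :: "nat \<Rightarrow> complex fps \<Rightarrow> complex \<Rightarrow> int" where
  "series_val e Y x = (if x \<in> fun_field - {0}
     then SOME n. \<exists>P R W. fraction x P R W \<and> n = int (subdegree (num e Y P R)) - int (subdegree (series e W))
     else 0)"

lemma fraction_nz: "fraction x P R W \<Longrightarrow> poly W t \<noteq> 0"
  by (auto simp: fraction_def poly_t_eq_0)

lemma fraction_ex: "x \<in> fun_field \<Longrightarrow> \<exists>P R W. fraction x P R W"
  by (erule fun_field_poly) (auto simp: fraction_def)

lemma fraction_fun_field: "fraction x P R W \<Longrightarrow> x \<in> fun_field"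
proof -
  assume *: "fraction x P R W"
  then have "x = (poly P t + poly R t * s) / poly W t"
    using fraction_nz[OF *] by (simp add: fraction_def field_simps)
  then show ?thesis
    using * by (auto simp: fraction_def intro!: KK.divide KK.add KK.mult poly_fun_field s_fun_field)
qed

lemma fraction_0: "fraction x P R W \<Longrightarrow> x = 0 \<longleftrightarrow> P = 0 \<and> R = 0"
  using fraction_nz[of x P R W] indep[of P R] unfolding fraction_def by auto

lemma fraction_mult:
  assumes "fraction x P R W" "fraction x' P' R' W'"
  shows "fraction (x * x') (P * P' + R * R' * f) (P * R' + R * P') (W * W')"
proof -
  have "x * x' * poly (W * W') t = (x * poly W t) * (x' * poly W' t)" by simp
  also have "\<dots> = (poly P t + poly R t * s) * (poly P' t + poly R' t * s)"
    using assms by (simp add: fraction_def)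
  also have "\<dots> = poly (P * P' + R * R' * f) t + poly (P * R' + R * P') t * s"
    by (simp add: s2[symmetric] power2_eq_square algebra_simps)
  finally show ?thesis
    using assms f unfolding fraction_def by (auto intro!: polys_intros)
qed

lemma fraction_add:
  assumes "fraction x P R W" "fraction x' P' R' W'"
  shows "fraction (x + x') (P * W' + P' * W) (R * W' + R' * W) (W * W')"
proof -
  have "(x + x') * poly (W * W') t = (x * poly W t) * poly W' t + (x' * poly W' t) * poly W t"
    by (simp add: algebra_simps)
  also have "\<dots> = (poly P t + poly R t * s) * poly W' t + (poly P' t + poly R' t * s) * poly W t"
    using assms by (simp add: fraction_def)
  also have "\<dots> = poly (P * W' + P' * W) t + poly (R * W' + R' * W) t * s"
    by (simp add: algebra_simps)
  finally show ?thesis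
    using assms unfolding fraction_def by (auto intro!: polys_intros)
qed

lemma fraction_unique:
  assumes "fraction x P R W" "fraction x P' R' W'"
  shows "P * W' = P' * W" "R * W' = R' * W"
proof -
  have "poly (P * W' - P' * W) t + poly (R * W' - R' * W) t * s
     = (poly P t + poly R t * s) * poly W' t - (poly P' t + poly R' t * s) * poly W t"
    by (simp add: algebra_simps)
  also have "\<dots> = x * poly W t * poly W' t - x * poly W' t * poly W t"
    using assms by (simp add: fraction_def)
  also have "\<dots> = 0" by simp
  finally have "poly (P * W' - P' * W) t + poly (R * W' - R' * W) t * s = 0" .
  moreover have "P * W' - P' * W \<in> polys k" "R * W' - R' * W \<in> polys k"
    using assms unfolding fraction_def by (auto intro!: polys_intros)
  ultimately have "P * W' - P' * W = 0 \<and> R * W' - R' * W = 0"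
    by (intro indep)
  then show "P * W' = P' * W" "R * W' = R' * W" by auto
qed

context
  fixes e :: nat and Y :: "complex fps"
  assumes e: "e > 0" and Y2: "Y\<^sup>2 = series e f"
begin

lemma num_mult: "num e Y P R * num e Y P' R' = num e Y (P * P' + R * R' * f) (P * R' + R * P')"
  by (simp add: num_def series_add series_mult Y2[symmetric] power2_eq_square algebra_simps)

lemma num_times: "num e Y P R * series e W = num e Y (P * W) (R * W)"
  by (simp add: num_def series_mult algebra_simps)

text \<open>The product with the conjugate is the image of the norm, a nonzero polynomial.\<close>

lemma num_nz:
  assumes "P \<in> polys k" "R \<in> polys k" "P \<noteq> 0 \<or> R \<noteq> 0"
  shows "num e Y P R \<noteq> 0"
proof -
  have "num e Y P R * num e Y P (- R) = series e (P\<^sup>2 - R\<^sup>2 * f)"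
    by (simp add: num_mult power2_eq_square mult.assoc) (simp add: num_def series_0 mult.commute)
  also have "\<dots> \<noteq> 0" using norm_nz[OF assms] by (simp add: series_eq_0_iff[OF e])
  finally show ?thesis by auto
qed

lemma fraction_num_nz:
  assumes "fraction x P R W" "x \<noteq> 0"
  shows "num e Y P R \<noteq> 0" "series e W \<noteq> 0"
proof -
  have "P \<noteq> 0 \<or> R \<noteq> 0" using fraction_0[OF assms(1)] assms(2) by blast
  then show "num e Y P R \<noteq> 0" using assms(1) by (intro num_nz) (auto simp: fraction_def)
  show "series e W \<noteq> 0" using assms(1) by (simp add: fraction_def series_eq_0_iff[OF e])
qed

lemma series_val_eq:
  assumes x: "x \<noteq> 0" and F: "fraction x P R W"
  shows "series_val e Y x = int (subdegree (num e Y P R)) - int (subdegree (series e W))"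
proof -
  have "n = int (subdegree (num e Y P R)) - int (subdegree (series e W))"
    if "\<exists>P R W. fraction x P R W \<and> n = int (subdegree (num e Y P R)) - int (subdegree (series e W))" for n
  proof -
    from that obtain P' R' W' where F': "fraction x P' R' W'"
      "n = int (subdegree (num e Y P' R')) - int (subdegree (series e W'))" by blast
    note nz = fraction_num_nz[OF F x] fraction_num_nz[OF F'(1) x]
    have "num e Y P R * series e W' = num e Y P' R' * series e W"
      using fraction_unique[OF F F'(1)] by (simp add: num_times)
    then have "subdegree (num e Y P R) + subdegree (series e W') = subdegree (num e Y P' R') + subdegree (series e W)"
      using nz by (metis subdegree_mult)
    then show ?thesis using F'(2) by simp
  qed
  then show ?thesis
    unfolding series_val_def using fraction_fun_field[OF F] x F by (auto intro!: some_equality)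
qed

text \<open>An element of value 1 is needed for the value group to be all of the integers: the substitution might factor
  through a power of the series variable.\<close>

lemma is_place_series_val:
  assumes y: "y \<in> fun_field" "y \<noteq> 0" "series_val e Y y = 1"
  shows "is_place k fun_field (series_val e Y)"
proof -
  have mult: "series_val e Y (a * b) = series_val e Y a + series_val e Y b"
    if ab: "a \<in> fun_field - {0}" "b \<in> fun_field - {0}" for a b
  proof -
    obtain P R W P' R' W' where F: "fraction a P R W" "fraction b P' R' W'"
      using fraction_ex ab by (metis DiffD1)
    have "a \<noteq> 0" "b \<noteq> 0" using ab by auto
    note nz = fraction_num_nz[OF F(1) this(1)] fraction_num_nz[OF F(2) this(2)]
    show ?thesis
      using that series_val_eq[OF _ F(1)] series_val_eq[OF _ F(2)] series_val_eq[OF _ fraction_mult[OF F]] nz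
      by (simp add: num_mult[symmetric] series_mult)
  qed
  have add: "min (series_val e Y a) (series_val e Y b) \<le> series_val e Y (a + b)"
    if ab: "a \<in> fun_field - {0}" "b \<in> fun_field - {0}" "a + b \<noteq> 0" for a b
  proof -
    obtain P R W P' R' W' where F: "fraction a P R W" "fraction b P' R' W'"
      using fraction_ex ab by (metis DiffD1)
    have "a \<noteq> 0" "b \<noteq> 0" using ab by auto
    note nz = fraction_num_nz[OF F(1) this(1)] fraction_num_nz[OF F(2) this(2)]
    note FA = fraction_add[OF F]
    have eq: "num e Y (P * W' + P' * W) (R * W' + R' * W) = num e Y P R * series e W' + num e Y P' R' * series e W"
      by (simp add: num_def series_add series_mult algebra_simps)
    have "num e Y (P * W' + P' * W) (R * W' + R' * W) \<noteq> 0"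
      using fraction_0[OF FA] that(3) FA by (intro num_nz) (auto simp: fraction_def)
    then have "min (subdegree (num e Y P R * series e W')) (subdegree (num e Y P' R' * series e W))
      \<le> subdegree (num e Y (P * W' + P' * W) (R * W' + R' * W))"
      unfolding eq by (rule subdegree_add_ge')
    then have "min (subdegree (num e Y P R) + subdegree (series e W')) (subdegree (num e Y P' R') + subdegree (series e W))
      \<le> subdegree (num e Y (P * W' + P' * W) (R * W' + R' * W))"
      using nz by simp
    then show ?thesis
      using that series_val_eq[OF _ F(1)] series_val_eq[OF _ F(2)] series_val_eq[OF _ FA] nz
      by (simp add: series_mult)
  qed
  have const: "series_val e Y c = 0" if "c \<in> k - {0}" for c
  proof -
    have "fraction c [:c:] 0 1" using that by (auto simp: fraction_def intro!: polys_intros)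
    then show ?thesis
      using that series_val_eq[of c "[:c:]" 0 1] by (simp add: num_def series_const series_0 series_1)
  qed
  have pow: "y ^ n \<in> fun_field - {0} \<and> series_val e Y (y ^ n) = int n" for n
  proof (induction n)
    case 0
    then show ?case using const[of 1] one KK.one by simp
  next
    case (Suc n)
    then show ?case using mult[of y "y ^ n"] y KK.mult by auto
  qed
  have inv: "series_val e Y (inverse x) = - series_val e Y x" if "x \<in> fun_field - {0}" for x
    using mult[of x "inverse x"] that KK.inverse const[of 1] one by auto
  have "\<exists>x\<in>fun_field - {0}. series_val e Y x = n" for n
  proof (cases "n \<ge> 0")
    case True
    then show ?thesis using pow[of "nat n"] by (intro bexI[of _ "y ^ nat n"]) auto
  next
    case False
    then show ?thesis using pow[of "nat (- n)"] inv[of "y ^ nat (- n)"] KK.inverse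
      by (intro bexI[of _ "inverse (y ^ nat (- n))"]) auto
  qed
  then have "series_val e Y ` (fun_field - {0}) = UNIV" by (metis UNIV_eq_I image_iff)
  moreover have "series_val e Y x = 0" if "x \<notin> fun_field - {0}" for x
    using that by (auto simp: series_val_def)
  ultimately show ?thesis
    unfolding is_place_def using mult add const by blast
qed

lemma series_val_t: "series_val e Y t = int e"
proof -
  have F: "fraction t [:0, 1:] 0 1" by (auto simp: fraction_def intro!: polys_intros zero one)
  show ?thesis
    using series_val_eq[OF t_nz F] by (simp add: num_def series_X series_0 series_1)
qed

lemma series_val_s: "series_val e Y s = int (subdegree Y)"
proof -
  have F: "fraction s 0 1 1" by (auto simp: fraction_def intro!: polys_intros zero one)
  show ?thesis
    using series_val_eq[OF s_nz F] by (simp add: num_def series_0 series_1)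
qed

end

text \<open>The other square root of \<open>f(\<tau>\<^sup>e)\<close> gives the composition of the place with the automorphism
  \<open>s \<mapsto> - s\<close> of the function field.\<close>

lemma series_val_conj:
  assumes e: "e > 0" and Y2: "Y\<^sup>2 = series e f" and A: "A \<in> rat_funs" and B: "B \<in> rat_funs"
  shows "series_val e (- Y) (A + B * s) = series_val e Y (A - B * s)"
proof (cases "A = 0 \<and> B = 0")
  case True
  then show ?thesis by (simp add: series_val_def)
next
  case False
  obtain P W P' W' where *: "P \<in> polys k" "W \<in> polys k" "W \<noteq> 0" "poly W t \<noteq> 0" "A = poly P t / poly W t"
    "P' \<in> polys k" "W' \<in> polys k" "W' \<noteq> 0" "poly W' t \<noteq> 0" "B = poly P' t / poly W' t"
    using A B by (auto elim!: rat_funsE)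
  have F: "fraction (A + B * s) (P * W') (P' * W) (W * W')"
    unfolding fraction_def using * by (auto intro!: polys_intros simp: field_simps)
  have F': "fraction (A - B * s) (P * W') (- (P' * W)) (W * W')"
    unfolding fraction_def using * by (auto intro!: polys_intros simp: field_simps)
  have nz: "A + B * s \<noteq> 0" "A - B * s \<noteq> 0"
    using False rat_indep[OF A B] rat_indep[OF A rf.uminus[OF B]]
    by (metis, metis add_uminus_conv_diff mult_minus_left neg_equal_0_iff_equal)
  have Y2': "(- Y)\<^sup>2 = series e f" using Y2 by simp
  show ?thesis
    unfolding series_val_eq[OF e Y2' nz(1) F] series_val_eq[OF e Y2 nz(2) F']
    by (simp add: num_def series_uminus)
qed

end

context reduced_double_cover
begin

text \<open>If \<open>f(0) \<noteq> 0\<close> then \<open>f(\<tau>)\<close> has a square root and \<open>t\<close> has order 1.  If \<open>f\<close> has a simple zero at \<open>0\<close> then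
  \<open>f(\<tau>\<^sup>2)\<close> is \<open>\<tau>\<^sup>2\<close> times a unit and \<open>s\<close> has order 1.\<close>

lemma ex_uniformizing_series:
  obtains e Y y where "e > 0" "Y\<^sup>2 = series e f" "y \<in> fun_field" "y \<noteq> 0"
    "series_val e Y y = 1" "series_val e (- Y) y = 1"
proof (cases "coeff f 0 = 0")
  case False
  have e: "(1::nat) > 0" by simp
  obtain Y where Y: "Y\<^sup>2 = series 1 f"
    using fps_sqrt_exists[of "series 1 f"] False by (auto simp: series_nth_0)
  have Y': "(- Y)\<^sup>2 = series 1 f" using Y by simp
  show ?thesis
    using that[OF e Y t_fun_field t_nz] series_val_t[OF e Y] series_val_t[OF e Y'] by simp
next
  case True
  have e: "(2::nat) > 0" by simp
  obtain h where h: "f = pCons 0 h" using True by (cases f) auto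
  have "coeff h 0 \<noteq> 0" using reduced True by (simp add: h)
  then obtain y where y: "y\<^sup>2 = series 2 h" "fps_nth y 0 \<noteq> 0"
    using fps_sqrt_exists[of "series 2 h"] by (auto simp: series_nth_0)
  define Y where "Y = fps_X * y"
  have f_eq: "f = [:0, 1:] * h" by (simp add: h)
  have "series 2 f = fps_X\<^sup>2 * series 2 h" by (simp only: f_eq series_mult series_X)
  then have Y: "Y\<^sup>2 = series 2 f" by (simp add: Y_def power_mult_distrib y)
  then have Y': "(- Y)\<^sup>2 = series 2 f" by simp
  have "y \<noteq> 0" using y(2) by auto
  then have "subdegree Y = 1" using y(2) by (simp add: Y_def)
  then show ?thesis
    using that[OF e Y s_fun_field s_nz] series_val_s[OF e Y] series_val_s[OF e Y'] by simp
qed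

lemma ex_conjugate_places_reduced:
  "\<exists>v\<in>places_over_0. \<exists>v'\<in>places_over_0.
     \<forall>A\<in>rat_funs. \<forall>B\<in>rat_funs. v' (A + B * s) = v (A - B * s)"
proof -
  obtain e Y y where *: "e > 0" "Y\<^sup>2 = series e f" "y \<in> fun_field" "y \<noteq> 0"
    "series_val e Y y = 1" "series_val e (- Y) y = 1"
    by (rule ex_uniformizing_series)
  have Y': "(- Y)\<^sup>2 = series e f" using * by simp
  have "series_val e Y \<in> places_over_0" "series_val e (- Y) \<in> places_over_0"
    using is_place_series_val[OF *(1,2,3,4,5)] is_place_series_val[OF *(1) Y' *(3,4,6)]
      series_val_t[OF *(1,2)] series_val_t[OF *(1) Y'] *(1)
    by (auto simp: places_over_0_def)
  then show ?thesis using series_val_conj[OF *(1,2)] by blast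
qed

end

section \<open>Functions without poles are constant\<close>

context double_cover
begin

lemma ex_conjugate_places:
  "\<exists>v\<in>places_over_0. \<exists>v'\<in>places_over_0.
     \<forall>A\<in>rat_funs. \<forall>B\<in>rat_funs. v' (A + B * s) = v (A - B * s)"
proof -
  obtain m h where h: "double_cover k t (s / t ^ m) h" "coeff h 0 \<noteq> 0 \<or> coeff h 1 \<noteq> 0"
    "double_cover.fun_field k t (s / t ^ m) = fun_field"
    by (rule reduce_at_0)
  interpret R: reduced_double_cover k t "s / t ^ m" h
    using h by (simp add: reduced_double_cover_def reduced_double_cover_axioms_def)
  have eq: "R.places_over_0 = places_over_0"
    by (simp add: R.places_over_0_def places_over_0_def h(3))
  obtain v v' where v: "v \<in> places_over_0" "v' \<in> places_over_0"
    "\<And>A B. A \<in> rat_funs \<Longrightarrow> B \<in> rat_funs \<Longrightarrow> v' (A + B * (s / t ^ m)) = v (A - B * (s / t ^ m))"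
    using R.ex_conjugate_places_reduced unfolding eq by blast
  have "v' (A + B * s) = v (A - B * s)" if "A \<in> rat_funs" "B \<in> rat_funs" for A B
    using v(3)[of A "B * t ^ m"] that t_rat_funs t_nz by (simp add: rf.mult rf.power)
  then show ?thesis using v(1,2) by blast
qed

lemma regular_trace_norm:
  assumes A: "A \<in> rat_funs" and B: "B \<in> rat_funs"
    and reg: "\<And>v. is_place k fun_field v \<Longrightarrow> val_ge v 0 (A + B * s)"
  shows "\<exists>v\<in>places_over_0. val_ge v 0 A \<and> val_ge v 0 (A\<^sup>2 - (B * s)\<^sup>2)"
proof -
  obtain v v' where v: "v \<in> places_over_0" "v' \<in> places_over_0"
    "\<And>A B. A \<in> rat_funs \<Longrightarrow> B \<in> rat_funs \<Longrightarrow> v' (A + B * s) = v (A - B * s)"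
    using ex_conjugate_places by blast
  interpret place k fun_field v using v placeI by (simp add: places_over_0_def)
  have inK: "A \<in> fun_field" "B * s \<in> fun_field"
    using A B rat_funs_fun_field s_fun_field by (auto intro: KK.mult)
  have plus: "val_ge v 0 (A + B * s)" using reg v by (simp add: places_over_0_def)
  have "A - B * s = 0 \<or> A + B * s \<noteq> 0"
    using rat_indep[OF A B] by (metis diff_zero mult_zero_left)
  then have minus: "val_ge v 0 (A - B * s)"
    using reg[of v'] v(2) v(3)[OF A B] by (auto simp: places_over_0_def val_ge_def)
  have half: "1 / 2 \<in> k" using divide[OF one numeral] .
  have "val_ge v 0 ((A + B * s) + (A - B * s))"
    by (rule ge_add) (use inK plus minus in \<open>auto intro: KK.add KK.diff\<close>)
  then have "val_ge v (0 + 0) (1 / 2 * ((A + B * s) + (A - B * s)))"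
    by (intro ge_mult[of "1 / 2"] ge_const[OF half])
      (use inK half k_fun_field in \<open>auto intro!: KK.mult KK.numeral\<close>)
  then have 1: "val_ge v 0 A" by simp
  have "val_ge v (0 + 0) ((A + B * s) * (A - B * s))"
    by (rule ge_mult) (use inK plus minus in \<open>auto intro: KK.add KK.diff\<close>)
  then have "val_ge v 0 (A\<^sup>2 - (B * s)\<^sup>2)" by (simp add: algebra_simps power2_eq_square)
  then show ?thesis using 1 v by blast
qed

text \<open>In a fraction \<open>P / W\<close> with \<open>W\<close> of least degree, a zero of \<open>W\<close> would be a zero of \<open>P\<close> and could be cancelled; so
  \<open>G\<close> is a polynomial in \<open>t\<close>, and it has no pole at infinity.\<close>

lemma rat_fun_const:
  assumes G: "G \<in> rat_funs"
    and fin: "\<And>a. a \<in> k \<Longrightarrow> \<exists>v. is_place k fun_field v \<and> v (t - a) > 0 \<and> val_ge v 0 G"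
    and inf: "\<exists>v. is_place k fun_field v \<and> v (inverse t) > 0 \<and> val_ge v 0 G"
  shows "G \<in> k"
proof -
  define ok where "ok W = (W \<in> polys k \<and> W \<noteq> 0 \<and> (\<exists>P\<in>polys k. G * poly W t = poly P t))" for W
  have "\<exists>W. ok W"
  proof -
    obtain P W where "P \<in> polys k" "W \<in> polys k" "W \<noteq> 0" "poly W t \<noteq> 0" "G = poly P t / poly W t"
      using G by (rule rat_funsE)
    then have "ok W" unfolding ok_def by (intro conjI bexI[of _ P]) simp_all
    then show ?thesis by blast
  qed
  then obtain W where W: "ok W" "\<And>W'. ok W' \<Longrightarrow> degree W \<le> degree W'"
    using ex_has_least_nat[of ok _ degree] by blast
  then obtain P where P: "P \<in> polys k" "G * poly W t = poly P t" by (auto simp: ok_def)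
  have Wk: "W \<in> polys k" "W \<noteq> 0" using W by (auto simp: ok_def)
  have G_in: "G \<in> fun_field" using G rat_funs_fun_field by blast
  have "degree W = 0"
  proof (rule ccontr)
    assume "degree W \<noteq> 0"
    then obtain a where a: "a \<in> k" "poly W a = 0" using ex_root[OF Wk(1)] by auto
    then obtain v where v: "is_place k fun_field v" "v (t - a) > 0" "val_ge v 0 G" using fin by blast
    interpret place k fun_field v using v placeI by simp
    have res: "val_ge v 1 (poly Q t - poly Q a)" if "Q \<in> polys k" for Q
    proof -
      have "val_ge v 1 (poly (pcompose Q [:a, 1:]) (t - a) - coeff (pcompose Q [:a, 1:]) 0)"
        using that a v t_fun_field k_fun_field
        by (intro poly_residue) (auto intro!: polys_intros one KK.diff simp: val_ge_def)
      then show ?thesis by (simp add: poly_pcompose flip: poly_0_coeff_0)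
    qed
    have "val_ge v (0 + 1) (G * poly W t)"
      using res[OF Wk(1)] a v(3) G_in poly_fun_field[OF Wk(1)] by (intro ge_mult) auto
    then have "val_ge v 1 (poly P t - (poly P t - poly P a))"
      unfolding P(2)
      by (intro ge_diff[of "poly P t" "poly P t - poly P a"])
        (use res[OF P(1)] poly_fun_field[OF P(1)] poly_in[OF P(1) a(1)] k_fun_field in \<open>auto intro!: KK.diff\<close>)
    then have Pa: "poly P a = 0"
      using v_const[OF poly_in[OF P(1) a(1)]] by (simp add: val_ge_def)
    define W' P' where "W' = synthetic_div W a" and "P' = synthetic_div P a"
    have eqs: "W = [:- a, 1:] * W'" "P = [:- a, 1:] * P'"
      using synthetic_div_correct'[of a W] synthetic_div_correct'[of a P] a(2) Pa
      by (simp_all add: W'_def P'_def)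
    have "t - a \<noteq> 0" using a t_notin by auto
    moreover have "(t - a) * (G * poly W' t) = (t - a) * poly P' t"
      using P(2) by (subst (asm) eqs(1), subst (asm) eqs(2)) (simp add: algebra_simps)
    ultimately have "G * poly W' t = poly P' t" by (metis mult_left_cancel)
    moreover have "W' \<noteq> 0" using eqs(1) Wk(2) by (metis mult_zero_right)
    ultimately have "ok W'"
      unfolding ok_def W'_def P'_def using polys_synthetic_div a Wk P by blast
    then show False
      using W(2) \<open>degree W \<noteq> 0\<close> by (fastforce simp: W'_def degree_synthetic_div)
  qed
  then obtain w where w: "W = [:w:]" by (metis degree_eq_zeroE)
  have wk: "w \<in> k" "w \<noteq> 0" using polysD[OF Wk(1), of 0] Wk(2) by (auto simp: w)
  obtain v where v: "is_place k fun_field v" "v (inverse t) > 0" "val_ge v 0 G" using inf by blast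
  interpret place k fun_field v using v placeI by simp
  have vt: "v t < 0" using v(2) v_inverse[OF t_fun_field] by simp
  have "degree P = 0"
  proof (rule ccontr)
    assume d: "degree P \<noteq> 0"
    then have "P \<noteq> 0" by auto
    note pole = poly_pole[OF P(1) t_fun_field vt this]
    have "val_ge v (0 + 0) (G * w)"
      using v(3) ge_const[OF wk(1)] G_in wk k_fun_field by (intro ge_mult) auto
    then have "val_ge v 0 (poly P t)" using P(2) by (simp add: w)
    then have "0 \<le> int (degree P) * v t" using pole by (simp add: val_ge_def)
    then show False using d vt by (simp add: zero_le_mult_iff)
  qed
  then obtain p where p: "P = [:p:]" by (metis degree_eq_zeroE)
  have "p \<in> k" using polysD[OF P(1), of 0] by (simp add: p)
  moreover have "G = p / w" using P(2) wk by (simp add: p w field_simps)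
  ultimately show ?thesis using wk divide by simp
qed

text \<open>The half trace \<open>A\<close> and the norm of \<open>x = A + B s\<close> are rational functions of \<open>t\<close> without poles, hence constants, and
  \<open>x\<close> is a root of a quadratic polynomial over \<open>k\<close>.\<close>

lemma regular_const:
  assumes x: "x \<in> fun_field" and reg: "\<And>v. is_place k fun_field v \<Longrightarrow> val_ge v 0 x"
  shows "x \<in> k"
proof -
  obtain A B where AB: "A \<in> rat_funs" "B \<in> rat_funs" "x = A + B * s"
    using x by (auto simp: fun_field_def)
  define N where "N = A\<^sup>2 - (B * s)\<^sup>2"
  have N_rat: "N \<in> rat_funs"
    unfolding N_def power_mult_distrib s2 using AB f_rat by (auto intro!: rf.diff rf.mult rf.power)
  have fin: "\<exists>v. is_place k fun_field v \<and> v (t - a) > 0 \<and> val_ge v 0 A \<and> val_ge v 0 N"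
    if a: "a \<in> k" for a
  proof -
    note T = translate[OF a]
    interpret D: double_cover k "t - a" s "pcompose f [:a, 1:]" by (rule T(1))
    show ?thesis
      using D.regular_trace_norm[of A B] AB reg unfolding T(2,3) D.places_over_0_def N_def by auto
  qed
  have inf: "\<exists>v. is_place k fun_field v \<and> v (inverse t) > 0 \<and> val_ge v 0 A \<and> val_ge v 0 N"
  proof -
    interpret D: double_cover k "inverse t" "s / t\<^sup>2" f_inv by (rule invert(1))
    have "B * t\<^sup>2 \<in> rat_funs" using AB t_rat_funs by (intro rf.mult rf.power)
    moreover have "B * t\<^sup>2 * (s / t\<^sup>2) = B * s" using t_nz by simp
    ultimately show ?thesis
      using D.regular_trace_norm[of A "B * t\<^sup>2"] AB reg
      unfolding invert(2,3) D.places_over_0_def N_def by auto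
  qed
  have Ak: "A \<in> k" using rat_fun_const[OF AB(1)] fin inf by blast
  have Nk: "N \<in> k" using rat_fun_const[OF N_rat] fin inf by blast
  have "(B * s)\<^sup>2 \<in> k"
    using diff[OF power[OF Ak, of 2] Nk] by (simp add: N_def)
  then obtain r where "r \<in> k" "r\<^sup>2 = (B * s)\<^sup>2" using ex_sqrt by blast
  then have "B * s \<in> k" using uminus[of r] by (auto simp: power2_eq_iff)
  then show ?thesis using Ak add AB(3) by simp
qed

end

section \<open>Riemann's inequality\<close>

context double_cover
begin

lemma subfield_k: "subfield k complex_ring" by (rule subfield)

text \<open>Otherwise all nonzero polynomials in \<open>t\<close> have the value 0, being products of linear factors, and then so does every
  function, because \<open>s\<^sup>2 = f(t)\<close>.\<close>

lemma place_center:
  assumes v: "is_place k fun_field v"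
  shows "v t < 0 \<or> (\<exists>a\<in>k. v (t - a) > 0)"
proof (rule ccontr)
  assume neg: "\<not> (v t < 0 \<or> (\<exists>a\<in>k. v (t - a) > 0))"
  interpret place k fun_field v using v by (rule placeI)
  have gt: "val_ge v 0 t" using neg by (simp add: val_ge_def)
  have ta: "v (t - a) = 0" if "a \<in> k" for a
  proof -
    have "val_ge v 0 (t - a)"
      using that gt ge_const[OF that] t_fun_field k_fun_field by (intro ge_diff) auto
    then show ?thesis using neg that v_0 by (force simp: val_ge_def)
  qed
  have poly0: "v (poly P t) = 0" if "P \<in> polys k" "P \<noteq> 0" for P
    using that
  proof (induction P rule: polys_factor_induct)
    case (const b)
    then show ?case using v_const[of b] by simp
  next
    case (factor a Q)
    have "poly ([:- a, 1:] * Q) t = (t - a) * poly Q t" by (simp add: algebra_simps)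
    moreover have "t - a \<noteq> 0" using t_notin factor(1) by auto
    moreover have "poly Q t \<noteq> 0" using poly_t_eq_0[OF factor(2)] factor(3) by simp
    moreover have "t - a \<in> fun_field" using t_fun_field factor(1) k_fun_field by (auto intro: KK.diff)
    ultimately show ?case
      using v_mult[of "t - a" "poly Q t"] poly_fun_field[OF factor(2)] ta[OF factor(1)] factor(4) by simp
  qed
  have "f \<noteq> 0" using s2 s_nz by auto
  then have vs: "v s = 0" using v_of_square[OF s_fun_field] poly0[OF f] s2 by simp
  have ge0: "val_ge v 0 x" if x: "x \<in> fun_field" for x
  proof -
    obtain P R W where *: "P \<in> polys k" "R \<in> polys k" "W \<in> polys k" "W \<noteq> 0" "poly W t \<noteq> 0"
      "x * poly W t = poly P t + poly R t * s"
      using fun_field_poly[OF x] by blast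
    have "val_ge v (0 + 0) (poly R t * s)"
      using poly_ge[OF *(2) t_fun_field gt] vs * poly_fun_field s_fun_field
      by (intro ge_mult) (auto simp: val_ge_def)
    then have "val_ge v 0 (x * poly W t)"
      unfolding *(6) using poly_ge[OF *(1) t_fun_field gt] * poly_fun_field s_fun_field
      by (intro ge_add) (auto intro: KK.mult)
    then show ?thesis
      using v_mult[OF x poly_fun_field[OF *(3)] _ *(5)] poly0[OF *(3,4)] *(5)
      by (cases "x = 0") (auto simp: val_ge_def)
  qed
  obtain x where x: "x \<in> fun_field - {0}" "v x = - 1" using v_surj by blast
  then show False using ge0[of x] by (auto simp: val_ge_def)
qed

lemma place_residue:
  assumes v: "is_place k fun_field v" and x: "x \<in> fun_field" "val_ge v 0 x"
  shows "\<exists>a\<in>k. val_ge v 1 (x - a)"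
  using place_center[OF v]
proof (elim disjE bexE)
  assume neg: "v t < 0"
  interpret place k fun_field v using v by (rule placeI)
  interpret D: double_cover k "inverse t" "s / t\<^sup>2" f_inv by (rule invert(1))
  have "v \<in> D.places_over_0"
    using v neg v_inverse[OF t_fun_field] by (simp add: D.places_over_0_def invert(3))
  then show ?thesis using D.residue_over_0 x by (simp add: invert(3))
next
  fix a assume a: "a \<in> k" "0 < v (t - a)"
  interpret D: double_cover k "t - a" s "pcompose f [:a, 1:]" by (rule translate(1)[OF a(1)])
  have "v \<in> D.places_over_0"
    using v a by (simp add: D.places_over_0_def translate(3)[OF a(1)])
  then show ?thesis using D.residue_over_0 x by (simp add: translate(3)[OF a(1)])
qed

definition L :: "((complex \<Rightarrow> int) \<Rightarrow> int) \<Rightarrow> complex set" where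
  "L D = riemann_roch_space k fun_field D"

lemma L_iff: "x \<in> L D \<longleftrightarrow> x \<in> fun_field \<and> (\<forall>v. is_place k fun_field v \<longrightarrow> val_ge v (- D v) x)"
  unfolding L_def riemann_roch_space_def val_ge_def by auto

lemma L_add: "x \<in> L D \<Longrightarrow> y \<in> L D \<Longrightarrow> x + y \<in> L D"
  unfolding L_iff using place.ge_add[OF placeI] by (auto intro: KK.add)

lemma L_scale:
  assumes "c \<in> k" "x \<in> L D" shows "c * x \<in> L D"
proof -
  have "c \<in> fun_field" using assms k_fun_field by auto
  moreover have "val_ge v (0 + - D v) (c * x)" if "is_place k fun_field v" for v
    using assms that place.ge_const[OF placeI[OF that] assms(1)] \<open>c \<in> fun_field\<close>
    by (intro place.ge_mult[OF placeI[OF that]]) (auto simp: L_iff)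
  ultimately show ?thesis using assms by (auto simp: L_iff intro: KK.mult)
qed

lemma L_0: "0 \<in> L D"
  by (simp add: L_iff val_ge_def KK.zero)

lemma L_subalgebra: "subalgebra k (L D) complex_ring"
proof (intro subalgebra.intro subalgebra_axioms.intro)
  show "subgroup (L D) (add_monoid complex_ring)"
  proof (rule cring.add.subgroupI)
    show "L D \<noteq> {}" using L_0 by blast
    fix a assume "a \<in> L D"
    then show "\<ominus>\<^bsub>complex_ring\<^esub> a \<in> L D"
      using L_scale[of "- 1" a D] uminus[OF one] by simp
  qed (auto intro: L_add)
qed (auto intro: L_scale)

lemma L_mono: "(\<And>v. is_place k fun_field v \<Longrightarrow> D v \<le> D' v) \<Longrightarrow> L D \<subseteq> L D'"
  unfolding L_iff val_ge_def subset_iff by (meson neg_le_iff_le order.trans)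

lemma dimension_L_0: "cring.dimension 1 k (L (\<lambda>v. 0))"
proof -
  have "L (\<lambda>v. 0) = k"
  proof
    show "L (\<lambda>v. 0) \<subseteq> k" using regular_const by (auto simp: L_iff)
    show "k \<subseteq> L (\<lambda>v. 0)" using k_fun_field place.ge_const[OF placeI] by (auto simp: L_iff)
  qed
  then show ?thesis using cring.dimension_one[OF subfield_k] by simp
qed

text \<open>Allowing one more pole costs one condition, because the residue field is \<open>k\<close>.\<close>

lemma dimension_L_step:
  assumes v: "is_place k fun_field v" and dim: "cring.dimension n k (L D)"
  shows "\<exists>m\<le>n + 1. cring.dimension m k (L (D(v := D v + 1)))"
proof -
  let ?D = "D(v := D v + 1)"
  interpret place k fun_field v using v by (rule placeI)
  have sub: "L D \<subseteq> L ?D" by (rule L_mono) simp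
  show ?thesis
  proof (cases "L D = L ?D")
    case True
    then show ?thesis using dim by (intro exI[of _ n]) simp
  next
    case False
    then obtain w where w: "w \<in> L ?D" "w \<notin> L D" using sub by blast
    have w0: "w \<noteq> 0" using w L_0 by auto
    have wK: "w \<in> fun_field" using w by (simp add: L_iff)
    have in_D: "y \<in> L D" if y: "y \<in> L ?D" "val_ge v (- D v) y" for y
      unfolding L_iff
    proof (intro conjI allI impI)
      fix u assume "is_place k fun_field u"
      then show "val_ge u (- D u) y" using y by (cases "u = v") (auto simp: L_iff)
    qed (use y in \<open>simp add: L_iff\<close>)
    have vw: "v w = - D v - 1"
    proof -
      have "- D v - 1 \<le> v w" using w(1) v w0 by (auto simp: L_iff val_ge_def)
      moreover have "\<not> - D v \<le> v w" using in_D[OF w(1)] w(2) by (auto simp: val_ge_def)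
      ultimately show ?thesis by linarith
    qed
    have "L ?D = cring.line_extension k w (L D)"
    proof
      show "cring.line_extension k w (L D) \<subseteq> L ?D"
        using w sub by (auto simp: cring.line_extension_mem_iff intro!: L_add L_scale)
      show "L ?D \<subseteq> cring.line_extension k w (L D)"
      proof
        fix y assume y: "y \<in> L ?D"
        have yK: "y \<in> fun_field" using y by (simp add: L_iff)
        have yw: "y / w \<in> fun_field" using yK wK by (rule KK.divide)
        have "val_ge v (- D v - 1) y" using y v by (auto simp: L_iff)
        then have "val_ge v 0 (y / w)"
          using v_divide[OF yK wK _ w0] vw by (cases "y = 0") (auto simp: val_ge_def)
        then obtain a where a: "a \<in> k" "val_ge v 1 (y / w - a)" using place_residue[OF v yw] by blast
        have "val_ge v (1 + v w) ((y / w - a) * w)"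
          using a yw wK k_fun_field by (intro ge_mult) (auto intro: KK.diff simp: val_ge_def)
        then have g: "val_ge v (- D v) (y - a * w)" using w0 by (simp add: vw algebra_simps)
        have "y - a * w \<in> L ?D"
          using L_add[OF y L_scale[OF uminus[OF a(1)] w(1)]] by simp
        then have "y - a * w \<in> L D" using g by (rule in_D)
        moreover have "y = a \<otimes>\<^bsub>complex_ring\<^esub> w \<oplus>\<^bsub>complex_ring\<^esub> (y - a * w)" by simp
        ultimately show "y \<in> cring.line_extension k w (L D)"
          unfolding cring.line_extension_mem_iff using a(1) by blast
      qed
    qed
    then show ?thesis
      using cring.Suc_dim[of w "L D" n k] w(2) dim by (intro exI[of _ "Suc n"]) simp
  qed
qed

lemma dimension_L_increase:
  assumes "finite S" "\<And>v. v \<in> S \<Longrightarrow> is_place k fun_field v" "\<And>v. v \<in> S \<Longrightarrow> D v \<le> D' v"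
    "\<And>v. v \<notin> S \<Longrightarrow> D' v = D v" and "cring.dimension n k (L D)"
  shows "\<exists>m. cring.dimension m k (L D') \<and> int m \<le> int n + (\<Sum>v\<in>S. D' v - D v)"
  using assms(3-5)
proof (induction "nat (\<Sum>v\<in>S. D' v - D v)" arbitrary: D n)
  case 0
  have "(\<Sum>v\<in>S. D' v - D v) \<ge> 0" using 0(2) by (intro sum_nonneg) auto
  then have "(\<Sum>v\<in>S. D' v - D v) = 0" using 0(1) by simp
  then have "\<forall>v\<in>S. D' v - D v = 0"
    using sum_nonneg_eq_0_iff[of S "\<lambda>v. D' v - D v"] assms(1) 0(2) by auto
  then have "D' v = D v" for v using 0(3)[of v] by (cases "v \<in> S") auto
  then have "D' = D" by blast
  then show ?case using 0 by auto
next
  case (Suc N)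
  have "\<exists>v\<in>S. D v < D' v"
  proof (rule ccontr)
    assume "\<not> (\<exists>v\<in>S. D v < D' v)"
    then have "(\<Sum>v\<in>S. D' v - D v) \<le> 0" by (intro sum_nonpos) (auto simp: not_less)
    then show False using Suc(2) by simp
  qed
  then obtain w where w: "w \<in> S" "D w < D' w" by blast
  define E where "E = D(w := D w + 1)"
  obtain m where m: "m \<le> n + 1" "cring.dimension m k (L E)"
    using dimension_L_step[OF assms(2)[OF w(1)] Suc.prems(3)] by (auto simp: E_def)
  have "(\<Sum>v\<in>S. D' v - E v) = (\<Sum>v\<in>S. (D' v - D v) - (if v = w then 1 else 0))"
    by (intro sum.cong) (auto simp: E_def)
  also have "\<dots> = (\<Sum>v\<in>S. D' v - D v) - 1"
    using assms(1) w by (simp add: sum_subtractf)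
  finally have sum: "(\<Sum>v\<in>S. D' v - E v) = (\<Sum>v\<in>S. D' v - D v) - 1" .
  have "N = nat (\<Sum>v\<in>S. D' v - E v)" using Suc(2) sum by simp
  then obtain m' where "cring.dimension m' k (L D')" "int m' \<le> int m + (\<Sum>v\<in>S. D' v - E v)"
    using Suc.hyps(1)[of E m] Suc.prems m w by (fastforce simp: E_def)
  then show ?case using m sum by (intro exI[of _ m']) simp
qed

lemma dimension_mono:
  assumes "cring.dimension n k E" "cring.dimension m k E'" "E \<subseteq> E'"
  shows "n \<le> m"
proof -
  obtain Us where "set Us \<subseteq> carrier complex_ring" "cring.independent k Us" "length Us = n"
    "cring.Span k Us = E"
    using cring.exists_base[OF subfield_k assms(1)] by blast
  moreover from this have "set Us \<subseteq> E" using cring.Span_base_incl[OF subfield_k, of Us] by simp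
  ultimately show ?thesis
    using cring.independent_length_le_dimension[OF subfield_k assms(2), of Us] assms(3) by blast
qed

lemma finite_dimension_L:
  assumes "is_divisor k fun_field D"
  shows "\<exists>n. cring.dimension n k (L D)"
proof -
  let ?S = "{v. D v \<noteq> 0}" and ?E = "\<lambda>v. max 0 (D v)"
  have fin: "finite ?S" "\<And>v. v \<in> ?S \<Longrightarrow> is_place k fun_field v"
    using assms by (auto simp: is_divisor_def)
  obtain m where m: "cring.dimension m k (L ?E)"
    using dimension_L_increase[OF fin, of "\<lambda>v. 0" ?E 1] dimension_L_0 by auto
  have "L D \<subseteq> L ?E" by (rule L_mono) simp
  then show ?thesis
    using cring.subalbegra_incl_imp_finite_dimension[OF subfield_k cring.finite_dimensionI[OF m] L_subalgebra]
    unfolding cring.finite_dimension_def by blast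
qed

definition bounded_polys :: "nat \<Rightarrow> complex poly set" where
  "bounded_polys n = {P \<in> polys k. \<forall>i\<ge>n. coeff P i = 0}"

lemma bounded_polys_Suc:
  "P \<in> bounded_polys (Suc n) \<longleftrightarrow> (\<exists>c\<in>k. \<exists>P'\<in>bounded_polys n. P = monom c n + P')"
proof
  assume P: "P \<in> bounded_polys (Suc n)"
  have "coeff P n \<in> k" using P polysD by (auto simp: bounded_polys_def)
  moreover have "P - monom (coeff P n) n \<in> bounded_polys n"
    unfolding bounded_polys_def
  proof (intro CollectI conjI allI impI)
    show "P - monom (coeff P n) n \<in> polys k"
      using P \<open>coeff P n \<in> k\<close> by (intro polys_intros) (auto simp: bounded_polys_def)
    show "coeff (P - monom (coeff P n) n) i = 0" if "n \<le> i" for i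
      using P that by (cases "i = n") (auto simp: bounded_polys_def)
  qed
  moreover have "P = monom (coeff P n) n + (P - monom (coeff P n) n)" by simp
  ultimately show "\<exists>c\<in>k. \<exists>P'\<in>bounded_polys n. P = monom c n + P'" by blast
qed (auto simp: bounded_polys_def intro: polys_intros)

definition bounded_space :: "complex \<Rightarrow> nat \<Rightarrow> nat \<Rightarrow> complex set" where
  "bounded_space z n m = {(poly P t + poly R t * s) / z | P R. P \<in> bounded_polys n \<and> R \<in> bounded_polys m}"

lemma dimension_bounded_space:
  assumes z: "z \<noteq> 0"
  shows "cring.dimension (n + m) k (bounded_space z n m)"
proof (induction m)
  case 0
  show ?case
  proof (induction n)
    case 0
    have "bounded_polys 0 = {0}" by (auto simp: bounded_polys_def poly_eq_iff polys_0)
    then have "bounded_space z 0 0 = {0}" by (auto simp: bounded_space_def)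
    then show ?case using cring.zero_dim[of k] by simp
  next
    case (Suc n)
    have "bounded_space z (Suc n) 0 = cring.line_extension k (t ^ n / z) (bounded_space z n 0)"
    proof (rule Set.set_eqI)
      fix x
      have "x \<in> bounded_space z (Suc n) 0 \<longleftrightarrow> (\<exists>c\<in>k. \<exists>P\<in>bounded_polys n. \<exists>R\<in>bounded_polys 0.
          x = (poly (monom c n + P) t + poly R t * s) / z)"
        unfolding bounded_space_def bounded_polys_Suc by blast
      also have "\<dots> \<longleftrightarrow> (\<exists>c\<in>k. \<exists>P\<in>bounded_polys n. \<exists>R\<in>bounded_polys 0.
          x = c * (t ^ n / z) + (poly P t + poly R t * s) / z)"
        by (simp add: poly_monom add_divide_distrib add.assoc)
      also have "\<dots> \<longleftrightarrow> x \<in> cring.line_extension k (t ^ n / z) (bounded_space z n 0)"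
        unfolding cring.line_extension_mem_iff bounded_space_def complex_ring_simps by blast
      finally show "x \<in> bounded_space z (Suc n) 0 \<longleftrightarrow> x \<in> cring.line_extension k (t ^ n / z) (bounded_space z n 0)" .
    qed
    moreover have "t ^ n / z \<notin> bounded_space z n 0"
    proof
      assume "t ^ n / z \<in> bounded_space z n 0"
      then obtain P R where *: "t ^ n / z = (poly P t + poly R t * s) / z" "P \<in> bounded_polys n" "R \<in> polys k"
          by (auto simp: bounded_space_def bounded_polys_def)
      have "poly (P - monom 1 n) t + poly R t * s = 0"
        using *(1) z by (simp add: poly_monom)
      then have "P = monom 1 n"
        using indep[of "P - monom 1 n" R] * by (auto simp: bounded_polys_def intro: polys_intros one)
      then show False using *(2) by (auto simp: bounded_polys_def)
    qed
    ultimately show ?case using cring.Suc_dim[of "t ^ n / z" _ "n + 0" k] Suc by simp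
  qed
next
  case (Suc m)
  have "bounded_space z n (Suc m) = cring.line_extension k (t ^ m * s / z) (bounded_space z n m)"
  proof (rule Set.set_eqI)
    fix x
    have "x \<in> bounded_space z n (Suc m) \<longleftrightarrow> (\<exists>c\<in>k. \<exists>P\<in>bounded_polys n. \<exists>R\<in>bounded_polys m.
        x = (poly P t + poly (monom c m + R) t * s) / z)"
      unfolding bounded_space_def bounded_polys_Suc by blast
    also have "\<dots> \<longleftrightarrow> (\<exists>c\<in>k. \<exists>P\<in>bounded_polys n. \<exists>R\<in>bounded_polys m.
        x = c * (t ^ m * s / z) + (poly P t + poly R t * s) / z)"
      by (simp add: poly_monom add_divide_distrib distrib_right add.left_commute mult.assoc)
    also have "\<dots> \<longleftrightarrow> x \<in> cring.line_extension k (t ^ m * s / z) (bounded_space z n m)"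
      unfolding cring.line_extension_mem_iff bounded_space_def complex_ring_simps by blast
    finally show "x \<in> bounded_space z n (Suc m) \<longleftrightarrow> x \<in> cring.line_extension k (t ^ m * s / z) (bounded_space z n m)" .
  qed
  moreover have "t ^ m * s / z \<notin> bounded_space z n m"
  proof
    assume "t ^ m * s / z \<in> bounded_space z n m"
    then obtain P R where *: "t ^ m * s / z = (poly P t + poly R t * s) / z" "P \<in> polys k" "R \<in> bounded_polys m"
      by (auto simp: bounded_space_def bounded_polys_def)
    have "poly P t + poly (R - monom 1 m) t * s = 0"
      using *(1) z by (simp add: poly_monom left_diff_distrib)
    then have "R = monom 1 m"
      using indep[of P "R - monom 1 m"] * by (auto simp: bounded_polys_def intro: polys_intros one)
    then show False using *(3) by (auto simp: bounded_polys_def)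
  qed
  ultimately show ?case using cring.Suc_dim[of "t ^ m * s / z" _ "n + m" k] Suc by simp
qed

definition zero_order :: "complex \<Rightarrow> (complex \<Rightarrow> int) \<Rightarrow> int" where
  "zero_order x v = (if is_place k fun_field v \<and> v x > 0 then v x else 0)"

lemma sum_zero_order:
  assumes fin: "finite {v. is_place k fun_field v \<and> 0 < v x}"
    and sum: "(\<Sum>v | is_place k fun_field v \<and> 0 < v x. v x) \<le> 2"
    and T: "finite T" "{v. is_place k fun_field v \<and> 0 < v x} \<subseteq> T"
  shows "(\<Sum>v\<in>T. zero_order x v) \<le> 2"
proof -
  have "(\<Sum>v\<in>T. zero_order x v) = (\<Sum>v | is_place k fun_field v \<and> 0 < v x. zero_order x v)"
    by (rule sum.mono_neutral_right) (use T in \<open>auto simp: zero_order_def\<close>)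
  also have "\<dots> = (\<Sum>v | is_place k fun_field v \<and> 0 < v x. v x)"
    by (rule sum.cong) (auto simp: zero_order_def)
  finally show ?thesis using sum by simp
qed

lemma places_translate:
  assumes "a \<in> k"
  shows "finite {v. is_place k fun_field v \<and> 0 < v (t - a)}"
    "(\<Sum>v | is_place k fun_field v \<and> 0 < v (t - a). v (t - a)) \<le> 2"
proof -
  interpret D: double_cover k "t - a" s "pcompose f [:a, 1:]" by (rule translate(1)[OF assms])
  show "finite {v. is_place k fun_field v \<and> 0 < v (t - a)}"
    "(\<Sum>v | is_place k fun_field v \<and> 0 < v (t - a). v (t - a)) \<le> 2"
    using D.sum_places_over_0 by (simp_all add: D.places_over_0_def translate(3)[OF assms])
qed

lemma places_invert:
  shows "finite {v. is_place k fun_field v \<and> 0 < v (inverse t)}"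
    "(\<Sum>v | is_place k fun_field v \<and> 0 < v (inverse t). v (inverse t)) \<le> 2"
proof -
  interpret D: double_cover k "inverse t" "s / t\<^sup>2" f_inv by (rule invert(1))
  show "finite {v. is_place k fun_field v \<and> 0 < v (inverse t)}"
    "(\<Sum>v | is_place k fun_field v \<and> 0 < v (inverse t). v (inverse t)) \<le> 2"
    using D.sum_places_over_0 by (simp_all add: D.places_over_0_def invert(3))
qed

text \<open>At a finite place \<open>z\<close> vanishes to the order that the divisor allows for poles, and at infinity it has \<open>M |A|\<close>
  times the pole of \<open>t\<close>, so that \<open>N = M + M |A|\<close> times the pole of \<open>t\<close> remains for the numerator.  Since \<open>s\<close> has at most twice the pole of \<open>t\<close> there, the degree of \<open>R\<close> must be smaller by 2 than that of
  \<open>P\<close>.\<close>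

lemma bounded_space_subset_L:
  fixes M :: nat
  assumes A: "finite A" "A \<subseteq> k" and N: "N = M * (1 + card A)"
    and z: "z = (\<Prod>a\<in>A. (t - a) ^ M)"
  shows "bounded_space z (N + 1) (N - 1) \<subseteq> L (\<lambda>v. int M * (zero_order (inverse t) v + (\<Sum>a\<in>A. zero_order (t - a) v)))"
    (is "_ \<subseteq> L ?D")
proof
  fix x assume "x \<in> bounded_space z (N + 1) (N - 1)"
  then obtain P R where x: "x = (poly P t + poly R t * s) / z" and PR: "P \<in> polys k" "R \<in> polys k"
      "\<forall>i\<ge>N + 1. coeff P i = 0" "\<forall>i\<ge>N - 1. coeff R i = 0"
    by (auto simp: bounded_space_def bounded_polys_def)
  define y where "y = poly P t + poly R t * s"
  have yK: "y \<in> fun_field" "poly P t \<in> fun_field" "poly R t \<in> fun_field" "poly R t * s \<in> fun_field"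
    unfolding y_def using PR by (auto intro: KK.add KK.mult poly_fun_field s_fun_field)
  have taK: "t - a \<in> fun_field" "t - a \<noteq> 0" if "a \<in> A" for a
    using that A t_notin t_fun_field k_fun_field by (auto intro: KK.diff)
  have z0: "z \<noteq> 0" and zK: "z \<in> fun_field"
  proof -
    show "z \<noteq> 0" unfolding z using A taK by simp
    have "(\<Prod>a\<in>B. (t - a) ^ M) \<in> fun_field" if "B \<subseteq> A" for B
      using finite_subset[OF that A(1)] that
      by (induction B rule: finite_induct) (auto intro!: KK.one KK.mult KK.power taK(1))
    then show "z \<in> fun_field" unfolding z by blast
  qed
  have vx: "val_ge v (- ?D v) x" if v: "is_place k fun_field v" for v
  proof -
    interpret place k fun_field v using v by (rule placeI)
    have vz: "v z = int M * (\<Sum>a\<in>A. v (t - a))"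
    proof -
      have "v (\<Prod>a\<in>B. (t - a) ^ M) = int M * (\<Sum>a\<in>B. v (t - a)) \<and> (\<Prod>a\<in>B. (t - a) ^ M) \<in> fun_field
        \<and> (\<Prod>a\<in>B. (t - a) ^ M) \<noteq> 0" if "B \<subseteq> A" for B
        using finite_subset[OF that A(1)] that
      proof (induction B rule: finite_induct)
        case empty
        then show ?case using v_const[OF one] KK.one by simp
      next
        case (insert a B)
        then show ?case
          using v_mult[of "(t - a) ^ M" "\<Prod>a\<in>B. (t - a) ^ M"] taK[of a] v_power[of "t - a" M]
          by (auto simp: KK.power KK.mult algebra_simps)
      qed
      then show ?thesis unfolding z by blast
    qed
    have "val_ge v (- ?D v + v z) y"
    proof (cases "v t < 0")
      case False
      then have gt: "val_ge v 0 t" by (simp add: val_ge_def)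
      have "zero_order (inverse t) v = 0"
        using False v_inverse[OF t_fun_field] by (simp add: zero_order_def)
      moreover have "zero_order (t - a) v = v (t - a)" if "a \<in> A" for a
      proof -
        have "val_ge v 0 (t - a)"
          using that A gt ge_const[of a] t_fun_field k_fun_field by (intro ge_diff) auto
        then show ?thesis using v taK[OF that] by (auto simp: zero_order_def val_ge_def)
      qed
      ultimately have "?D v = v z" unfolding vz by simp
      moreover have "val_ge v 0 y"
        unfolding y_def using poly_ge[OF PR(1) t_fun_field gt] poly_ge[OF PR(2) t_fun_field gt]
          ge_mult[of "poly R t" s 0 0] v_s_ge[OF v] False yK s_fun_field
        by (intro ge_add) auto
      ultimately show ?thesis by simp
    next
      case True
      have "zero_order (inverse t) v = - v t"
        using True v v_inverse[OF t_fun_field] by (simp add: zero_order_def)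
      moreover have vta: "v (t - a) = v t" if "a \<in> A" for a
        using poly_pole(2)[of "[:- a, 1:]", OF _ t_fun_field True] that A
        by (auto intro!: polys_intros uminus one simp: polys_pCons uminus one polys_0 subset_iff)
      then have "zero_order (t - a) v = 0" if "a \<in> A" for a
        using True that by (simp add: zero_order_def)
      ultimately have "- ?D v = int M * v t" by simp
      moreover have "v z = int M * int (card A) * v t" unfolding vz using vta by simp
      ultimately have eq: "- ?D v + v z = int N * v t" by (simp add: N algebra_simps)
      have pole: "val_ge v (int n * v t) (poly Q t)" if "Q \<in> polys k" "degree Q \<le> n" for Q n
        using poly_pole[OF that(1) t_fun_field True] that(2) True
        by (cases "Q = 0") (auto simp: val_ge_def mult_right_mono_neg)
      have degP: "degree P \<le> N" using PR(3) by (intro degree_le) auto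
      have P: "val_ge v (int N * v t) (poly P t)" by (rule pole[OF PR(1) degP])
      have R: "val_ge v (int N * v t) (poly R t * s)"
      proof (cases "R = 0")
        case True
        then show ?thesis by (simp add: val_ge_def)
      next
        case False
        then have "coeff R (degree R) \<noteq> 0" by simp
        then have "degree R < N - 1" using PR(4) by (meson not_le)
        then have deg: "degree R \<le> N - 2" "N \<ge> 2" by auto
        have "f \<noteq> 0" using s2 s_nz by auto
        have "2 * v s = int (degree f) * v t"
          using v_of_square[OF s_fun_field] poly_pole[OF f t_fun_field True \<open>f \<noteq> 0\<close>] s2 by simp
        also have "\<dots> \<ge> 4 * v t" using deg_f True by (intro mult_right_mono_neg) auto
        finally have "val_ge v (2 * v t) s" by (simp add: val_ge_def)
        then have "val_ge v (int (N - 2) * v t + 2 * v t) (poly R t * s)"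
          using pole[OF PR(2) deg(1)] yK s_fun_field by (intro ge_mult) auto
        then show ?thesis using deg(2) by (simp add: of_nat_diff algebra_simps)
      qed
      show ?thesis unfolding eq y_def using P R yK by (intro ge_add) auto
    qed
    then show "val_ge v (- ?D v) x"
      using v_divide[OF yK(1) zK _ z0] unfolding x y_def[symmetric] val_ge_def by auto
  qed
  have "x \<in> fun_field" unfolding x y_def[symmetric] using yK(1) zK by (rule KK.divide)
  then show "x \<in> L ?D" using vx by (simp add: L_iff)
qed

text \<open>The divisor \<open>D\<close> is enlarged to \<open>D' \<ge> D\<close> with \<open>deg D' \<le> 2 N\<close> and \<open>dim L(D') \<ge> 2 N\<close>; since
  \<open>dim L(D') - dim L(D) \<le> deg D' - deg D\<close>, the inequality goes back to \<open>D\<close>.\<close>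

lemma divisor_degree_le_dimension:
  assumes D: "is_divisor k fun_field D" and dim: "cring.dimension n k (L D)"
  shows "divisor_degree D \<le> int n"
proof -
  define S where "S = {v. D v \<noteq> 0}"
  have S: "finite S" "\<And>v. v \<in> S \<Longrightarrow> is_place k fun_field v"
    using D by (auto simp: is_divisor_def S_def)
  define center where "center v = (SOME a. a \<in> k \<and> v (t - a) > 0)" for v :: "complex \<Rightarrow> int"
  have center: "center v \<in> k \<and> v (t - center v) > 0" if "v \<in> S" "\<not> v t < 0" for v
  proof -
    have "\<exists>a. a \<in> k \<and> v (t - a) > 0" using place_center[OF S(2)[OF that(1)]] that(2) by blast
    then show ?thesis unfolding center_def by (rule someI_ex)
  qed
  \<comment> \<open>The support of \<open>D'\<close> consists of all places above infinity and above the centers of the finite places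
    in the support of \<open>D\<close>; the multiplicity \<open>M\<close> exceeds all values of \<open>D\<close>.\<close>
  define A where "A = center ` {v \<in> S. \<not> v t < 0}"
  have A: "finite A" "A \<subseteq> k" using S center by (auto simp: A_def)
  define M where "M = Suc (\<Sum>v\<in>S. nat \<bar>D v\<bar>)"
  define N where "N = M * (1 + card A)"
  define D' where "D' v = int M * (zero_order (inverse t) v + (\<Sum>a\<in>A. zero_order (t - a) v))" for v
  define T where "T = S \<union> {v. is_place k fun_field v \<and> 0 < v (inverse t)} \<union>
    (\<Union>a\<in>A. {v. is_place k fun_field v \<and> 0 < v (t - a)})"
  have T: "finite T" "\<And>v. v \<in> T \<Longrightarrow> is_place k fun_field v"
  proof -
    have "finite (\<Union>a\<in>A. {v. is_place k fun_field v \<and> 0 < v (t - a)})"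
      using A places_translate(1) by (intro finite_UN_I) blast+
    then show "finite T" unfolding T_def using S(1) places_invert(1) by (intro finite_UnI)
    show "is_place k fun_field v" if "v \<in> T" for v
      using that S(2) unfolding T_def by blast
  qed
  have zo: "zero_order x v \<ge> 0" for x v by (simp add: zero_order_def)
  have DM: "D v \<le> int M" for v
  proof (cases "v \<in> S")
    case True
    then have "nat \<bar>D v\<bar> \<le> (\<Sum>v\<in>S. nat \<bar>D v\<bar>)" using S(1) by (intro member_le_sum) auto
    then have "nat \<bar>D v\<bar> \<le> M" unfolding M_def by (rule le_SucI)
    then show ?thesis by linarith
  qed (simp add: S_def)
  have le: "D v \<le> D' v" if "v \<in> T" for v
  proof (cases "v \<in> S")
    case False
    then show ?thesis using zo by (auto simp: S_def D'_def intro!: mult_nonneg_nonneg add_nonneg_nonneg sum_nonneg)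
  next
    case True
    have "1 \<le> zero_order (inverse t) v + (\<Sum>a\<in>A. zero_order (t - a) v)"
    proof (cases "v t < 0")
      case neg: True
      interpret place k fun_field v using S(2)[OF True] by (rule placeI)
      have "zero_order (inverse t) v \<ge> 1"
        using neg v_inverse[OF t_fun_field] S(2)[OF True] by (simp add: zero_order_def)
      then show ?thesis using zo by (simp add: add_increasing2 sum_nonneg)
    next
      case False
      then have "center v \<in> A" using True by (auto simp: A_def)
      then have "zero_order (t - center v) v \<le> (\<Sum>a\<in>A. zero_order (t - a) v)"
        using A(1) zo by (intro member_le_sum) auto
      moreover have "zero_order (t - center v) v \<ge> 1"
        using center[OF True False] S(2)[OF True] by (simp add: zero_order_def)
      ultimately show ?thesis using zo[of "inverse t" v] by linarith
    qed
    then have "int M * 1 \<le> D' v" unfolding D'_def by (intro mult_left_mono) auto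
    then show ?thesis using DM[of v] by simp
  qed
  have off: "D' v = D v" if "v \<notin> T" for v
  proof -
    have "zero_order (inverse t) v = 0" "D v = 0" "\<And>a. a \<in> A \<Longrightarrow> zero_order (t - a) v = 0"
      using that unfolding T_def S_def zero_order_def by auto
    then show ?thesis by (simp add: D'_def)
  qed
  obtain m where m: "cring.dimension m k (L D')" "int m \<le> int n + (\<Sum>v\<in>T. D' v - D v)"
    using dimension_L_increase[OF T le off dim] by blast
  have sumD: "(\<Sum>v\<in>T. D v) = divisor_degree D"
    unfolding divisor_degree_def by (rule sum.mono_neutral_right) (use T(1) in \<open>auto simp: T_def S_def\<close>)
  have "(\<Sum>v\<in>T. D' v) = int M * ((\<Sum>v\<in>T. zero_order (inverse t) v) + (\<Sum>a\<in>A. \<Sum>v\<in>T. zero_order (t - a) v))"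
    unfolding D'_def by (simp add: sum_distrib_left[symmetric] sum.distrib sum.swap[of _ A])
  also have "\<dots> \<le> int M * (2 + (\<Sum>a\<in>A. 2))"
  proof (intro mult_left_mono add_mono sum_mono)
    show "(\<Sum>v\<in>T. zero_order (inverse t) v) \<le> 2"
      by (rule sum_zero_order[OF places_invert T(1)]) (unfold T_def, blast)
    fix a assume a: "a \<in> A"
    then have "a \<in> k" "{v. is_place k fun_field v \<and> 0 < v (t - a)} \<subseteq> T"
      using A(2) unfolding T_def by blast+
    then show "(\<Sum>v\<in>T. zero_order (t - a) v) \<le> 2"
      using sum_zero_order[OF places_translate T(1)] by blast
  qed simp
  also have "\<dots> = 2 * int N" by (simp add: N_def algebra_simps)
  finally have sumD': "(\<Sum>v\<in>T. D' v) \<le> 2 * int N" .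
  define z where "z = (\<Prod>a\<in>A. (t - a) ^ M)"
  have "z \<noteq> 0" unfolding z_def using A t_notin by (subst prod_zero_iff) auto
  then have "cring.dimension ((N + 1) + (N - 1)) k (bounded_space z (N + 1) (N - 1))"
    by (rule dimension_bounded_space)
  moreover have "bounded_space z (N + 1) (N - 1) \<subseteq> L D'"
    using bounded_space_subset_L[OF A N_def z_def] unfolding D'_def[abs_def] .
  ultimately have "(N + 1) + (N - 1) \<le> m" using dimension_mono m(1) by blast
  moreover have "N \<ge> 1" by (simp add: N_def M_def)
  ultimately have "2 * N \<le> m" by linarith
  then show ?thesis using m(2) sumD sumD' by (simp add: sum_subtractf)
qed

lemma riemann_roch_dim_eq:
  assumes "cring.dimension n k (L D)"
  shows "riemann_roch_dim k fun_field D = n"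
  using cring.dimI[OF subfield_k assms] unfolding riemann_roch_dim_def over_def L_def .

text \<open>The genus is a maximum of integers that are at most 1, and the value at the zero divisor is
  \<open>0 - 1 + 1\<close>.\<close>

theorem genus_le_1: "\<exists>g. function_field_genus k fun_field g \<and> (g = 0 \<or> g = 1)"
proof -
  define val where "val D = divisor_degree D - int (riemann_roch_dim k fun_field D) + 1" for D
  have le: "val D \<le> 1" if D: "is_divisor k fun_field D" for D
  proof -
    obtain n where n: "cring.dimension n k (L D)" using finite_dimension_L[OF D] by blast
    then show ?thesis
      using divisor_degree_le_dimension[OF D n] riemann_roch_dim_eq[OF n] by (simp add: val_def)
  qed
  have zero: "is_divisor k fun_field (\<lambda>v. 0)" by (simp add: is_divisor_def)
  have val0: "val (\<lambda>v. 0) = 0"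
    using riemann_roch_dim_eq[OF dimension_L_0] by (simp add: val_def divisor_degree_def)
  show ?thesis
  proof (cases "\<exists>D. is_divisor k fun_field D \<and> val D = 1")
    case True
    then have "function_field_genus k fun_field 1"
      unfolding function_field_genus_def val_def[symmetric] using le by metis
    then show ?thesis by blast
  next
    case False
    then have "val D \<le> 0" if "is_divisor k fun_field D" for D
      using le[OF that] that by force
    then have "function_field_genus k fun_field 0"
      unfolding function_field_genus_def val_def[symmetric] using zero val0 by metis
    then show ?thesis by blast
  qed
qed

end

section \<open>Forms and function fields of projective varieties\<close>

definition exponents :: "nat \<Rightarrow> (nat \<times> nat \<times> nat \<times> nat) set" where
  "exponents n = {(i1, i2, i3, i4). i1 + i2 + i3 + i4 = n}"

fun power_product :: "nat \<times> nat \<times> nat \<times> nat \<Rightarrow> 'a::field quad \<Rightarrow> 'a" where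
  "power_product (i1, i2, i3, i4) (x1, x2, x3, x4) = x1 ^ i1 * x2 ^ i2 * x3 ^ i3 * x4 ^ i4"

lemma finite_exponents: "finite (exponents n)"
proof (rule finite_subset)
  show "exponents n \<subseteq> {..n} \<times> {..n} \<times> {..n} \<times> {..n}" by (auto simp: exponents_def)
qed simp

lemma is_form_iff:
  "is_form F n f \<longleftrightarrow> (\<exists>c. (\<forall>e. c e \<in> F) \<and> f = (\<lambda>x. \<Sum>e\<in>exponents n. c e * power_product e x))"
proof -
  have "(\<lambda>(x1, x2, x3, x4). \<Sum>(i1, i2, i3, i4) | i1 + i2 + i3 + i4 = n.
      c (i1, i2, i3, i4) * x1 ^ i1 * x2 ^ i2 * x3 ^ i3 * x4 ^ i4)
    = (\<lambda>x. \<Sum>e\<in>exponents n. c e * power_product e x)" for c :: "_ \<Rightarrow> 'a"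
    by (auto simp: exponents_def fun_eq_iff mult.assoc intro!: sum.cong)
  then show ?thesis unfolding is_form_def by simp
qed

lemma power_product_mult:
  "power_product (i1, i2, i3, i4) x * power_product (j1, j2, j3, j4) x
    = power_product (i1 + j1, i2 + j2, i3 + j3, i4 + j4) x"
  by (cases x) (simp add: power_add mult_ac)

context complex_subfield
begin

lemma form_zero: "is_form F n (\<lambda>x. 0)"
  unfolding is_form_iff by (intro exI[of _ "\<lambda>e. 0"]) (simp add: zero)

lemma form_add:
  assumes "is_form F n f" "is_form F n g" shows "is_form F n (\<lambda>x. f x + g x)"
proof -
  obtain c c' where "\<forall>e. c e \<in> F" "f = (\<lambda>x. \<Sum>e\<in>exponents n. c e * power_product e x)"
    "\<forall>e. c' e \<in> F" "g = (\<lambda>x. \<Sum>e\<in>exponents n. c' e * power_product e x)"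
    using assms unfolding is_form_iff by blast
  then show ?thesis
    unfolding is_form_iff
    by (intro exI[of _ "\<lambda>e. c e + c' e"]) (simp add: add distrib_right sum.distrib)
qed

lemma form_scale:
  assumes "is_form F n f" "a \<in> F" shows "is_form F n (\<lambda>x. a * f x)"
proof -
  obtain c where "\<forall>e. c e \<in> F" "f = (\<lambda>x. \<Sum>e\<in>exponents n. c e * power_product e x)"
    using assms unfolding is_form_iff by blast
  then show ?thesis
    unfolding is_form_iff
    by (intro exI[of _ "\<lambda>e. a * c e"]) (simp add: mult assms(2) sum_distrib_left mult.assoc)
qed

lemma form_uminus: "is_form F n g \<Longrightarrow> is_form F n (\<lambda>x. - g x)"
  using form_scale[of n g "- 1"] uminus[OF one] by simp

lemma form_sum:
  assumes "finite I" "\<And>i. i \<in> I \<Longrightarrow> is_form F n (g i)"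
  shows "is_form F n (\<lambda>x. \<Sum>i\<in>I. g i x)"
  using assms by (induction I rule: finite_induct) (auto intro: form_zero form_add)

lemma form_monomial:
  assumes "e \<in> exponents n" "a \<in> F" shows "is_form F n (\<lambda>x. a * power_product e x)"
proof -
  have "(\<Sum>e'\<in>exponents n. (if e' = e then a else 0) * power_product e' x) = a * power_product e x" for x
  proof -
    have "(\<Sum>e'\<in>exponents n. (if e' = e then a else 0) * power_product e' x)
      = (\<Sum>e'\<in>exponents n. if e' = e then a * power_product e' x else 0)"
      by (intro sum.cong) auto
    also have "\<dots> = a * power_product e x" using assms(1) finite_exponents by simp
    finally show ?thesis .
  qed
  then show ?thesis
    unfolding is_form_iff
    by (intro exI[of _ "\<lambda>e'. if e' = e then a else 0"]) (auto simp: assms(2) zero)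
qed

lemma form_mult:
  assumes "is_form F n f" "is_form F m g" shows "is_form F (n + m) (\<lambda>x. f x * g x)"
proof -
  obtain c c' where c: "\<forall>e. c e \<in> F" "f = (\<lambda>x. \<Sum>e\<in>exponents n. c e * power_product e x)"
    "\<forall>e. c' e \<in> F" "g = (\<lambda>x. \<Sum>e\<in>exponents m. c' e * power_product e x)"
    using assms unfolding is_form_iff by blast
  have "is_form F (n + m) (\<lambda>x. \<Sum>e\<in>exponents n. \<Sum>e'\<in>exponents m.
      c e * power_product e x * (c' e' * power_product e' x))"
  proof (intro form_sum finite_exponents)
    fix e e' assume e: "e \<in> exponents n" "e' \<in> exponents m"
    obtain i1 i2 i3 i4 j1 j2 j3 j4 where ij: "e = (i1, i2, i3, i4)" "e' = (j1, j2, j3, j4)"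
      by (metis prod_cases4)
    have "(i1 + j1, i2 + j2, i3 + j3, i4 + j4) \<in> exponents (n + m)"
      using e by (simp add: ij exponents_def)
    then have "is_form F (n + m) (\<lambda>x. (c e * c' e') * power_product (i1 + j1, i2 + j2, i3 + j3, i4 + j4) x)"
      by (intro form_monomial mult c(1)[rule_format] c(3)[rule_format])
    then show "is_form F (n + m) (\<lambda>x. c e * power_product e x * (c' e' * power_product e' x))"
      by (simp add: ij power_product_mult[symmetric] mult_ac)
  qed
  then show ?thesis unfolding c(2,4) sum_product .
qed

lemma form_const: "a \<in> F \<Longrightarrow> is_form F 0 (\<lambda>x. a)"
proof -
  assume "a \<in> F"
  then have "is_form F 0 (\<lambda>x. a * power_product (0, 0, 0, 0) x)"
    by (intro form_monomial) (simp_all add: exponents_def)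
  moreover have "power_product (0, 0, 0, 0) x = (1::complex)" for x by (cases x) simp
  ultimately show ?thesis by simp
qed

lemma form_coordinates:
  "is_form F 1 (\<lambda>(x1, x2, x3, x4). x1)" "is_form F 1 (\<lambda>(x1, x2, x3, x4). x2)"
  "is_form F 1 (\<lambda>(x1, x2, x3, x4). x3)" "is_form F 1 (\<lambda>(x1, x2, x3, x4). x4)"
proof -
  have e: "(1, 0, 0, 0) \<in> exponents 1" "(0, 1, 0, 0) \<in> exponents 1" "(0, 0, 1, 0) \<in> exponents 1"
    "(0, 0, 0, 1) \<in> exponents 1" by (simp_all add: exponents_def)
  have eq: "(\<lambda>x. 1 * power_product (1, 0, 0, 0) x) = (\<lambda>(x1, x2, x3, x4). x1::complex)"
    "(\<lambda>x. 1 * power_product (0, 1, 0, 0) x) = (\<lambda>(x1, x2, x3, x4). x2::complex)"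
    "(\<lambda>x. 1 * power_product (0, 0, 1, 0) x) = (\<lambda>(x1, x2, x3, x4). x3::complex)"
    "(\<lambda>x. 1 * power_product (0, 0, 0, 1) x) = (\<lambda>(x1, x2, x3, x4). x4::complex)"
    by (auto simp: fun_eq_iff)
  show "is_form F 1 (\<lambda>(x1, x2, x3, x4). x1)" "is_form F 1 (\<lambda>(x1, x2, x3, x4). x2)"
    "is_form F 1 (\<lambda>(x1, x2, x3, x4). x3)" "is_form F 1 (\<lambda>(x1, x2, x3, x4). x4)"
    using form_monomial[OF e(1) one] form_monomial[OF e(2) one] form_monomial[OF e(3) one]
      form_monomial[OF e(4) one] unfolding eq by blast+
qed

lemma form_linear:
  assumes "a2 \<in> F" "a3 \<in> F" "a4 \<in> F"
  shows "is_form F 1 (\<lambda>(x1, x2, x3, x4). a2 * x2 + a3 * x3 + a4 * x4)"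
proof -
  have "is_form F 1 (\<lambda>x. a2 * (case x of (x1, x2, x3, x4) \<Rightarrow> x2) + a3 * (case x of (x1, x2, x3, x4) \<Rightarrow> x3)
      + a4 * (case x of (x1, x2, x3, x4) \<Rightarrow> x4))"
    by (intro form_add form_scale form_coordinates assms)
  then show ?thesis by (simp add: case_prod_unfold)
qed

lemma form_value:
  assumes "complex_subfield K" "F \<subseteq> K" "is_form F n f" "x1 \<in> K" "x2 \<in> K" "x3 \<in> K" "x4 \<in> K"
  shows "f (x1, x2, x3, x4) \<in> K"
proof -
  interpret K: complex_subfield K by fact
  obtain c where c: "\<forall>e. c e \<in> F" "f = (\<lambda>x. \<Sum>e\<in>exponents n. c e * power_product e x)"
    using assms unfolding is_form_iff by blast
  have pp: "power_product e (x1, x2, x3, x4) \<in> K" for e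
    using assms by (cases e) (auto intro!: K.mult K.power)
  show ?thesis
    unfolding c(2) by (intro K.sum K.mult pp subsetD[OF assms(2)] c(1)[rule_format])
qed

lemma function_field_complex_subfield: "complex_subfield (function_field_at F \<xi>)"
proof
  have I: "f \<xi> / h \<xi> \<in> function_field_at F \<xi>" if "is_form F n f" "is_form F n h" "h \<xi> \<noteq> 0" for f h n
    using that unfolding function_field_at_def by blast
  show "1 \<in> function_field_at F \<xi>"
    using I[of 0 "\<lambda>x. 1" "\<lambda>x. 1"] form_const[OF one] by simp
  fix x assume "x \<in> function_field_at F \<xi>"
  then obtain f h n where x: "is_form F n f" "is_form F n h" "h \<xi> \<noteq> 0" "x = f \<xi> / h \<xi>"
    unfolding function_field_at_def by blast
  show "- x \<in> function_field_at F \<xi>"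
    using I[OF form_uminus[OF x(1)] x(2,3)] x(4) by simp
  show "inverse x \<in> function_field_at F \<xi>"
  proof (cases "f \<xi> = 0")
    case True
    then show ?thesis using I[of 0 "\<lambda>x. 0" "\<lambda>x. 1"] form_const[OF one] form_const[OF zero] x(4) by simp
  next
    case False
    then show ?thesis using I[OF x(2,1)] x(4) by simp
  qed
  fix y assume "y \<in> function_field_at F \<xi>"
  then obtain f' h' n' where y: "is_form F n' f'" "is_form F n' h'" "h' \<xi> \<noteq> 0" "y = f' \<xi> / h' \<xi>"
    unfolding function_field_at_def by blast
  have hh: "is_form F (n + n') (\<lambda>z. h z * h' z)" by (rule form_mult[OF x(2) y(2)])
  have "is_form F (n + n') (\<lambda>z. f z * h' z + h z * f' z)"
    by (intro form_add form_mult x y)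
  from I[OF this hh] show "x + y \<in> function_field_at F \<xi>"
    using x y by (simp add: add_frac_eq mult.commute)
  show "x * y \<in> function_field_at F \<xi>"
    using I[OF form_mult[OF x(1) y(1)] hh] x y by simp
qed

lemma function_field_ratio:
  "is_form F n f \<Longrightarrow> is_form F n h \<Longrightarrow> h \<xi> \<noteq> 0 \<Longrightarrow> f \<xi> / h \<xi> \<in> function_field_at F \<xi>"
  unfolding function_field_at_def by blast

lemma function_field_consts: "F \<subseteq> function_field_at F \<xi>"
  using function_field_ratio[of 0 "\<lambda>x. _" "\<lambda>x. 1"] form_const one by fastforce

end

section \<open>Curves with a rational generic point\<close>

text \<open>For the coefficients of a form over the algebraic numbers, this splits the form into rational forms.\<close>

lemma rational_basis:
  fixes C :: "complex set"
  assumes "finite C"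
  obtains B where "B \<subseteq> C" "finite B"
    "\<And>u. (\<Sum>b\<in>B. of_rat (u b) * b) = 0 \<Longrightarrow> \<forall>b\<in>B. u b = (0::rat)"
    "\<And>c. c \<in> C \<Longrightarrow> \<exists>u. c = (\<Sum>b\<in>B. of_rat (u b) * b)"
proof -
  interpret V: vector_space "\<lambda>(r::rat) (x::complex). of_rat r * x"
    by unfold_locales (simp_all add: of_rat_add of_rat_mult algebra_simps)
  obtain B where B: "B \<subseteq> C" "V.independent B" "C \<subseteq> V.span B"
    using V.maximal_independent_subset[of C] by blast
  have fin: "finite B" using B(1) assms by (rule finite_subset)
  show ?thesis
  proof (rule that[OF B(1) fin])
    show "\<forall>b\<in>B. u b = 0" if "(\<Sum>b\<in>B. of_rat (u b) * b) = 0" for u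
      using that B(2) unfolding V.dependent_finite[OF fin] by auto
    show "\<exists>u. c = (\<Sum>b\<in>B. of_rat (u b) * b)" if "c \<in> C" for c
      using that B(3) unfolding V.span_finite[OF fin] by auto
  qed
qed

text \<open>The Zariski closure of a point over the rationals.\<close>

definition rational_closure :: "complex quad \<Rightarrow> complex quad set" where
  "rational_closure \<xi> = {x. x \<noteq> (0, 0, 0, 0) \<and> (\<forall>n f. is_form \<rat> n f \<and> f \<xi> = 0 \<longrightarrow> f x = 0)}"

lemma zariski_closed_rational_closure: "zariski_closed \<rat> (rational_closure \<xi>)"
  unfolding zariski_closed_def rational_closure_def
  by (intro exI[of _ "{f. \<exists>n. is_form \<rat> n f \<and> f \<xi> = 0}"]) blast

lemma generic_point_imp_irreducible:
  assumes "generic_point k V \<xi>" "\<xi> \<noteq> (0, 0, 0, 0)" "V \<subseteq> {x. x \<noteq> (0, 0, 0, 0)}"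
  shows "irreducible_over k V"
proof -
  have "V \<subseteq> A" if "zariski_closed k A" "\<xi> \<in> A" for A
  proof -
    obtain S where S: "\<forall>f\<in>S. \<exists>n. is_form k n f" "A = {x. x \<noteq> (0, 0, 0, 0) \<and> (\<forall>f\<in>S. f x = 0)}"
      using \<open>zariski_closed k A\<close> unfolding zariski_closed_def by blast
    show ?thesis
    proof
      fix x assume x: "x \<in> V"
      have "f x = 0" if f: "f \<in> S" for f
      proof -
        obtain n where "is_form k n f" using S(1) f by blast
        moreover have "f \<xi> = 0" using \<open>\<xi> \<in> A\<close> f unfolding S(2) by blast
        ultimately show ?thesis using assms(1) x unfolding generic_point_def by blast
      qed
      moreover have "x \<noteq> (0, 0, 0, 0)" using assms(3) x by blast
      ultimately show "x \<in> A" unfolding S(2) by blast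
    qed
  qed
  moreover have "\<xi> \<in> V" using assms(1) by (simp add: generic_point_def)
  ultimately show ?thesis unfolding irreducible_over_def by blast
qed

context double_cover
begin

lemma transcendence_degree_one: "transcendence_degree_one k fun_field"
proof -
  have tr: "cring.transcendental k t"
    using algebraic_over_iff[OF complex_subfield_axioms, of t] poly_t_eq_0 by blast
  define E where "E = generate_field complex_ring (insert t k)"
  have "subfield E complex_ring"
    unfolding E_def by (rule field.generate_field_is_subfield[OF field_complex_ring]) simp
  then interpret E: complex_subfield E by (rule subfield_imp_complex_subfield)
  have "insert t k \<subseteq> E" unfolding E_def by (auto intro: generate_field.incl)
  then have rat: "rat_funs \<subseteq> E" using rat_funs_minimal[OF E.complex_subfield_axioms] by simp
  have "\<not> cring.transcendental E x" if x: "x \<in> fun_field" for x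
  proof -
    obtain A B where AB: "A \<in> rat_funs" "B \<in> rat_funs" "x = A + B * s"
      using x by (auto simp: fun_field_def)
    define p where "p = [:A\<^sup>2 - B\<^sup>2 * poly f t, - 2 * A, 1:]"
    have "p \<in> polys E"
      unfolding p_def using AB rat f_rat
      by (intro E.polys_intros E.diff E.mult E.power E.one E.uminus E.numeral) auto
    moreover have "p \<noteq> 0" by (simp add: p_def)
    moreover have "poly p x = 0"
      by (simp add: p_def AB(3) s2[symmetric] power2_eq_square algebra_simps)
    ultimately show ?thesis using algebraic_over_iff[OF E.complex_subfield_axioms] by blast
  qed
  then show ?thesis
    unfolding transcendence_degree_one_def E_def using tr t_fun_field by blast
qed

end

text \<open>With \<open>f\<close> over the rationals, the numbers \<open>P(t) + R(t) s\<close> with rational polynomials \<open>P\<close> and \<open>R\<close> form a ring, the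
  ring of polynomial functions on an affine model of the curve.\<close>

locale rational_double_cover = double_cover alg_numbers t s f for t s f +
  assumes f_rat_poly: "f \<in> polys \<rat>"
begin

definition rational_ring :: "complex set" where
  "rational_ring = {poly P t + poly R t * s | P R. P \<in> polys \<rat> \<and> R \<in> polys \<rat>}"

interpretation Q: complex_subfield \<rat> by (rule complex_subfield_Rats)

lemma rational_ringI: "P \<in> polys \<rat> \<Longrightarrow> R \<in> polys \<rat> \<Longrightarrow> x = poly P t + poly R t * s \<Longrightarrow> x \<in> rational_ring"
  unfolding rational_ring_def by blast

lemma rational_ring_add: "x \<in> rational_ring \<Longrightarrow> y \<in> rational_ring \<Longrightarrow> x + y \<in> rational_ring"
proof -
  assume "x \<in> rational_ring" "y \<in> rational_ring"
  then obtain P R P' R' where *: "P \<in> polys \<rat>" "R \<in> polys \<rat>" "x = poly P t + poly R t * s"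
    "P' \<in> polys \<rat>" "R' \<in> polys \<rat>" "y = poly P' t + poly R' t * s"
    unfolding rational_ring_def by blast
  then show ?thesis
    by (intro rational_ringI[of "P + P'" "R + R'"]) (auto intro: Q.polys_intros simp: algebra_simps)
qed

lemma rational_ring_mult: "x \<in> rational_ring \<Longrightarrow> y \<in> rational_ring \<Longrightarrow> x * y \<in> rational_ring"
proof -
  assume "x \<in> rational_ring" "y \<in> rational_ring"
  then obtain P R P' R' where *: "P \<in> polys \<rat>" "R \<in> polys \<rat>" "x = poly P t + poly R t * s"
    "P' \<in> polys \<rat>" "R' \<in> polys \<rat>" "y = poly P' t + poly R' t * s"
    unfolding rational_ring_def by blast
  then show ?thesis
    using f_rat_poly
    by (intro rational_ringI[of "P * P' + R * R' * f" "P * R' + R * P'"])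
      (auto intro!: Q.polys_intros simp: s2[symmetric] power2_eq_square algebra_simps)
qed

lemma rational_ring_const: "a \<in> \<rat> \<Longrightarrow> a \<in> rational_ring"
  by (rule rational_ringI[of "[:a:]" 0]) (auto intro: Q.polys_intros)

lemma rational_ring_t: "t \<in> rational_ring"
  by (rule rational_ringI[of "[:0, 1:]" 0]) (auto intro: Q.polys_0 Q.polys_pCons[OF Q.zero Q.polys_const[OF Q.one]])

lemma rational_ring_s: "s \<in> rational_ring"
  by (rule rational_ringI[of 0 1]) (auto intro: Q.polys_intros)

lemma rational_ring_power: "x \<in> rational_ring \<Longrightarrow> x ^ n \<in> rational_ring"
  by (induction n) (auto intro: rational_ring_const rational_ring_mult)

lemma rational_ring_sum: "(\<And>i. i \<in> I \<Longrightarrow> g i \<in> rational_ring) \<Longrightarrow> (\<Sum>i\<in>I. g i) \<in> rational_ring"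
  by (induction I rule: infinite_finite_induct) (auto intro: rational_ring_const rational_ring_add)

lemma rational_ring_poly: "P \<in> polys \<rat> \<Longrightarrow> x \<in> rational_ring \<Longrightarrow> poly P x \<in> rational_ring"
  unfolding poly_altdef
  by (rule rational_ring_sum, rule rational_ring_mult) (auto intro: rational_ring_power rational_ring_const dest: polysD)

lemma rational_ring_fun_field: "x \<in> rational_ring \<Longrightarrow> x \<in> fun_field"
  unfolding rational_ring_def
  by (auto intro!: KK.add KK.mult poly_fun_field s_fun_field polys_mono[of \<rat>] Rats)

lemma linearly_disjoint:
  assumes B: "finite B" "B \<subseteq> alg_numbers"
    and ind: "\<And>u. (\<Sum>b\<in>B. of_rat (u b) * b) = 0 \<Longrightarrow> \<forall>b\<in>B. u b = (0::rat)"
    and m: "\<And>b. b \<in> B \<Longrightarrow> m b \<in> rational_ring" and sum0: "(\<Sum>b\<in>B. b * m b) = 0"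
  shows "\<forall>b\<in>B. m b = 0"
proof -
  have "\<forall>b\<in>B. \<exists>P R. P \<in> polys \<rat> \<and> R \<in> polys \<rat> \<and> m b = poly P t + poly R t * s"
    using m unfolding rational_ring_def by blast
  then obtain P R where PR: "\<And>b. b \<in> B \<Longrightarrow> P b \<in> polys \<rat> \<and> R b \<in> polys \<rat> \<and> m b = poly (P b) t + poly (R b) t * s"
    by metis
  have sub: "\<rat> \<subseteq> alg_numbers" using Rats by blast
  have zero: "S b = 0" if S: "\<And>b. b \<in> B \<Longrightarrow> S b \<in> polys \<rat>" "(\<Sum>b\<in>B. smult b (S b)) = 0" and b: "b \<in> B" for S b
  proof (rule poly_eqI)
    fix i
    have "\<forall>b\<in>B. \<exists>u. coeff (S b) i = of_rat u" using polysD[OF S(1)] by (metis Rats_cases)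
    then obtain u where u: "\<And>b. b \<in> B \<Longrightarrow> coeff (S b) i = of_rat (u b)" by metis
    have "(\<Sum>b\<in>B. of_rat (u b) * b) = (\<Sum>b\<in>B. b * coeff (S b) i)"
      using u by (intro sum.cong) (auto simp: mult.commute)
    also have "\<dots> = coeff (\<Sum>b\<in>B. smult b (S b)) i" by (simp add: coeff_sum)
    finally have "(\<Sum>b\<in>B. of_rat (u b) * b) = 0" using S(2) by simp
    then have "u b = 0" using ind b by blast
    then show "coeff (S b) i = coeff 0 i" using u[OF b] by simp
  qed
  have "poly (\<Sum>b\<in>B. smult b (P b)) t + poly (\<Sum>b\<in>B. smult b (R b)) t * s = (\<Sum>b\<in>B. b * m b)"
  proof -
    have "(\<Sum>b\<in>B. b * m b) = (\<Sum>b\<in>B. b * poly (P b) t + b * poly (R b) t * s)"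
      using PR by (intro sum.cong) (simp_all add: distrib_left mult.assoc)
    then show ?thesis by (simp add: poly_sum sum.distrib sum_distrib_right)
  qed
  then have "(\<Sum>b\<in>B. smult b (P b)) = 0 \<and> (\<Sum>b\<in>B. smult b (R b)) = 0"
    using sum0 B(2) PR polys_mono[OF sub] by (intro indep polys_sum polys_smult) auto
  then have "P b = 0" "R b = 0" if "b \<in> B" for b
    using zero[of P b] zero[of R b] PR that by blast+
  then show ?thesis using PR by simp
qed

text \<open>This is the geometric irreducibility: a form over \<open>k\<close> is a combination of rational forms whose coefficients are
  independent over the rationals, and if it vanishes at \<open>\<xi>\<close> then so does each of the rational
  forms.\<close>

lemma generic_point_rational_closure:
  assumes \<xi>: "\<xi> = (x1, x2, x3, x4)" "x1 \<in> rational_ring" "x2 \<in> rational_ring" "x3 \<in> rational_ring"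
      "x4 \<in> rational_ring" "\<xi> \<noteq> (0, 0, 0, 0)"
  shows "generic_point alg_numbers (rational_closure \<xi>) \<xi>"
  unfolding generic_point_def
proof (intro conjI allI impI ballI)
  show "\<xi> \<in> rational_closure \<xi>" using \<xi> by (simp add: rational_closure_def)
  fix n f x assume f: "is_form alg_numbers n f \<and> f \<xi> = 0" and x: "x \<in> rational_closure \<xi>"
  obtain c where c: "\<forall>e. c e \<in> alg_numbers" "f = (\<lambda>x. \<Sum>e\<in>exponents n. c e * power_product e x)"
    using f unfolding is_form_iff by blast
  obtain B where B: "B \<subseteq> c ` exponents n" "finite B"
    and ind: "\<And>u. (\<Sum>b\<in>B. of_rat (u b) * b) = 0 \<Longrightarrow> \<forall>b\<in>B. u b = (0::rat)"
    and span: "\<And>a. a \<in> c ` exponents n \<Longrightarrow> \<exists>u. a = (\<Sum>b\<in>B. of_rat (u b) * b)"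
    using rational_basis[OF finite_imageI[OF finite_exponents], of c n] by blast
  have "\<forall>e\<in>exponents n. \<exists>u. c e = (\<Sum>b\<in>B. of_rat (u b) * b)" using span by blast
  then obtain u where u: "\<And>e. e \<in> exponents n \<Longrightarrow> c e = (\<Sum>b\<in>B. of_rat (u e b) * b)" by metis
  define g where "g b = (\<lambda>y. \<Sum>e\<in>exponents n. of_rat (u e b) * power_product e (y :: complex quad))" for b :: complex
  have g_form: "is_form \<rat> n (g b)" for b
    unfolding is_form_iff g_def by (intro exI[of _ "\<lambda>e. of_rat (u e b)"]) simp
  have f_eq: "f y = (\<Sum>b\<in>B. b * g b y)" for y
  proof -
    have "f y = (\<Sum>e\<in>exponents n. \<Sum>b\<in>B. b * (of_rat (u e b) * power_product e y))"
      unfolding c(2)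
    proof (rule sum.cong[OF refl])
      fix e assume e: "e \<in> exponents n"
      show "c e * power_product e y = (\<Sum>b\<in>B. b * (of_rat (u e b) * power_product e y))"
        unfolding u[OF e] sum_distrib_right by (intro sum.cong) (simp_all only: mult_ac)
    qed
    also have "\<dots> = (\<Sum>b\<in>B. \<Sum>e\<in>exponents n. b * (of_rat (u e b) * power_product e y))"
      by (rule sum.swap)
    finally show ?thesis by (simp add: g_def sum_distrib_left)
  qed
  have pp: "power_product e \<xi> \<in> rational_ring" for e
    using \<xi> by (cases e) (auto intro!: rational_ring_mult rational_ring_power)
  have "g b \<xi> \<in> rational_ring" for b
    unfolding g_def by (rule rational_ring_sum, rule rational_ring_mult, rule rational_ring_const)
      (simp_all add: pp)
  moreover have "B \<subseteq> alg_numbers" using B(1) c(1) by blast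
  moreover have "(\<Sum>b\<in>B. b * g b \<xi>) = 0" using f f_eq[of \<xi>] by simp
  ultimately have "\<forall>b\<in>B. g b \<xi> = 0"
    using linearly_disjoint[OF B(2) _ ind, of "\<lambda>b. g b \<xi>"] by blast
  then have "\<forall>b\<in>B. g b x = 0"
    using x g_form unfolding rational_closure_def by blast
  then show "f x = 0" by (simp add: f_eq)
qed

theorem curve_of_genus_le_1:
  assumes \<xi>: "\<xi> = (x1, x2, x3, x4)" "x1 \<in> rational_ring" "x2 \<in> rational_ring" "x3 \<in> rational_ring"
      "x4 \<in> rational_ring" "\<xi> \<noteq> (0, 0, 0, 0)"
    and t: "t \<in> function_field_at alg_numbers \<xi>" and s: "s \<in> function_field_at alg_numbers \<xi>"
  shows "geom_irreducible_curve_over_Q (rational_closure \<xi>)"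
    and "\<exists>g. has_geometric_genus (rational_closure \<xi>) g \<and> (g = 0 \<or> g = 1)"
proof -
  have eq: "function_field_at alg_numbers \<xi> = fun_field"
  proof
    show "function_field_at alg_numbers \<xi> \<subseteq> fun_field"
      unfolding function_field_at_def \<xi>(1)
      using form_value[OF KK.complex_subfield_axioms k_fun_field] \<xi>(2-5) rational_ring_fun_field
      by (auto intro!: KK.divide)
    show "fun_field \<subseteq> function_field_at alg_numbers \<xi>"
      by (rule fun_field_minimal[OF function_field_complex_subfield function_field_consts t s])
  qed
  note gen = generic_point_rational_closure[OF \<xi>]
  have "irreducible_over alg_numbers (rational_closure \<xi>)"
    by (rule generic_point_imp_irreducible[OF gen \<xi>(6)]) (auto simp: rational_closure_def)
  then show "geom_irreducible_curve_over_Q (rational_closure \<xi>)"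
    unfolding geom_irreducible_curve_over_Q_def
    using zariski_closed_rational_closure gen transcendence_degree_one eq by metis
  show "\<exists>g. has_geometric_genus (rational_closure \<xi>) g \<and> (g = 0 \<or> g = 1)"
    unfolding has_geometric_genus_def using gen genus_le_1 eq by metis
qed

end

section \<open>Double covers of parametrized rational curves\<close>

interpretation alg_numbers: alg_closed_subfield alg_numbers
  by unfold_locales (rule alg_numbers_closed)

interpretation rats: complex_subfield \<rat>
  by (rule complex_subfield_Rats)

lemma Rats_subset_alg_numbers: "\<rat> \<subseteq> alg_numbers"
  using alg_numbers.Rats by blast

text \<open>The rational function field \<open>k(t)\<close> is a double cover of the line with coordinate \<open>t\<^sup>2\<close>, which brings the rational
  curves under the same treatment.\<close>

lemma double_cover_square:
  assumes t: "t \<notin> alg_numbers"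
  shows "double_cover alg_numbers (t\<^sup>2) t [:0, 1:]"
proof unfold_locales
  show "[:0, 1:] \<in> polys alg_numbers"
    by (intro alg_numbers.polys_intros alg_numbers.zero alg_numbers.one)
  fix P R assume PR: "P \<in> polys alg_numbers" "R \<in> polys alg_numbers" "poly P (t\<^sup>2) + poly R (t\<^sup>2) * t = 0"
  define P' R' where "P' = pcompose P [:0, 0, 1:]" and "R' = pcompose R [:0, 0, 1:] * [:0, 1:]"
  have sq: "[:0, 0, 1:] \<in> polys alg_numbers" and X: "[:0, 1:] \<in> polys alg_numbers"
    by (intro alg_numbers.polys_intros alg_numbers.zero alg_numbers.one)+
  have "P' + R' \<in> polys alg_numbers"
    unfolding P'_def R'_def
    by (intro alg_numbers.polys_add alg_numbers.polys_mult alg_numbers.polys_pcompose PR sq X)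
  moreover have "poly (P' + R') t = 0"
    using PR(3) by (simp add: P'_def R'_def poly_pcompose power2_eq_square mult.commute)
  ultimately have 0: "P' + R' = 0" using alg_numbers_closed t by blast
  have dP: "degree P' = 2 * degree P"
    by (simp add: P'_def degree_pcompose)
  have R0: "R = 0"
  proof (rule ccontr)
    assume "R \<noteq> 0"
    then have "pcompose R [:0, 0, 1:] \<noteq> 0" by (simp add: pcompose_eq_0_iff)
    then have "degree R' = 2 * degree R + 1"
      unfolding R'_def by (subst degree_mult_eq) (simp_all add: degree_pcompose)
    moreover have "P' = - R'" using 0 by (simp add: eq_neg_iff_add_eq_0)
    ultimately have "2 * degree P = 2 * degree R + 1" using dP by simp
    then show False by presburger
  qed
  then have "P' = 0" using 0 by (simp add: R'_def)
  then show "P = 0 \<and> R = 0" using R0 by (simp add: P'_def pcompose_eq_0_iff)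
qed simp_all

text \<open>The coefficients of a square root are determined recursively by its value at one point.\<close>

lemma rational_sqrt:
  fixes g :: "complex poly"
  assumes sq: "g\<^sup>2 \<in> polys \<rat>" and \<tau>: "\<tau> \<in> \<rat>" and r: "r \<in> \<rat>" "r \<noteq> 0" "poly g \<tau> = r"
  shows "g \<in> polys \<rat>"
proof -
  define G where "G = pcompose g [:\<tau>, 1:]"
  have G2: "G * G \<in> polys \<rat>"
  proof -
    have "pcompose (g\<^sup>2) [:\<tau>, 1:] \<in> polys \<rat>"
      by (rule rats.polys_pcompose[OF sq]) (intro rats.polys_intros rats.one \<tau>)
    then show ?thesis by (simp add: G_def power2_eq_square pcompose_mult)
  qed
  have G0: "coeff G 0 = r"
    using r(3) by (simp add: G_def poly_pcompose flip: poly_0_coeff_0)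
  have "coeff G n \<in> \<rat>" for n
  proof (induction n rule: less_induct)
    case (less n)
    show ?case
    proof (cases "n = 0")
      case True
      then show ?thesis using G0 r by simp
    next
      case False
      define rest where "rest = (\<Sum>i\<in>{0<..<n}. coeff G i * coeff G (n - i))"
      have "{..n} = insert 0 (insert n {0<..<n})" using False by auto
      then have "coeff (G * G) n = 2 * r * coeff G n + rest"
        using False by (simp add: coeff_mult rest_def G0)
      moreover have "rest \<in> \<rat>"
        unfolding rest_def using less by (intro rats.sum rats.mult) auto
      ultimately have "coeff G n = (coeff (G * G) n - rest) / (2 * r)" using r by simp
      then show ?thesis
        using polysD[OF G2] \<open>rest \<in> \<rat>\<close> r by (simp add: Rats_divide Rats_diff Rats_mult)
    qed
  qed
  then have "G \<in> polys \<rat>" by (rule polysI)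
  then have "pcompose G [:- \<tau>, 1:] \<in> polys \<rat>"
    by (rule rats.polys_pcompose) (intro rats.polys_intros rats.one rats.uminus \<tau>)
  moreover have "pcompose G [:- \<tau>, 1:] = g"
    by (simp add: G_def pcompose_assoc[symmetric] pcompose_pCons)
  ultimately show ?thesis by simp
qed

lemma indep_or_square:
  fixes f :: "complex poly"
  assumes k: "f \<in> polys alg_numbers" and t: "t \<notin> alg_numbers" and s: "s\<^sup>2 = poly f t"
    and not_indep: "P \<in> polys alg_numbers" "R \<in> polys alg_numbers" "poly P t + poly R t * s = 0" "P \<noteq> 0 \<or> R \<noteq> 0"
  obtains g where "f = g\<^sup>2"
proof -
  have t0: "S = 0" if "S \<in> polys alg_numbers" "poly S t = 0" for S
    using that alg_numbers_closed t by blast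
  have R: "R \<noteq> 0" using not_indep t0[of P] by auto
  have "poly P t = - (poly R t * s)" using not_indep(3) by (simp add: eq_neg_iff_add_eq_0)
  then have "poly (P\<^sup>2 - R\<^sup>2 * f) t = 0" by (simp add: power_mult_distrib s)
  moreover have "P\<^sup>2 - R\<^sup>2 * f \<in> polys alg_numbers"
    using not_indep k by (intro alg_numbers.polys_intros)
  ultimately have eq: "P\<^sup>2 = R\<^sup>2 * f" using t0 by fastforce
  then have "R\<^sup>2 dvd P\<^sup>2" by simp
  then have "R dvd P" by (simp add: pow_divides_pow_iff)
  then obtain g where "P = R * g" by (rule dvdE)
  then have "R\<^sup>2 * f = R\<^sup>2 * g\<^sup>2" using eq by (auto simp add: power_mult_distrib)
  then have "f = g\<^sup>2" using R by simp
  then show ?thesis by (rule that)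
qed

text \<open>The condition \<open>ratio\<close> expresses \<open>t\<close> as a quotient of linear forms on the curve \<open>p(t)\<close>, so that the function field is all of
  \<open>k(t, s)\<close>.  The condition \<open>square\<close> rules out that \<open>f\<close> is a constant nonsquare times a square, where the
  curve would split into two conjugate components.\<close>

theorem parametrized_curve:
  fixes p :: "nat \<Rightarrow> complex poly" and f :: "complex poly" and A B :: "nat \<Rightarrow> complex"
  assumes p: "\<And>i. p i \<in> polys \<rat>" and f: "f \<in> polys \<rat>" "degree f \<le> 4"
    and A: "\<And>i. A i \<in> \<rat>" and B: "\<And>i. B i \<in> \<rat>"
    and ratio: "smult (A 2) (p 2) + smult (A 3) (p 3) + smult (A 4) (p 4) = [:0, 1:] * D"
    and D: "D = smult (B 2) (p 2) + smult (B 3) (p 3) + smult (B 4) (p 4)" "D \<noteq> 0"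
    and square: "f = 0 \<or> (\<exists>\<tau>\<in>\<rat>. \<exists>r\<in>\<rat>. r \<noteq> 0 \<and> poly f \<tau> = r\<^sup>2)"
  shows "\<exists>V g. geom_irreducible_curve_over_Q V \<and> has_geometric_genus V g \<and> (g = 0 \<or> g = 1) \<and>
    (\<forall>n \<psi>. is_form \<rat> n \<psi> \<and> (\<forall>t s. s\<^sup>2 = poly f t \<longrightarrow> \<psi> (s, poly (p 2) t, poly (p 3) t, poly (p 4) t) = 0)
      \<longrightarrow> (\<forall>x\<in>V. \<psi> x = 0))"
proof -
  obtain t where t: "t \<notin> alg_numbers" using ex_not_algebraic by blast
  define s where "s = csqrt (poly f t)"
  have s2: "s\<^sup>2 = poly f t" by (simp add: s_def)
  define \<xi> where "\<xi> = (s, poly (p 2) t, poly (p 3) t, poly (p 4) t)"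
  let ?K = "function_field_at alg_numbers \<xi>"
  interpret K: complex_subfield ?K by (rule alg_numbers.function_field_complex_subfield)
  note mono = polys_mono[OF Rats_subset_alg_numbers]
  have Dk: "D \<in> polys alg_numbers"
    unfolding D(1) by (intro alg_numbers.polys_intros mono p alg_numbers.Rats B)
  have Dt: "poly D t \<noteq> 0" using alg_numbers_closed[OF Dk D(2)] t by blast
  have \<xi>0: "\<xi> \<noteq> (0, 0, 0, 0)" using Dt by (auto simp: \<xi>_def D(1))
  define LA LB where "LA = (\<lambda>(x1::complex, x2, x3, x4). A 2 * x2 + A 3 * x3 + A 4 * x4)"
    and "LB = (\<lambda>(x1::complex, x2, x3, x4). B 2 * x2 + B 3 * x3 + B 4 * x4)"
  have forms: "is_form alg_numbers 1 LA" "is_form alg_numbers 1 LB"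
    unfolding LA_def LB_def by (intro alg_numbers.form_linear alg_numbers.Rats A B)+
  have LB: "LB \<xi> = poly D t" by (simp add: LB_def \<xi>_def D(1))
  have LA: "LA \<xi> = t * poly D t"
    using arg_cong[OF ratio, of "\<lambda>P. poly P t"] by (simp add: LA_def \<xi>_def)
  have tK: "t \<in> ?K"
    using alg_numbers.function_field_ratio[OF forms, of \<xi>] Dt by (simp add: LA LB)
  have "s / poly D t \<in> ?K"
    using alg_numbers.function_field_ratio[OF alg_numbers.form_coordinates(1) forms(2), of \<xi>] Dt
    by (simp add: LB) (simp add: \<xi>_def)
  moreover have "poly D t \<in> ?K"
    by (rule K.poly_in[OF polys_mono[OF alg_numbers.function_field_consts Dk] tK])
  ultimately have sK: "s \<in> ?K" using K.mult[of "s / poly D t" "poly D t"] Dt by simp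
  have "geom_irreducible_curve_over_Q (rational_closure \<xi>) \<and>
    (\<exists>g. has_geometric_genus (rational_closure \<xi>) g \<and> (g = 0 \<or> g = 1))"
  proof (cases "\<exists>P R. P \<in> polys alg_numbers \<and> R \<in> polys alg_numbers \<and> poly P t + poly R t * s = 0 \<and> (P \<noteq> 0 \<or> R \<noteq> 0)")
    case False
    interpret C: rational_double_cover t s f
      by unfold_locales (use False mono f s2 in blast)+
    have "\<xi> = (s, poly (p 2) t, poly (p 3) t, poly (p 4) t)" by (simp add: \<xi>_def)
    then show ?thesis
      using C.curve_of_genus_le_1[of \<xi>] C.rational_ring_s C.rational_ring_poly[OF p C.rational_ring_t]
        \<xi>0 tK sK by blast
  next
    case True
    then obtain g where g: "f = g\<^sup>2" using indep_or_square[OF mono[OF f(1)] t s2] by blast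
    have "g \<in> polys \<rat>"
    proof (cases "f = 0")
      case True
      then show ?thesis using g rats.polys_0 by simp
    next
      case False
      then obtain \<tau> r where \<tau>: "\<tau> \<in> \<rat>" "r \<in> \<rat>" "r \<noteq> 0" "poly f \<tau> = r\<^sup>2" using square by blast
      then have "poly g \<tau> = r \<or> poly g \<tau> = - r" using g by (simp add: power2_eq_iff)
      then show ?thesis
        using rational_sqrt[of g \<tau> r] rational_sqrt[of g \<tau> "- r"] \<tau> f(1) g by auto
    qed
    interpret D: double_cover alg_numbers "t\<^sup>2" t "[:0, 1:]" by (rule double_cover_square[OF t])
    interpret C: rational_double_cover "t\<^sup>2" t "[:0, 1:]"
      by unfold_locales (intro rats.polys_intros rats.zero rats.one)
    have "s = poly g t \<or> s = - poly g t" using s2 by (simp add: g power2_eq_iff)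
    then have "s \<in> C.rational_ring"
      using C.rational_ring_poly[OF \<open>g \<in> polys \<rat>\<close> C.rational_ring_s]
        C.rational_ring_poly[OF rats.polys_uminus[OF \<open>g \<in> polys \<rat>\<close>] C.rational_ring_s] by auto
    moreover have "\<xi> = (s, poly (p 2) t, poly (p 3) t, poly (p 4) t)" by (simp add: \<xi>_def)
    ultimately show ?thesis
      using C.curve_of_genus_le_1[of \<xi>] C.rational_ring_poly[OF p C.rational_ring_s]
        \<xi>0 tK K.power[OF tK] by blast
  qed
  moreover have "\<psi> x = 0"
    if "is_form \<rat> n \<psi>" "\<forall>t s. s\<^sup>2 = poly f t \<longrightarrow> \<psi> (s, poly (p 2) t, poly (p 3) t, poly (p 4) t) = 0"
      "x \<in> rational_closure \<xi>" for n \<psi> x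
  proof -
    have "\<psi> \<xi> = 0" unfolding \<xi>_def using that(2) s2 by blast
    then show ?thesis using that(1,3) unfolding rational_closure_def by blast
  qed
  ultimately show ?thesis by blast
qed

section \<open>Ternary quadratic forms with infinitely many common points\<close>

text \<open>Vectors are indexed by 2, 3, 4, as the last three coordinates of a point.\<close>

definition tern :: "(nat \<Rightarrow> rat) \<Rightarrow> (nat \<Rightarrow> 'a::field_char_0) \<Rightarrow> 'a" where
  "tern h y = of_rat (h 2) * (y 2)\<^sup>2 + of_rat (h 3) * (y 3)\<^sup>2 + of_rat (h 4) * (y 4)\<^sup>2
     + of_rat (h 5) * y 2 * y 3 + of_rat (h 6) * y 2 * y 4 + of_rat (h 7) * y 3 * y 4"

definition polar :: "(nat \<Rightarrow> rat) \<Rightarrow> (nat \<Rightarrow> 'a::field_char_0) \<Rightarrow> (nat \<Rightarrow> 'a) \<Rightarrow> 'a" where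
  "polar h y z = 2 * of_rat (h 2) * y 2 * z 2 + 2 * of_rat (h 3) * y 3 * z 3 + 2 * of_rat (h 4) * y 4 * z 4
     + of_rat (h 5) * (y 2 * z 3 + y 3 * z 2) + of_rat (h 6) * (y 2 * z 4 + y 4 * z 2)
     + of_rat (h 7) * (y 3 * z 4 + y 4 * z 3)"

definition vec :: "'a \<Rightarrow> 'a \<Rightarrow> 'a \<Rightarrow> nat \<Rightarrow> 'a" where
  "vec x2 x3 x4 i = (if i = 2 then x2 else if i = 3 then x3 else x4)"

lemma vec_simps [simp]: "vec x2 x3 x4 2 = x2" "vec x2 x3 x4 3 = x3" "vec x2 x3 x4 4 = x4"
  by (simp_all add: vec_def)

definition lin :: "(nat \<Rightarrow> rat) \<Rightarrow> (nat \<Rightarrow> rat) \<Rightarrow> rat" where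
  "lin A y = A 2 * y 2 + A 3 * y 3 + A 4 * y 4"

definition cross :: "(nat \<Rightarrow> rat) \<Rightarrow> (nat \<Rightarrow> rat) \<Rightarrow> nat \<Rightarrow> rat" where
  "cross y z = vec (y 3 * z 4 - y 4 * z 3) (y 4 * z 2 - y 2 * z 4) (y 2 * z 3 - y 3 * z 2)"

definition proportional :: "(nat \<Rightarrow> rat) \<Rightarrow> (nat \<Rightarrow> rat) \<Rightarrow> bool" where
  "proportional y z \<longleftrightarrow> (\<exists>l. \<forall>i\<in>{2, 3, 4}. y i = l * z i)"

lemma tern_cong: "y 2 = z 2 \<Longrightarrow> y 3 = z 3 \<Longrightarrow> y 4 = z 4 \<Longrightarrow> tern h y = tern h z"
  by (simp add: tern_def)

lemma tern_combination:
  "tern h (\<lambda>i. a * w i + b * u i + c * v i) =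
     a\<^sup>2 * tern h w + b\<^sup>2 * tern h u + c\<^sup>2 * tern h v
     + a * b * polar h w u + a * c * polar h w v + b * c * polar h u v"
  by (simp add: tern_def polar_def power2_eq_square algebra_simps)

lemma tern_scale: "tern h (\<lambda>i. a * w i) = a\<^sup>2 * tern h w"
  by (simp add: tern_def power2_eq_square algebra_simps)

lemma tern_of_rat: "tern h (\<lambda>i. of_rat (w i)) = of_rat (tern h w)"
  by (simp add: tern_def of_rat_add of_rat_mult of_rat_power)

lemma polar_of_rat: "polar h (\<lambda>i. of_rat (w i)) (\<lambda>i. of_rat (u i)) = of_rat (polar h w u)"
  by (simp add: polar_def of_rat_add of_rat_mult)

lemma polar_commute: "polar h y z = polar h z y"
  by (simp add: polar_def algebra_simps)

lemma formEven_tern: "formEven h x1 x2 x3 x4 = of_rat (h 1) * x1\<^sup>2 + tern h (vec x2 x3 x4)"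
  by (simp add: formEven_def tern_def)

lemma formEven_form: "is_form (\<rat> :: complex set) 2 (\<lambda>(x1, x2, x3, x4). formEven h x1 x2 x3 x4)"
proof -
  let ?x1 = "\<lambda>(x1::complex, x2::complex, x3::complex, x4::complex). x1"
    and ?x2 = "\<lambda>(x1::complex, x2::complex, x3::complex, x4::complex). x2"
    and ?x3 = "\<lambda>(x1::complex, x2::complex, x3::complex, x4::complex). x3"
    and ?x4 = "\<lambda>(x1::complex, x2::complex, x3::complex, x4::complex). x4"
  have m: "is_form \<rat> 2 (\<lambda>x. of_rat r * (g x * g' x))" if "is_form \<rat> 1 g" "is_form \<rat> 1 g'"
    for r and g g' :: "complex quad \<Rightarrow> complex"
    using rats.form_scale[OF rats.form_mult[OF that], of "of_rat r"] by (simp add: numeral_2_eq_2)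
  have "is_form \<rat> 2 (\<lambda>x. of_rat (h 1) * (?x1 x * ?x1 x) + of_rat (h 2) * (?x2 x * ?x2 x)
    + of_rat (h 3) * (?x3 x * ?x3 x) + of_rat (h 4) * (?x4 x * ?x4 x) + of_rat (h 5) * (?x2 x * ?x3 x)
    + of_rat (h 6) * (?x2 x * ?x4 x) + of_rat (h 7) * (?x3 x * ?x4 x))"
    by (intro rats.form_add m rats.form_coordinates)
  then show ?thesis
    by (simp add: formEven_def case_prod_unfold power2_eq_square mult.assoc)
qed

text \<open>The values of \<open>h\<close> along the curve \<open>\<alpha> w + \<beta> u + \<gamma> v\<close>.\<close>

definition tern_along ::
  "(nat \<Rightarrow> rat) \<Rightarrow> (nat \<Rightarrow> rat) \<Rightarrow> (nat \<Rightarrow> rat) \<Rightarrow> (nat \<Rightarrow> rat) \<Rightarrow> complex poly \<Rightarrow> complex poly \<Rightarrow> complex poly \<Rightarrow> complex poly"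
  where "tern_along h w u v \<alpha> \<beta> \<gamma> =
    smult (of_rat (tern h w)) (\<alpha> * \<alpha>) + smult (of_rat (tern h u)) (\<beta> * \<beta>) + smult (of_rat (tern h v)) (\<gamma> * \<gamma>)
    + smult (of_rat (polar h w u)) (\<alpha> * \<beta>) + smult (of_rat (polar h w v)) (\<alpha> * \<gamma>) + smult (of_rat (polar h u v)) (\<beta> * \<gamma>)"

definition curve_in :: "complex quad set \<Rightarrow> bool" where
  "curve_in U \<longleftrightarrow> (\<exists>V g. geom_irreducible_curve_over_Q V \<and> V \<subseteq> U \<and>
     has_geometric_genus V g \<and> (g = 0 \<or> g = 1))"

definition double_conic :: "(nat \<Rightarrow> rat) \<Rightarrow> (nat \<Rightarrow> rat) \<Rightarrow> complex quad set" where
  "double_conic S C = {(x1, x2, x3, x4). x1\<^sup>2 = tern S (vec x2 x3 x4) \<and> tern C (vec x2 x3 x4) = 0}"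

lemma curve_from_parametrization:
  fixes \<alpha> \<beta> \<gamma> D :: "complex poly"
  assumes param: "\<alpha> \<in> polys \<rat>" "\<beta> \<in> polys \<rat>" "\<gamma> \<in> polys \<rat>"
      "degree \<alpha> \<le> 2" "degree \<beta> \<le> 2" "degree \<gamma> \<le> 2"
    and D: "D = smult (of_rat (lin B w)) \<alpha> + smult (of_rat (lin B u)) \<beta> + smult (of_rat (lin B v)) \<gamma>" "D \<noteq> 0"
    and ratio: "smult (of_rat (lin A w)) \<alpha> + smult (of_rat (lin A u)) \<beta> + smult (of_rat (lin A v)) \<gamma> = [:0, 1:] * D"
    and f_def: "f = tern_along S w u v \<alpha> \<beta> \<gamma>"
    and C: "tern_along C w u v \<alpha> \<beta> \<gamma> = 0"
    and square: "f = 0 \<or> (\<exists>\<tau>\<in>\<rat>. \<exists>r\<in>\<rat>. r \<noteq> 0 \<and> poly f \<tau> = r\<^sup>2)"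
  shows "curve_in (double_conic S C)"
proof -
  define p where "p i = smult (of_rat (w i)) \<alpha> + smult (of_rat (u i)) \<beta> + smult (of_rat (v i)) \<gamma>" for i :: nat
  have p: "p i \<in> polys \<rat>" for i
    unfolding p_def using param by (intro rats.polys_add rats.polys_smult) auto
  have val: "tern h (\<lambda>i. poly (p i) t) = of_rat (tern h w) * (poly \<alpha> t)\<^sup>2 + of_rat (tern h u) * (poly \<beta> t)\<^sup>2
      + of_rat (tern h v) * (poly \<gamma> t)\<^sup>2 + of_rat (polar h w u) * (poly \<alpha> t * poly \<beta> t)
      + of_rat (polar h w v) * (poly \<alpha> t * poly \<gamma> t) + of_rat (polar h u v) * (poly \<beta> t * poly \<gamma> t)" for h t
  proof -
    have "tern h (\<lambda>i. poly (p i) t)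
      = tern h (\<lambda>i. poly \<alpha> t * of_rat (w i) + poly \<beta> t * of_rat (u i) + poly \<gamma> t * of_rat (v i))"
      by (rule tern_cong) (simp_all add: p_def mult.commute)
    then show ?thesis unfolding tern_combination tern_of_rat polar_of_rat by (simp add: mult_ac)
  qed
  have f: "f \<in> polys \<rat>"
    unfolding f_def tern_along_def using param by (intro rats.polys_add rats.polys_smult rats.polys_mult) auto
  have deg_term: "degree (smult r (a * b)) \<le> 4"
    if "degree a \<le> 2" "degree b \<le> 2" for r :: complex and a b :: "complex poly"
    using degree_smult_le[of r "a * b"] degree_mult_le[of a b] that by linarith
  have deg: "degree f \<le> 4"
    unfolding f_def tern_along_def by (intro degree_add_le deg_term param)
  have fS: "poly f t = tern S (\<lambda>i. poly (p i) t)" for t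
    by (simp add: val f_def tern_along_def power2_eq_square)
  have C0: "tern C (\<lambda>i. poly (p i) t) = 0" for t
    using arg_cong[OF C, of "\<lambda>P. poly P t"] by (simp add: val tern_along_def power2_eq_square)
  have linp: "smult (of_rat (E 2)) (p 2) + smult (of_rat (E 3)) (p 3) + smult (of_rat (E 4)) (p 4)
     = smult (of_rat (lin E w)) \<alpha> + smult (of_rat (lin E u)) \<beta> + smult (of_rat (lin E v)) \<gamma>" for E
    by (rule poly_eqI) (simp add: p_def lin_def of_rat_add of_rat_mult algebra_simps)
  obtain V g where V: "geom_irreducible_curve_over_Q V" "has_geometric_genus V g" "g = 0 \<or> g = 1"
    and van: "\<And>n \<psi>. is_form \<rat> n \<psi> \<Longrightarrow>
      (\<forall>t s. s\<^sup>2 = poly f t \<longrightarrow> \<psi> (s, poly (p 2) t, poly (p 3) t, poly (p 4) t) = 0) \<Longrightarrow> \<forall>x\<in>V. \<psi> x = 0"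
    using parametrized_curve[of p f "\<lambda>i. of_rat (A i)" "\<lambda>i. of_rat (B i)" D, OF p f deg _ _ _ _ D(2) square]
    unfolding linp using D(1) ratio by auto
  have V1: "\<forall>x\<in>V. (\<lambda>(x1, x2, x3, x4). formEven (\<lambda>i. if i = 1 then 1 else - S i) x1 x2 x3 x4) x = 0"
  proof (rule van[OF formEven_form], intro allI impI)
    fix t s :: complex assume "s\<^sup>2 = poly f t"
    moreover have "poly f t = tern S (vec (poly (p 2) t) (poly (p 3) t) (poly (p 4) t))"
      unfolding fS by (rule tern_cong) simp_all
    ultimately show "(case (s, poly (p 2) t, poly (p 3) t, poly (p 4) t) of (x1, x2, x3, x4) \<Rightarrow>
        formEven (\<lambda>i. if i = 1 then 1 else - S i) x1 x2 x3 x4) = 0"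
      by (simp add: formEven_tern) (simp add: tern_def of_rat_minus algebra_simps)
  qed
  have V2: "\<forall>x\<in>V. (\<lambda>(x1, x2, x3, x4). formEven (C(1 := 0)) x1 x2 x3 x4) x = 0"
  proof (rule van[OF formEven_form], intro allI impI)
    fix t s :: complex
    have "tern C (vec (poly (p 2) t) (poly (p 3) t) (poly (p 4) t)) = 0"
      using C0[of t] tern_cong[of "\<lambda>i. poly (p i) t" "vec (poly (p 2) t) (poly (p 3) t) (poly (p 4) t)" C] by simp
    then show "(case (s, poly (p 2) t, poly (p 3) t, poly (p 4) t) of (x1, x2, x3, x4) \<Rightarrow>
        formEven (C(1 := 0)) x1 x2 x3 x4) = 0"
      by (simp add: formEven_tern) (simp add: tern_def)
  qed
  have "V \<subseteq> double_conic S C"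
  proof
    fix x assume "x \<in> V"
    obtain x1 x2 x3 x4 where x: "x = (x1, x2, x3, x4)" by (metis prod_cases4)
    have "x1\<^sup>2 = tern S (vec x2 x3 x4)" "tern C (vec x2 x3 x4) = 0"
      using bspec[OF V1 \<open>x \<in> V\<close>] bspec[OF V2 \<open>x \<in> V\<close>]
      by (simp_all add: x formEven_tern) (simp_all add: tern_def of_rat_minus algebra_simps)
    then show "x \<in> double_conic S C" by (simp add: double_conic_def x)
  qed
  then show ?thesis unfolding curve_in_def using V by blast
qed

text \<open>On the line \<open>t y + z\<close> the parameter is a quotient of linear forms obtained from the normal vector \<open>n = y \<times> z\<close>:
  the form \<open>p \<mapsto> n \<cdot> (p \<times> z)\<close> has the value \<open>t |n|\<^sup>2\<close>, and \<open>p \<mapsto> n \<cdot> (y \<times> p)\<close> the value \<open>|n|\<^sup>2\<close>.\<close>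

lemma curve_over_line_aux:
  assumes C: "tern C y = 0" "tern C z = 0" "polar C y z = 0"
    and n: "lin (cross y z) (cross y z) \<noteq> 0"
    and S: "tern S z = r\<^sup>2" "r \<noteq> 0 \<or> tern S y = 0"
  shows "curve_in (double_conic S C)"
proof -
  let ?n = "cross y z"
  define N where "N = lin ?n ?n"
  have A: "lin (cross z ?n) y = N" "lin (cross z ?n) z = 0"
    and B: "lin (cross ?n y) z = N" "lin (cross ?n y) y = 0"
    by (simp_all add: N_def lin_def cross_def algebra_simps)
  define f :: "complex poly" where "f = [:of_rat (tern S z), of_rat (polar S y z), of_rat (tern S y):]"
  have "f = 0 \<or> (\<exists>\<tau>\<in>\<rat>. \<exists>r\<in>\<rat>. r \<noteq> 0 \<and> poly f \<tau> = r\<^sup>2)"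
  proof (cases "r = 0")
    case False
    then show ?thesis
      by (intro disjI2 bexI[of _ 0] bexI[of _ "of_rat r"]) (simp_all add: f_def S(1) of_rat_power)
  next
    case True
    define m where "m = polar S y z"
    have f: "f = [:0, of_rat m:]" using S True by (simp add: f_def m_def)
    show ?thesis
    proof (cases "m = 0")
      case True
      then show ?thesis by (simp add: f)
    next
      case False
      then show ?thesis
        by (intro disjI2 bexI[of _ "of_rat m"]) (simp_all add: f power2_eq_square)
    qed
  qed
  then show ?thesis
  proof (intro curve_from_parametrization[of "[:0, 1:]" 1 0 "[:of_rat N:]" "cross ?n y" y z "\<lambda>i. 0" "cross z ?n" f S C])
    show "[:0, 1:] \<in> polys (\<rat> :: complex set)" by (intro rats.polys_intros rats.zero rats.one)
    show "[:of_rat N:] \<noteq> (0 :: complex poly)" using n by (simp add: N_def)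
  qed (auto simp: A B C f_def tern_along_def intro: rats.polys_intros)
qed

lemma curve_over_line:
  assumes C: "tern C y = 0" "tern C z = 0" "polar C y z = 0"
    and n: "\<not> proportional y z" "\<exists>i\<in>{2, 3, 4}. z i \<noteq> 0"
    and S: "tern S y = a\<^sup>2" "tern S z = r\<^sup>2"
  shows "curve_in (double_conic S C)"
proof -
  have "lin (cross y z) (cross y z) \<noteq> 0"
  proof
    assume "lin (cross y z) (cross y z) = 0"
    then have "(cross y z 2)\<^sup>2 + (cross y z 3)\<^sup>2 + (cross y z 4)\<^sup>2 = 0"
      by (simp add: lin_def power2_eq_square)
    then have "cross y z 2 = 0" "cross y z 3 = 0" "cross y z 4 = 0"
      by (simp_all add: sum_power2_eq_zero_iff add_nonneg_eq_0_iff)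
    then have eq: "y 3 * z 4 = y 4 * z 3" "y 4 * z 2 = y 2 * z 4" "y 2 * z 3 = y 3 * z 2"
      by (simp_all add: cross_def)
    obtain i where i: "i \<in> {2, 3, 4}" "z i \<noteq> 0" using n(2) by blast
    have "\<forall>j\<in>{2, 3, 4}. y j = (y i / z i) * z j"
      using i eq by (auto simp: field_simps)
    then show False using n(1) unfolding proportional_def by blast
  qed
  note n' = this
  have "lin (cross z y) (cross z y) = lin (cross y z) (cross y z)"
    by (simp add: lin_def cross_def algebra_simps)
  note n'' = n'[folded this]
  show ?thesis
  proof (cases "r = 0 \<and> a \<noteq> 0")
    case True
    then show ?thesis
      using curve_over_line_aux[of C z y S a] C n'' S polar_commute[of C y z] by simp
  next
    case False
    then show ?thesis using curve_over_line_aux[of C y z S r] C n' S by auto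
  qed
qed


lemma polar_self: "polar h y y = 2 * tern h y"
  by (simp add: polar_def tern_def power2_eq_square)

lemma polar_combination:
  fixes w u v z :: "nat \<Rightarrow> rat"
  assumes "\<forall>i\<in>{2, 3, 4}. a * w i + b * u i + c * v i = 0"
  shows "a * polar h z w + b * polar h z u + c * polar h z v = (0 :: rat)"
proof -
  have "a * polar h z w + b * polar h z u + c * polar h z v
    = polar h z (\<lambda>i. a * w i + b * u i + c * v i)"
    by (simp add: polar_def algebra_simps)
  also have "\<dots> = 0" using assms by (simp add: polar_def)
  finally show ?thesis .
qed

lemma isotropic_triple_independent:
  fixes w u v :: "nat \<Rightarrow> rat"
  assumes C: "tern C w = 0" "tern C u = 0" "tern C v = 0"
    and nz: "polar C w u \<noteq> 0" "polar C w v \<noteq> 0" "polar C u v \<noteq> 0"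
    and comb: "\<forall>i\<in>{2, 3, 4}. a * w i + b * u i + c * v i = 0"
  shows "a = 0 \<and> b = 0 \<and> c = 0"
proof -
  define p q r where pqr: "p = polar C w u" "q = polar C w v" "r = polar C u v"
  have "b * p + c * q = 0" "a * p + c * r = 0" "a * q + b * r = 0"
    using polar_combination[OF comb, of C w] polar_combination[OF comb, of C u]
      polar_combination[OF comb, of C v] C
    by (simp_all add: polar_self pqr polar_commute[of C u w] polar_commute[of C v])
  then have "b * p = - (c * q)" "a * p = - (c * r)" "(a * p) * q + (b * p) * r = 0"
    by (simp_all add: eq_neg_iff_add_eq_0) (metis distrib_right mult.assoc mult.commute mult_zero_left)
  then have "2 * c * q * r = 0" by (simp add: algebra_simps)
  then have "c = 0" using nz by (simp add: pqr)
  then show ?thesis using \<open>b * p = - (c * q)\<close> \<open>a * p = - (c * r)\<close> nz by (simp add: pqr)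
qed

text \<open>If the determinant vanishes, then the cross products provide linear relations between the three vectors, which are
  all trivial, so that the cross products vanish as well.\<close>

lemma isotropic_triple_det:
  assumes C: "tern C w = 0" "tern C u = 0" "tern C v = 0"
    and nz: "polar C w u \<noteq> 0" "polar C w v \<noteq> 0" "polar C u v \<noteq> 0"
  shows "lin (cross w u) v \<noteq> 0"
proof
  assume det: "lin (cross w u) v = 0"
  note ind = isotropic_triple_independent[OF C nz]
  have cross0: "cross u v i = 0" if i: "i \<in> {2, 3, 4}" for i
  proof -
    have "\<forall>j\<in>{2, 3, 4}. cross u v i * w j + cross v w i * u j + cross w u i * v j = 0"
      using i det by (auto simp: lin_def cross_def algebra_simps)
    then show ?thesis using ind by blast
  qed
  have eq: "u 3 * v 4 = u 4 * v 3" "u 4 * v 2 = u 2 * v 4" "u 2 * v 3 = u 3 * v 2"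
    using cross0[of 2] cross0[of 3] cross0[of 4] by (simp_all add: cross_def)
  have "v j = 0" if j: "j \<in> {2, 3, 4}" for j
  proof -
    have "\<forall>i\<in>{2, 3, 4}. 0 * w i + v j * u i + (- u j) * v i = 0"
      using j eq by (auto simp: algebra_simps)
    then show ?thesis using ind by blast
  qed
  then have "polar C u v = 0" by (simp add: polar_def)
  then show False using nz by simp
qed

lemma cramer:
  assumes "k \<in> {2, 3, 4}"
  shows "lin (cross w u) v * y k = lin (cross u v) y * w k + lin (cross v w) y * u k + lin (cross w u) y * v k"
  using assms by (auto simp: lin_def cross_def algebra_simps)

text \<open>In the coordinates of the basis \<open>w, u, v\<close> the conic is \<open>a X Y + b X Z + c Y Z = 0\<close>, and the lines through
  \<open>w\<close> parametrize it: \<open>t = Y / Z\<close> belongs to the point \<open>(- c t : (a t + b) t : a t + b)\<close>.  Every given point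
  other than \<open>w\<close> and \<open>u\<close> is of this form, and gives a square value of \<open>f\<close>; infinitely many
  of them cannot all be zeros of a nonzero \<open>f\<close>.\<close>

lemma curve_over_conic:
  fixes x :: "nat \<Rightarrow> rat" and y :: "nat \<Rightarrow> nat \<Rightarrow> rat" and w u v :: "nat \<Rightarrow> rat"
  assumes C: "tern C w = 0" "tern C u = 0" "tern C v = 0"
    and nz: "polar C w u \<noteq> 0" "polar C w v \<noteq> 0" "polar C u v \<noteq> 0"
    and yS: "\<And>n. (x n)\<^sup>2 = tern S (y n)" and yC: "\<And>n. tern C (y n) = 0"
    and y0: "\<And>n. \<exists>i\<in>{2, 3, 4}. y n i \<noteq> 0"
    and avoid: "\<And>Z. finite Z \<Longrightarrow> \<exists>n. \<forall>z\<in>Z. \<not> proportional (y n) z"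
  shows "curve_in (double_conic S C)"
proof -
  define a b c where abc: "a = polar C w u" "b = polar C w v" "c = polar C u v"
  define N where "N = lin (cross w u) v"
  have N: "N \<noteq> 0" unfolding N_def by (rule isotropic_triple_det[OF C nz])
  define \<alpha> \<beta> \<gamma> :: "complex poly" where
    "\<alpha> = [:0, - of_rat c:]" and "\<beta> = [:0, of_rat b, of_rat a:]" and "\<gamma> = [:of_rat b, of_rat a:]"
  define f where "f = tern_along S w u v \<alpha> \<beta> \<gamma>"
  define p where "p \<tau> i = - c * \<tau> * w i + (a * \<tau> + b) * \<tau> * u i + (a * \<tau> + b) * v i" for \<tau> and i :: nat
  have fp: "poly f (of_rat \<tau>) = of_rat (tern S (p \<tau>))" for \<tau>
  proof -
    have "poly \<alpha> (of_rat \<tau>) = of_rat (- c * \<tau>)" "poly \<beta> (of_rat \<tau>) = of_rat ((a * \<tau> + b) * \<tau>)"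
      "poly \<gamma> (of_rat \<tau>) = of_rat (a * \<tau> + b)"
      by (simp_all add: \<alpha>_def \<beta>_def \<gamma>_def of_rat_add of_rat_mult of_rat_minus algebra_simps)
    moreover have "tern S (p \<tau>) = (- c * \<tau>)\<^sup>2 * tern S w + ((a * \<tau> + b) * \<tau>)\<^sup>2 * tern S u + (a * \<tau> + b)\<^sup>2 * tern S v
        + (- c * \<tau>) * ((a * \<tau> + b) * \<tau>) * polar S w u + (- c * \<tau>) * (a * \<tau> + b) * polar S w v
        + ((a * \<tau> + b) * \<tau>) * (a * \<tau> + b) * polar S u v"
      unfolding p_def by (rule tern_combination)
    ultimately show ?thesis
      unfolding f_def tern_along_def
      by (simp only: poly_add poly_smult poly_mult of_rat_add of_rat_mult power2_eq_square mult_ac)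
  qed
  have square: "f = 0 \<or> (\<exists>\<tau>\<in>\<rat>. \<exists>r\<in>\<rat>. r \<noteq> 0 \<and> poly f \<tau> = r\<^sup>2)"
  proof (cases "f = 0")
    case False
    define roots where "roots = {\<tau>. poly f (of_rat \<tau>) = 0}"
    have "finite roots"
    proof -
      have "inj (of_rat :: rat \<Rightarrow> complex)" by (simp add: inj_def)
      moreover have "roots = of_rat -` {z. poly f z = 0}" by (auto simp: roots_def)
      ultimately show ?thesis using finite_vimageI[OF poly_roots_finite[OF False]] by metis
    qed
    then have "finite ({w, u} \<union> p ` roots)" by simp
    then obtain n where n: "\<forall>z\<in>{w, u} \<union> p ` roots. \<not> proportional (y n) z" using avoid by blast
    define e1 e2 e3 where e: "e1 = lin (cross u v) (y n) / N" "e2 = lin (cross v w) (y n) / N" "e3 = lin (cross w u) (y n) / N"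
    have coords: "y n k = e1 * w k + e2 * u k + e3 * v k" if "k \<in> {2, 3, 4}" for k
      using cramer[OF that, of w u v "y n"] N unfolding e N_def[symmetric] by (simp add: field_simps)
    have "tern C (y n) = tern C (\<lambda>i. e1 * w i + e2 * u i + e3 * v i)"
      by (rule tern_cong) (simp_all add: coords)
    \<comment> \<open>The equation of the conic in the coordinates \<open>e1, e2, e3\<close>.\<close>
    then have rel: "e1 * e2 * a + e1 * e3 * b + e2 * e3 * c = 0"
      using yC[of n] unfolding tern_combination C abc by simp
    have "e3 \<noteq> 0"
    proof
      assume "e3 = 0"
      then have "e1 = 0 \<or> e2 = 0" using rel nz by (simp add: abc)
      then have "proportional (y n) u \<or> proportional (y n) w"
        using coords \<open>e3 = 0\<close> by (auto simp: proportional_def)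
      then show False using n by blast
    qed
    define \<tau> where "\<tau> = e2 / e3"
    define k where "k = a * \<tau> + b"
    have e2: "e2 = \<tau> * e3" using \<open>e3 \<noteq> 0\<close> by (simp add: \<tau>_def)
    have "e3 * (e1 * k + c * e2) = 0" using rel by (simp add: k_def e2 algebra_simps)
    then have e1k: "e1 * k = - (c * \<tau> * e3)"
      using \<open>e3 \<noteq> 0\<close> by (simp add: e2 eq_neg_iff_add_eq_0 mult.assoc)
    have "k \<noteq> 0"
    proof
      assume "k = 0"
      then have "\<tau> = 0" using e1k \<open>e3 \<noteq> 0\<close> nz by (simp add: abc)
      then show False using \<open>k = 0\<close> nz by (simp add: k_def abc)
    qed
    have py: "p \<tau> i = k / e3 * y n i" if "i \<in> {2, 3, 4}" for i
    proof -
      have "k / e3 * y n i = e1 * k / e3 * w i + k * \<tau> * u i + k * v i"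
        using \<open>e3 \<noteq> 0\<close> by (simp add: coords[OF that] e2 field_simps)
      also have "e1 * k / e3 = - c * \<tau>" using \<open>e3 \<noteq> 0\<close> by (simp add: e1k)
      finally show ?thesis by (simp add: p_def k_def)
    qed
    have "tern S (p \<tau>) = tern S (\<lambda>i. k / e3 * y n i)" by (rule tern_cong) (simp_all add: py)
    also have "\<dots> = (k / e3 * x n)\<^sup>2" unfolding tern_scale yS[symmetric] by (rule power_mult_distrib[symmetric])
    finally have val: "poly f (of_rat \<tau>) = (of_rat (k / e3 * x n))\<^sup>2"
      unfolding fp by (simp add: of_rat_power)
    have "k / e3 * x n \<noteq> 0"
    proof
      assume "k / e3 * x n = 0"
      then have "\<tau> \<in> roots" using val by (simp add: roots_def)
      moreover have "proportional (y n) (p \<tau>)"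
        unfolding proportional_def using py \<open>k \<noteq> 0\<close> \<open>e3 \<noteq> 0\<close> by (intro exI[of _ "e3 / k"]) simp
      ultimately show False using n by blast
    qed
    then show ?thesis
      using val by (intro disjI2 bexI[of _ "of_rat \<tau>"] bexI[of _ "of_rat (k / e3 * x n)"]) auto
  qed simp
  show ?thesis
  proof (rule curve_from_parametrization[OF _ _ _ _ _ _ _ _ _ f_def _ square])
    show "\<alpha> \<in> polys \<rat>" "\<beta> \<in> polys \<rat>" "\<gamma> \<in> polys \<rat>"
      unfolding \<alpha>_def \<beta>_def \<gamma>_def by (intro rats.polys_pCons rats.polys_0; simp)+
    show "degree \<alpha> \<le> 2" "degree \<beta> \<le> 2" "degree \<gamma> \<le> 2"
      unfolding \<alpha>_def \<beta>_def \<gamma>_def by auto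
    have A: "lin (cross v w) w = 0" "lin (cross v w) u = N" "lin (cross v w) v = 0"
      and B: "lin (cross w u) w = 0" "lin (cross w u) u = 0"
      by (simp_all add: N_def lin_def cross_def algebra_simps)
    show "smult (of_rat N) \<gamma> = smult (of_rat (lin (cross w u) w)) \<alpha> + smult (of_rat (lin (cross w u) u)) \<beta>
        + smult (of_rat (lin (cross w u) v)) \<gamma>"
      by (simp add: B N_def)
    show "smult (of_rat N) \<gamma> \<noteq> 0" using N nz by (simp add: \<gamma>_def abc)
    show "smult (of_rat (lin (cross v w) w)) \<alpha> + smult (of_rat (lin (cross v w) u)) \<beta>
        + smult (of_rat (lin (cross v w) v)) \<gamma> = [:0, 1:] * smult (of_rat N) \<gamma>"
      by (simp add: A \<beta>_def \<gamma>_def)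
    show "tern_along C w u v \<alpha> \<beta> \<gamma> = 0"
      unfolding tern_along_def C abc[symmetric] by (simp add: \<alpha>_def \<beta>_def \<gamma>_def)
  qed
qed


text \<open>A point \<open>y\<close> of the plane lies below at most two points of the double cover, so the points \<open>y n\<close> can be chosen
  outside any given finite set of directions.\<close>

theorem infinitely_many_points_curve:
  fixes x :: "nat \<Rightarrow> rat" and y :: "nat \<Rightarrow> nat \<Rightarrow> rat"
  assumes yS: "\<And>n. (x n)\<^sup>2 = tern S (y n)" and yC: "\<And>n. tern C (y n) = 0"
    and y0: "\<And>n. \<exists>i\<in>{2, 3, 4}. y n i \<noteq> 0"
    and distinct: "\<And>n m l. n \<noteq> m \<Longrightarrow> l \<noteq> 0 \<Longrightarrow> x m = l * x n \<Longrightarrow> \<exists>i\<in>{2, 3, 4}. y m i \<noteq> l * y n i"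
  shows "curve_in (double_conic S C)"
proof -
  have fin: "finite {n. proportional (y n) z}" for z
  proof -
    define A where "A = {n. proportional (y n) z}"
    have "\<forall>n\<in>A. \<exists>l. \<forall>i\<in>{2, 3, 4}. y n i = l * z i" by (simp add: A_def proportional_def)
    then obtain l where l: "\<And>n i. n \<in> A \<Longrightarrow> i \<in> {2, 3, 4} \<Longrightarrow> y n i = l n * z i" by metis
    have l0: "l n \<noteq> 0" if "n \<in> A" for n using y0[of n] l[OF that] by auto
    have sq: "(x n / l n)\<^sup>2 = tern S z" if "n \<in> A" for n
    proof -
      have "tern S (y n) = tern S (\<lambda>i. l n * z i)" by (rule tern_cong) (simp_all add: l[OF that])
      then show ?thesis using yS[of n] l0[OF that] by (simp add: tern_scale power_divide)
    qed
    have "inj_on (\<lambda>n. x n / l n) A"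
    proof (rule inj_onI, rule ccontr)
      fix n m assume nm: "n \<in> A" "m \<in> A" "x n / l n = x m / l m" "n \<noteq> m"
      have "x m = l m / l n * x n" using nm l0 by (simp add: field_simps)
      then obtain i where i: "i \<in> {2, 3, 4}" "y m i \<noteq> l m / l n * y n i"
        using distinct[OF nm(4), of "l m / l n"] l0[OF nm(1)] l0[OF nm(2)] by auto
      then show False using l[OF nm(1) i(1)] l[OF nm(2) i(1)] l0[OF nm(1)] by simp
    qed
    moreover have "finite {r. r\<^sup>2 = tern S z}"
    proof (cases "\<exists>r. r\<^sup>2 = tern S z")
      case True
      then obtain r where r: "r\<^sup>2 = tern S z" by blast
      have "{r. r\<^sup>2 = tern S z} \<subseteq> {r, - r}" using r by (auto simp: r[symmetric] power2_eq_iff)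
      then show ?thesis by (rule finite_subset) simp
    qed simp
    moreover have "(\<lambda>n. x n / l n) ` A \<subseteq> {r. r\<^sup>2 = tern S z}" using sq by auto
    ultimately have "finite A" by (metis finite_imageD finite_subset)
    then show ?thesis by (simp add: A_def)
  qed
  have avoid: "\<exists>n. \<forall>z\<in>Z. \<not> proportional (y n) z" if "finite Z" for Z
  proof (rule ccontr)
    assume "\<not> ?thesis"
    then have "(UNIV :: nat set) = (\<Union>z\<in>Z. {n. proportional (y n) z})" by auto
    moreover have "finite (\<Union>z\<in>Z. {n. proportional (y n) z})" using that fin by blast
    ultimately show False using infinite_UNIV_nat by metis
  qed
  show ?thesis
  proof (cases "\<exists>n m. \<not> proportional (y n) (y m) \<and> polar C (y n) (y m) = 0")
    case True
    then obtain n m where nm: "\<not> proportional (y n) (y m)" "polar C (y n) (y m) = 0" by blast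
    show ?thesis
      by (rule curve_over_line[OF yC yC nm(2,1) y0 yS[symmetric] yS[symmetric]])
  next
    case False
    obtain n1 where n1: "\<not> proportional (y n1) (y 0)" using avoid[of "{y 0}"] by auto
    obtain n2 where n2: "\<not> proportional (y n2) (y 0)" "\<not> proportional (y n2) (y n1)"
      using avoid[of "{y 0, y n1}"] by auto
    have "polar C (y 0) (y n1) \<noteq> 0" "polar C (y 0) (y n2) \<noteq> 0" "polar C (y n1) (y n2) \<noteq> 0"
      using False n1 n2 polar_commute[of C] by metis+
    then show ?thesis
      by (rule curve_over_conic[OF yC yC yC _ _ _ yS yC y0 avoid])
  qed
qed

section \<open>The surface cut by the invariant quadrics\<close>

text \<open>On the quadric \<open>Q(x3, x4) = N Q(x1, x2)\<close> the form \<open>F\<close> is \<open>Q(x1, x2)\<close> times the following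
  quadratic form, because \<open>Q1(x1) Q1(-x1) = Q (q x4\<^sup>2 - N x1\<^sup>2)\<close> and
  \<open>Q2(x1) Q2(-x1) = Q (N x2\<^sup>2 - x4\<^sup>2)\<close> there.\<close>

definition quotF :: "rat \<Rightarrow> (nat \<Rightarrow> int) \<Rightarrow> rat \<Rightarrow> nat \<Rightarrow> rat" where
  "quotF q a N i =
    (if i = 1 then of_int (a 1) - of_int (a 2) * N + N * of_int (a 6)
     else if i = 2 then of_int (a 1) * q + of_int (a 3) * N + N * of_int (a 7)
     else if i = 3 then N * of_int (a 10)
     else if i = 4 then of_int (a 2) * q - of_int (a 3) + N * of_int (a 12)
     else if i = 5 then 2 * of_int (a 5) + N * of_int (a 8)
     else if i = 6 then - 2 * q * of_int (a 4) + N * of_int (a 9)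
     else N * of_int (a 11))"

lemma formF_on_quadric:
  fixes x1 x2 x3 x4 :: "'a::field_char_0"
  assumes "formQ q x3 x4 = of_rat N * formQ q x1 x2"
  shows "formF q a x1 x2 x3 x4 = formQ q x1 x2 * formEven (quotF q a N) x1 x2 x3 x4"
proof -
  define y where "y = formQ q x1 x2"
  have x1: "x1\<^sup>2 = y - of_rat q * x2\<^sup>2" by (simp add: y_def formQ_def)
  have x3: "x3\<^sup>2 = of_rat N * y - of_rat q * x4\<^sup>2" using assms by (simp add: y_def formQ_def algebra_simps)
  have "formQ1 q x1 x2 x3 x4 * formQ1 q (- x1) x2 x3 x4 = (of_rat q)\<^sup>2 * x2\<^sup>2 * x4\<^sup>2 - x1\<^sup>2 * x3\<^sup>2"
    by (simp add: formQ1_def power2_eq_square algebra_simps)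
  also have "\<dots> = y * (of_rat q * x4\<^sup>2 - of_rat N * x1\<^sup>2)"
    unfolding x3 x1 by (simp add: power2_eq_square algebra_simps)
  finally have 1: "formQ1 q x1 x2 x3 x4 * formQ1 q (- x1) x2 x3 x4 = y * (of_rat q * x4\<^sup>2 - of_rat N * x1\<^sup>2)" .
  have "formQ2 x1 x2 x3 x4 * formQ2 (- x1) x2 x3 x4 = x2\<^sup>2 * x3\<^sup>2 - x1\<^sup>2 * x4\<^sup>2"
    by (simp add: formQ2_def power2_eq_square algebra_simps)
  also have "\<dots> = y * (of_rat N * x2\<^sup>2 - x4\<^sup>2)"
    unfolding x3 x1 by (simp add: power2_eq_square algebra_simps)
  finally have 2: "formQ2 x1 x2 x3 x4 * formQ2 (- x1) x2 x3 x4 = y * (of_rat N * x2\<^sup>2 - x4\<^sup>2)" .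
  have 3: "formQ q (- x1) x2 = y" by (simp add: y_def formQ_def)
  have 4: "y * formQ1 q (- x1) x2 x3 x4 + y * formQ1 q x1 x2 x3 x4 = y * (- 2 * of_rat q * x2 * x4)"
    by (simp add: formQ1_def algebra_simps)
  have 5: "y * formQ2 (- x1) x2 x3 x4 + y * formQ2 x1 x2 x3 x4 = y * (2 * x2 * x3)"
    by (simp add: formQ2_def algebra_simps)
  have 6: "of_int (a 1) * y * y = y * (of_int (a 1) * (x1\<^sup>2 + of_rat q * x2\<^sup>2))"
    by (simp add: x1)
  have "formF q a x1 x2 x3 x4 = y * (of_int (a 1) * (x1\<^sup>2 + of_rat q * x2\<^sup>2)
      + of_int (a 2) * (of_rat q * x4\<^sup>2 - of_rat N * x1\<^sup>2) + of_int (a 3) * (of_rat N * x2\<^sup>2 - x4\<^sup>2)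
      + of_int (a 4) * (- 2 * of_rat q * x2 * x4) + of_int (a 5) * (2 * x2 * x3)
      + (of_int (a 6) * x1\<^sup>2 + of_int (a 7) * x2\<^sup>2 + of_int (a 8) * x2 * x3 + of_int (a 9) * x2 * x4
      + of_int (a 10) * x3\<^sup>2 + of_int (a 11) * x3 * x4 + of_int (a 12) * x4\<^sup>2) * of_rat N)"
    unfolding formF_def 3 y_def[symmetric] mult.assoc[of _ "formQ1 _ _ _ _ _"] mult.assoc[of _ "formQ2 _ _ _ _"]
      1 2 4 5 6 assms[folded y_def] by (simp add: algebra_simps)
  also have "\<dots> = y * formEven (quotF q a N) x1 x2 x3 x4"
    by (simp add: formEven_def quotF_def of_rat_add of_rat_mult of_rat_diff of_rat_minus algebra_simps)
  finally show ?thesis by (simp add: y_def)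
qed

definition quotG :: "rat \<Rightarrow> nat \<Rightarrow> (nat \<Rightarrow> nat \<Rightarrow> rat) \<Rightarrow> (nat \<Rightarrow> int) \<Rightarrow> (nat \<Rightarrow> int) \<Rightarrow> rat \<Rightarrow> nat \<Rightarrow> rat" where
  "quotG q d c b a N i = (\<Sum>j=0..d-1. N ^ j * c j i) + (\<Sum>j=0..d-2. of_int (b j) * N ^ j) * quotF q a N i"

lemma formEven_add: "formEven (\<lambda>i. c i + c' i) x1 x2 x3 x4 = formEven c x1 x2 x3 x4 + formEven c' x1 x2 x3 x4"
  by (simp add: formEven_def of_rat_add algebra_simps)

lemma formEven_scale: "formEven (\<lambda>i. r * c i) x1 x2 x3 x4 = of_rat r * formEven c x1 x2 x3 x4"
  by (simp add: formEven_def of_rat_mult algebra_simps)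

lemma formEven_sum:
  "formEven (\<lambda>i. \<Sum>j\<in>J. c j i) x1 x2 x3 x4 = (\<Sum>j\<in>J. formEven (c j) x1 x2 x3 x4)"
proof (induction J rule: infinite_finite_induct)
  case (insert j J)
  then show ?case by (simp add: formEven_add)
qed (simp_all add: formEven_def)

lemma formG_on_quadric:
  fixes x1 x2 x3 x4 :: "'a::field_char_0"
  assumes d: "d \<ge> 2" and quadric: "formQ q x3 x4 = of_rat N * formQ q x1 x2"
  shows "formG q d c b a x1 x2 x3 x4 = formQ q x1 x2 ^ (d - 1) * formEven (quotG q d c b a N) x1 x2 x3 x4"
proof -
  define y where "y = formQ q x1 x2"
  have "(\<Sum>j=0..d-1. y ^ (d - 1 - j) * (of_rat N * y) ^ j * formEven (c j) x1 x2 x3 x4)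
     = y ^ (d - 1) * (\<Sum>j=0..d-1. of_rat N ^ j * formEven (c j) x1 x2 x3 x4)"
    unfolding sum_distrib_left
  proof (rule sum.cong)
    fix j assume "j \<in> {0..d-1}"
    then have "d - 1 = (d - 1 - j) + j" by simp
    then have "y ^ (d - 1) = y ^ (d - 1 - j) * y ^ j" by (metis power_add)
    then show "y ^ (d - 1 - j) * (of_rat N * y) ^ j * formEven (c j) x1 x2 x3 x4
      = y ^ (d - 1) * (of_rat N ^ j * formEven (c j) x1 x2 x3 x4)"
      by (simp add: power_mult_distrib)
  qed simp
  moreover have "(\<Sum>j=0..d-2. of_int (b j) * y ^ (d - 2 - j) * (of_rat N * y) ^ j)
     = y ^ (d - 2) * (\<Sum>j=0..d-2. of_int (b j) * of_rat N ^ j)"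
    unfolding sum_distrib_left
  proof (rule sum.cong)
    fix j assume "j \<in> {0..d-2}"
    then have "d - 2 = (d - 2 - j) + j" by simp
    then have "y ^ (d - 2) = y ^ (d - 2 - j) * y ^ j" by (metis power_add)
    then show "of_int (b j) * y ^ (d - 2 - j) * (of_rat N * y) ^ j = y ^ (d - 2) * (of_int (b j) * of_rat N ^ j)"
      by (simp add: power_mult_distrib)
  qed simp
  moreover have "y ^ (d - 1) = y ^ (d - 2) * y"
  proof -
    have "d - 1 = Suc (d - 2)" using d by simp
    then show ?thesis by simp
  qed
  moreover have "formEven (quotG q d c b a N) x1 x2 x3 x4
     = (\<Sum>j=0..d-1. of_rat N ^ j * formEven (c j) x1 x2 x3 x4)
      + (\<Sum>j=0..d-2. of_int (b j) * of_rat N ^ j) * formEven (quotF q a N) x1 x2 x3 x4"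
    unfolding quotG_def[abs_def] formEven_add formEven_sum formEven_scale
    by (simp add: of_rat_power of_rat_sum of_rat_mult)
  ultimately show ?thesis
    unfolding formG_def formF_on_quadric[OF quadric] quadric y_def[symmetric]
    by (simp add: algebra_simps)
qed

text \<open>The quadric solved for \<open>x1\<^sup>2\<close>, and the result of eliminating \<open>x1\<^sup>2\<close> from the quadratic form
  \<open>h\<close>.\<close>

definition quadric_form :: "rat \<Rightarrow> rat \<Rightarrow> nat \<Rightarrow> rat" where
  "quadric_form q N i = (if i = 2 then - q else if i = 3 then 1 / N else if i = 4 then q / N else 0)"

definition eliminated :: "rat \<Rightarrow> rat \<Rightarrow> (nat \<Rightarrow> rat) \<Rightarrow> nat \<Rightarrow> rat" where
  "eliminated q N h i = h i + h 1 * quadric_form q N i"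

lemma quadric_iff:
  fixes x1 x2 x3 x4 :: "'a::field_char_0"
  assumes "N \<noteq> 0"
  shows "formQ q x3 x4 = of_rat N * formQ q x1 x2 \<longleftrightarrow> x1\<^sup>2 = tern (quadric_form q N) (vec x2 x3 x4)"
proof -
  have "(of_rat N :: 'a) \<noteq> 0" using assms by simp
  then show ?thesis
    by (auto simp: formQ_def tern_def quadric_form_def of_rat_minus of_rat_divide field_simps)
qed

lemma formEven_eliminated:
  assumes "x1\<^sup>2 = tern (quadric_form q N) (vec x2 x3 x4)"
  shows "formEven h x1 x2 x3 x4 = tern (eliminated q N h) (vec x2 x3 x4)"
  unfolding formEven_tern assms
  by (simp add: tern_def eliminated_def of_rat_add of_rat_mult algebra_simps)

lemma double_conic_subset_surface:
  assumes "d \<ge> 2" "N \<noteq> 0"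
  shows "double_conic (quadric_form q N) (eliminated q N (quotG q d c b a N)) \<subseteq> surface q d c b a"
proof
  fix x assume x: "x \<in> double_conic (quadric_form q N) (eliminated q N (quotG q d c b a N))"
  obtain x1 x2 x3 x4 where xx: "x = (x1, x2, x3, x4)" by (metis prod_cases4)
  have eq: "x1\<^sup>2 = tern (quadric_form q N) (vec x2 x3 x4)"
    "tern (eliminated q N (quotG q d c b a N)) (vec x2 x3 x4) = 0"
    using x by (simp_all add: double_conic_def xx)
  then have "formG q d c b a x1 x2 x3 x4 = 0"
    using formG_on_quadric[OF assms(1) quadric_iff[OF assms(2), THEN iffD2, OF eq(1)]]
      formEven_eliminated[OF eq(1)] by simp
  then show "x \<in> surface q d c b a" by (simp add: surface_def xx)
qed

section \<open>The invariant of the RC operation\<close>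

lemma quadratic_second_root:
  fixes u v w x y :: rat
  assumes root: "u * x\<^sup>2 + v * x * y + w * y\<^sup>2 = 0" and xy: "(x, y) \<noteq> (0, 0)"
  shows "\<exists>z1 z2. \<forall>x1 x2. u * x1\<^sup>2 + v * x1 * x2 + w * x2\<^sup>2 = (y * x1 - x * x2) * (z2 * x1 - z1 * x2)"
proof (cases "y = 0")
  case False
  define z2 z1 where "z2 = u / y" and "z1 = - (v + x * z2) / y"
  have 1: "y * z2 = u" using False by (simp add: z2_def)
  have 2: "y * z1 = - (v + x * z2)" using False by (simp add: z1_def)
  have "y * y * (x * z1 - w) = x * y * (y * z1) - w * y * y" by (simp add: algebra_simps)
  also have "\<dots> = - (x * y * v + x * x * (y * z2) + w * y * y)" unfolding 2 by (simp add: algebra_simps)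
  also have "\<dots> = 0" unfolding 1 using root by (simp add: power2_eq_square algebra_simps)
  finally have 3: "x * z1 = w" using False by simp
  have "u * x1\<^sup>2 + v * x1 * x2 + w * x2\<^sup>2 = (y * x1 - x * x2) * (z2 * x1 - z1 * x2)" for x1 x2
  proof -
    have "(y * x1 - x * x2) * (z2 * x1 - z1 * x2) = (y * z2) * x1\<^sup>2 - (y * z1 + x * z2) * x1 * x2 + (x * z1) * x2\<^sup>2"
      by (simp add: power2_eq_square algebra_simps)
    then show ?thesis unfolding 1 2 3 by simp
  qed
  then show ?thesis by blast
next
  case True
  then have x: "x \<noteq> 0" using xy by simp
  then have u: "u = 0" using root True by simp
  have "u * x1\<^sup>2 + v * x1 * x2 + w * x2\<^sup>2 = (y * x1 - x * x2) * (- v / x * x1 - w / x * x2)" for x1 x2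
    using x by (simp add: True u power2_eq_square field_simps)
  then show ?thesis by blast
qed

lemma conjugate_exists:
  assumes "d \<ge> 2" and res: "residual_coeffs q d c b a \<phi>0 \<phi>1 \<phi>2" and D3: "D3 q d \<phi>0 \<phi>1 \<phi>2"
    and P: "P \<in> surface q d c b a \<inter> admissible"
  shows "is_conjugate q \<phi>0 \<phi>1 \<phi>2 P (conjugate q \<phi>0 \<phi>1 \<phi>2 P)"
proof -
  obtain x1 x2 x3 x4 where x: "P = (x1, x2, x3, x4)" by (metis prod_cases4)
  have G: "formG q d c b a x1 x2 x3 x4 = 0" and nz: "(x1, x2) \<noteq> (0, 0)" "(x3, x4) \<noteq> (0, 0)"
    using P by (auto simp: surface_def admissible_def x)
  define y where "y = formQ q x1 x2"
  have yd: "y ^ (d - 1) \<noteq> 0" using D3 nz(1) unfolding D3_def y_def by blast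
  then have y: "y \<noteq> 0" using \<open>d \<ge> 2\<close> by auto
  have y_eq: "y = x1\<^sup>2 + q * x2\<^sup>2" by (simp add: y_def formQ_def)
  \<comment> \<open>Cramer's rule for the two linear equations, whose determinant is \<open>y\<close>.\<close>
  define m1 m2 where "m1 = (x1 * x3 - q * x2 * x4) / y" and "m2 = (x1 * x4 + x2 * x3) / y"
  have m: "m1 * y = x1 * x3 - q * x2 * x4" "m2 * y = x1 * x4 + x2 * x3"
    using y by (simp_all add: m1_def m2_def)
  have "y * formB1 q m1 m2 x1 x2 = (m1 * y) * x1 + q * (m2 * y) * x2"
    by (simp add: formB1_def algebra_simps)
  also have "\<dots> = y * x3" unfolding m by (simp add: y_eq power2_eq_square algebra_simps)
  finally have B1: "x3 = formB1 q m1 m2 x1 x2" using y by simp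
  have "y * formB2 m1 m2 x1 x2 = (m2 * y) * x1 - (m1 * y) * x2"
    by (simp add: formB2_def algebra_simps)
  also have "\<dots> = y * x4" unfolding m by (simp add: y_eq power2_eq_square algebra_simps)
  finally have B2: "x4 = formB2 m1 m2 x1 x2" using y by simp
  have "(m1, m2) \<noteq> (0, 0)" using B1 B2 nz(2) by (auto simp: formB1_def formB2_def)
  then have phi: "\<not> (\<phi>0 m1 m2 = 0 \<and> \<phi>1 m1 m2 = 0 \<and> \<phi>2 m1 m2 = 0)"
    using D3 unfolding D3_def by blast
  have "y ^ (d - 1) * (\<phi>0 m1 m2 * x1\<^sup>2 + \<phi>1 m1 m2 * x1 * x2 + \<phi>2 m1 m2 * x2\<^sup>2) = 0"
    using res G unfolding residual_coeffs_def B1[symmetric] y_def by (metis B1 B2)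
  then have "\<phi>0 m1 m2 * x1\<^sup>2 + \<phi>1 m1 m2 * x1 * x2 + \<phi>2 m1 m2 * x2\<^sup>2 = 0"
    using yd by (metis mult_eq_0_iff)
  then obtain z1 z2 where z: "\<And>u v. \<phi>0 m1 m2 * u\<^sup>2 + \<phi>1 m1 m2 * u * v + \<phi>2 m1 m2 * v\<^sup>2
      = (x2 * u - x1 * v) * (z2 * u - z1 * v)"
    using quadratic_second_root nz(1) by blast
  have "(z1, z2) \<noteq> (0, 0)"
  proof
    assume "(z1, z2) = (0, 0)"
    then have 0: "\<phi>0 m1 m2 * u\<^sup>2 + \<phi>1 m1 m2 * u * v + \<phi>2 m1 m2 * v\<^sup>2 = 0" for u v using z by simp
    show False using 0[of 1 0] 0[of 0 1] 0[of 1 1] phi by simp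
  qed
  then have "is_conjugate q \<phi>0 \<phi>1 \<phi>2 P (z1, z2, formB1 q m1 m2 z1 z2, formB2 m1 m2 z1 z2)"
    unfolding is_conjugate_def x using B1 B2 z
    by (simp only: split) (intro exI[of _ m1] exI[of _ m2] exI[of _ 1], simp)
  then show ?thesis unfolding conjugate_def by (rule someI)
qed

definition norm_ratio :: "rat \<Rightarrow> rat quad \<Rightarrow> rat" where
  "norm_ratio q = (\<lambda>(x1, x2, x3, x4). formQ q x3 x4 / formQ q x1 x2)"

text \<open>A point and its conjugate have the same \<open>(m1, m2)\<close>, and \<open>Q(B1, B2) = Q(m1, m2) Q(x1, x2)\<close>.\<close>

lemma norm_ratio_RC:
  assumes d: "d \<ge> 2" and res: "residual_coeffs q d c b a \<phi>0 \<phi>1 \<phi>2" and D3: "D3 q d \<phi>0 \<phi>1 \<phi>2"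
    and P: "P \<in> surface q d c b a \<inter> admissible"
  shows "norm_ratio q (RC q \<phi>0 \<phi>1 \<phi>2 P) = norm_ratio q P"
proof -
  have aniso: "formQ q u v \<noteq> 0" if "(u, v) \<noteq> (0, 0)" for u v :: rat
    using D3 that d unfolding D3_def by (metis power_eq_0_iff zero_less_diff less_le_trans one_less_numeral_iff semiring_norm(76))
  obtain x1 x2 x3 x4 where x: "P = (x1, x2, x3, x4)" by (metis prod_cases4)
  obtain z1 z2 z3 z4 where z: "conjugate q \<phi>0 \<phi>1 \<phi>2 P = (z1, z2, z3, z4)" by (metis prod_cases4)
  obtain m1 m2 where m: "x3 = formB1 q m1 m2 x1 x2" "x4 = formB2 m1 m2 x1 x2" "(z1, z2) \<noteq> (0, 0)"
    "z3 = formB1 q m1 m2 z1 z2" "z4 = formB2 m1 m2 z1 z2"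
    using conjugate_exists[OF assms, unfolded z, unfolded x] unfolding is_conjugate_def by auto
  have "formQ q x1 x2 \<noteq> 0" "formQ q z1 z2 \<noteq> 0"
    using aniso m(3) P by (auto simp: admissible_def x)
  then have "norm_ratio q P = formQ q m1 m2" "norm_ratio q (conjugate q \<phi>0 \<phi>1 \<phi>2 P) = formQ q m1 m2"
    unfolding z unfolding x by (simp_all add: norm_ratio_def m formQ_B)
  moreover have "norm_ratio q (reflection R) = norm_ratio q R" for R
    by (cases R) (simp add: norm_ratio_def reflection_def formQ_def)
  ultimately show ?thesis by (simp add: RC_def)
qed

theorem mainTheorem7:
  fixes q :: rat and d :: nat
    and c :: "nat \<Rightarrow> nat \<Rightarrow> rat" and b :: "nat \<Rightarrow> int" and a :: "nat \<Rightarrow> int"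
    and \<phi>0 \<phi>1 \<phi>2 :: "rat \<Rightarrow> rat \<Rightarrow> rat" and P :: "rat quad"
  assumes "2 * d \<ge> 4"
    and "residual_coeffs q d c b a \<phi>0 \<phi>1 \<phi>2"
    and "D1 q d c b a" and "D2 q d c b a" and "D3 q d \<phi>0 \<phi>1 \<phi>2"
    and "\<forall>n. (RC q \<phi>0 \<phi>1 \<phi>2 ^^ n) P \<in> surface q d c b a \<inter> admissible"
    and "\<forall>i j. i \<noteq> j \<longrightarrow>
           \<not> same_point ((RC q \<phi>0 \<phi>1 \<phi>2 ^^ i) P) ((RC q \<phi>0 \<phi>1 \<phi>2 ^^ j) P)"
  shows "\<exists>V g. geom_irreducible_curve_over_Q V \<and> V \<subseteq> surface q d c b a \<and>
           has_geometric_genus V g \<and> (g = 0 \<or> g = 1)"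
proof -
  have d: "d \<ge> 2" using assms(1) by simp
  define T where "T n = (RC q \<phi>0 \<phi>1 \<phi>2 ^^ n) P" for n
  define N where "N = norm_ratio q P"
  have T: "T n \<in> surface q d c b a \<inter> admissible" for n using assms(6) by (simp add: T_def)
  have TN: "norm_ratio q (T n) = N" for n
  proof (induction n)
    case 0
    then show ?case by (simp add: T_def N_def)
  next
    case (Suc n)
    have "T (Suc n) = RC q \<phi>0 \<phi>1 \<phi>2 (T n)" by (simp add: T_def)
    then show ?case using norm_ratio_RC[OF d assms(2,5) T[of n]] Suc by simp
  qed
  have aniso: "formQ q u v \<noteq> 0" if "(u, v) \<noteq> (0, 0)" for u v :: rat
    using assms(5) that d unfolding D3_def by (metis power_eq_0_iff zero_less_diff less_le_trans one_less_numeral_iff semiring_norm(76))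
  define x where "x n = fst (T n)" for n
  define y where "y n = (case T n of (x1, x2, x3, x4) \<Rightarrow> vec x2 x3 x4)" for n
  have T_eq: "T n = (x n, y n 2, y n 3, y n 4)" for n
    by (cases "T n") (simp add: x_def y_def)
  have vec_y: "vec (y n 2) (y n 3) (y n 4) = y n" for n
    by (cases "T n") (simp add: y_def)
  have adm: "(x n, y n 2) \<noteq> (0, 0)" "(y n 3, y n 4) \<noteq> (0, 0)" for n
    using T[of n] by (auto simp: admissible_def T_eq)
  have quad: "formQ q (y n 3) (y n 4) = N * formQ q (x n) (y n 2)" for n
    using TN[of n] aniso[OF adm(1)[of n]] by (simp add: norm_ratio_def T_eq field_simps)
  have N0: "N \<noteq> 0" using quad[of 0] aniso[OF adm(2)[of 0]] by auto
  let ?S = "quadric_form q N" and ?C = "eliminated q N (quotG q d c b a N)"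
  have S: "(x n)\<^sup>2 = tern ?S (y n)" for n
    using quadric_iff[OF N0, of q "y n 3" "y n 4" "x n" "y n 2"] quad[of n] by (simp add: vec_y)
  have C: "tern ?C (y n) = 0" for n
  proof -
    have "formG q d c b a (x n) (y n 2) (y n 3) (y n 4) = 0"
      using T[of n] by (simp add: surface_def T_eq)
    then have "formEven (quotG q d c b a N) (x n) (y n 2) (y n 3) (y n 4) = 0"
      using formG_on_quadric[OF d, of q "y n 3" "y n 4" N "x n" "y n 2" c b a] quad[of n]
        aniso[OF adm(1)[of n]] by simp
    then show ?thesis
      using formEven_eliminated[of "x n" q N "y n 2" "y n 3" "y n 4"] S[of n] by (simp add: vec_y)
  qed
  have "curve_in (double_conic ?S ?C)"
  proof (rule infinitely_many_points_curve[OF S C])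
    show "\<exists>i\<in>{2, 3, 4}. y n i \<noteq> 0" for n using adm(2)[of n] by auto
    show "\<exists>i\<in>{2, 3, 4}. y m i \<noteq> l * y n i" if "n \<noteq> m" "l \<noteq> 0" "x m = l * x n" for n m l
    proof (rule ccontr)
      assume "\<not> ?thesis"
      then have "same_point (T n) (T m)" using that by (auto simp: same_point_def T_eq)
      then show False using assms(7) that(1) by (simp add: T_def)
    qed
  qed
  then show ?thesis
    unfolding curve_in_def using double_conic_subset_surface[OF d N0, of q c b a] by blast
qed

end
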